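(* Let $R$ be a graded-commutative noetherian ring, $\mathcal{T}$ a compactly generated $R$-linear triangulated category and $M\in\mathcal T$. For any sequence of elements $x_1,\ldots,x_t$ in $R$ ($t\ge1$), there exist isomorphisms $$\mathrm{hocolim}_n V_{t,n}\xrightarrow{\cong}L_{\mathcal V(x_1,\ldots,x_t)}M\qquad\text{and}\qquad \mathrm{hocolim}_n\Sigma^{-t}M/\!\!/(x_1^n,\ldots,x_t^n)\xrightarrow{\cong}\Gamma_{\mathcal V(x_1,\ldots,x_t)}M$$ such that for any $\ell\ge1$: (i) the composite $\Sigma^{-t}M/\!\!/(x_1^\ell,\ldots,x_t^\ell)\to\mathrm{hocolim}_n\Sigma^{-t}M/\!\!/(x_1^n,\ldots,x_t^n)\xrightarrow{\cong}\Gamma_{\mathcal V(x_1,\ldots,x_t)}M\to M$ equals the canonical morphism $\Sigma^{-t}M/\!\!/(x_1^\ell,\ldots,x_t^\ell)\to M$; and (ii) the composite $M\to V_{t,\ell}\to\mathrm{hocolim}_nV_{t,n}\xrightarrow{\cong}L_{\mathcal V(x_1,\ldots,x_t)}M$ equals the canonical morphism $M\to L_{\mathcal V(x_1,\ldots,x_t)}M$.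
   Context: A graded-commutative ring is a $\mathbb{Z}$-graded ring $R=\bigoplus_n R_n$ with $xy=(-1)^{|x||y|}yx$; all elements and ideals are homogeneous. A triangulated category $\mathcal{T}$ with suspension $\Sigma$ is $R$-linear if it is equipped with a homomorphism of graded rings $R\to Z^*(\mathcal{T})=\bigoplus_{n\in\mathbb{Z}}\{\alpha\colon \mathrm{id}_{\mathcal T}\to\Sigma^n \text{ natural}\mid \alpha\Sigma=(-1)^n\Sigma\alpha\}$; so $x\in R$ induces natural morphisms $x\colon M\to\Sigma^{|x|}M$. Koszul objects: $M/\!\!/x$ is the cone of $x\colon M\to\Sigma^{|x|}M$, with exact triangle $M\xrightarrow{x}\Sigma^{|x|}M\to M/\!\!/x\to\Sigma M$; inductively $M/\!\!/(x_1,\ldots,x_t)=(M/\!\!/(x_1,\ldots,x_{t-1}))/\!\!/x_t$. The canonical morphism $\Sigma^{-t}M/\!\!/(x_1,\ldots,x_t)\to M$ is the composition $\Sigma^{-t}M/\!\!/(x_1,\ldots,x_t)\to\Sigma^{-t+1}M/\!\!/(x_1,\ldots,x_{t-1})\to\cdots\to M$ of (de)suspensions of the last maps of these triangles. Systems: write $K_{s,n}=\Sigma^{-s}M/\!\!/(x_1^n,\ldots,x_s^n)$. Morphisms $u_{s,n}\colon K_{s,n}\to K_{s,n+1}$ are constructed inductively: $u_{0,n}=\mathrm{id}_M$, and $u_{s,n}$ is any morphism such that $(u_{s,n},\,u_{s-1,n},\,x_s\circ\Sigma^{n|x_s|}u_{s-1,n})$ is a morphism from the exact triangle $K_{s,n}\to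 K_{s-1,n}\xrightarrow{x_s^n}\Sigma^{n|x_s|}K_{s-1,n}\to\Sigma K_{s,n}$ to the exact triangle $K_{s,n+1}\to K_{s-1,n+1}\xrightarrow{x_s^{n+1}}\Sigma^{(n+1)|x_s|}K_{s-1,n+1}\to\Sigma K_{s,n+1}$. The homotopy colimit of the $K_{t,n}$ is taken along the $u_{t,n}$. $V_{t,n}$ is the cone of the canonical morphism $K_{t,n}\to M$, and $v_{t,n}\colon V_{t,n}\to V_{t,n+1}$ is a morphism such that $(u_{t,n},\mathrm{id}_M,v_{t,n})$ is a morphism from the exact triangle $K_{t,n}\to M\to V_{t,n}\to\Sigma K_{t,n}$ to $K_{t,n+1}\to M\to V_{t,n+1}\to\Sigma K_{t,n+1}$; the homotopy colimit of the $V_{t,n}$ is taken along the $v_{t,n}$. The homotopy colimit of $M_1\xrightarrow{f_1}M_2\xrightarrow{f_2}\cdots$ is defined by the exact triangle $\coprod_nM_n\xrightarrow{\mathrm{id}-f_n}\coprod_nM_n\to\mathrm{hocolim}_nM_n\to\Sigma\coprod_nM_n$; the canonical morphism $M_\ell\to\mathrm{hocolim}_nM_n$ is the composite $M_\ell\to\coprod_nM_n\to\mathrm{hocolim}_nM_n$. Local cohomology and localization: $\mathrm{Spec}(R)$ is the set of homogeneous primes, $\mathcal{V}(\mathfrak a)=\{\mathfrak p\mid\mathfrak a\subseteq\mathfrak p\}$. For $\mathcal{V}\subseteq\mathrm{Spec}(R)$ specialization closed, $\mathcal{T}_{\mathcal V}$ is the localizing subcategory generated by the compact objects $D$ with $\mathrm{End}^*_{\mathcal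 T}(D)_{\mathfrak p}=0$ for all $\mathfrak p\notin\mathcal V$, where $\mathrm{End}^*_{\mathcal T}(D)=\bigoplus_n\mathrm{Hom}_{\mathcal T}(D,\Sigma^nD)$. The functor $\Gamma_{\mathcal V}$ is the composite of the right adjoint of the inclusion $\mathcal{T}_{\mathcal V}\to\mathcal{T}$ with the inclusion, and $L_{\mathcal V}$ is the associated localization functor with kernel $\mathcal T_{\mathcal V}$; there is a functorial exact triangle $\Gamma_{\mathcal V}M\to M\to L_{\mathcal V}M\to\Sigma\Gamma_{\mathcal V}M$ providing the canonical morphisms. *)

theory Defs
  imports "HOL-Algebra.Ideal" "HOL-Algebra.Product_Groups" "HOL-Library.Equipollence" "HOL-Library.Countable_Set"
begin

section \<open>Preadditive categories\<close>

text \<open>Arrows know their domain and codomain; \<open>Cmp T g f\<close> is the composite ``first \<open>f\<close>, then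
  \<open>g\<close>''.  The operations are constrained only on the carriers \<open>Obj T\<close> and \<open>Arr T\<close>.\<close>

record ('o, 'm) add_cat =
  Obj :: "'o set"
  Arr :: "'m set"
  Dom :: "'m \<Rightarrow> 'o"
  Cod :: "'m \<Rightarrow> 'o"
  Idn :: "'o \<Rightarrow> 'm"
  Cmp :: "'m \<Rightarrow> 'm \<Rightarrow> 'm"  (infixr \<open>\<cdot>\<index>\<close> 75)
  Add :: "'m \<Rightarrow> 'm \<Rightarrow> 'm"
  Zer :: "'o \<Rightarrow> 'o \<Rightarrow> 'm"

definition Hom :: "('o, 'm, 'z) add_cat_scheme \<Rightarrow> 'o \<Rightarrow> 'o \<Rightarrow> 'm set" where
  "Hom T X Y = {f \<in> Arr T. Dom T f = X \<and> Cod T f = Y}"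

definition hom_group :: "('o, 'm, 'z) add_cat_scheme \<Rightarrow> 'o \<Rightarrow> 'o \<Rightarrow> 'm monoid" where
  "hom_group T X Y = \<lparr>carrier = Hom T X Y, mult = Add T, one = Zer T X Y\<rparr>"

definition neg :: "('o, 'm, 'z) add_cat_scheme \<Rightarrow> 'm \<Rightarrow> 'm" where
  "neg T f = inv\<^bsub>hom_group T (Dom T f) (Cod T f)\<^esub> f"

text \<open>The arrow $(-1)^k f$.\<close>

definition signed :: "('o, 'm, 'z) add_cat_scheme \<Rightarrow> int \<Rightarrow> 'm \<Rightarrow> 'm" where
  "signed T k f = (if even k then f else neg T f)"

definition category :: "('o, 'm, 'z) add_cat_scheme \<Rightarrow> bool" where
  "category T \<longleftrightarrow>
     (\<forall>f \<in> Arr T. Dom T f \<in> Obj T \<and> Cod T f \<in> Obj T) \<and>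
     (\<forall>X \<in> Obj T. Idn T X \<in> Hom T X X) \<and>
     (\<forall>f \<in> Arr T. \<forall>g \<in> Arr T. Cod T f = Dom T g \<longrightarrow> g \<cdot>\<^bsub>T\<^esub> f \<in> Hom T (Dom T f) (Cod T g)) \<and>
     (\<forall>f \<in> Arr T. f \<cdot>\<^bsub>T\<^esub> Idn T (Dom T f) = f \<and> Idn T (Cod T f) \<cdot>\<^bsub>T\<^esub> f = f) \<and>
     (\<forall>f \<in> Arr T. \<forall>g \<in> Arr T. \<forall>h \<in> Arr T. Cod T f = Dom T g \<longrightarrow> Cod T g = Dom T h \<longrightarrow>
        h \<cdot>\<^bsub>T\<^esub> (g \<cdot>\<^bsub>T\<^esub> f) = (h \<cdot>\<^bsub>T\<^esub> g) \<cdot>\<^bsub>T\<^esub> f)"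

definition preadditive :: "('o, 'm, 'z) add_cat_scheme \<Rightarrow> bool" where
  "preadditive T \<longleftrightarrow> category T \<and>
     (\<forall>X \<in> Obj T. \<forall>Y \<in> Obj T. comm_group (hom_group T X Y)) \<and>
     (\<forall>X \<in> Obj T. \<forall>Y \<in> Obj T. \<forall>Z \<in> Obj T. \<forall>f \<in> Hom T X Y. \<forall>f' \<in> Hom T X Y.
        \<forall>g \<in> Hom T Y Z. \<forall>g' \<in> Hom T Y Z.
          g \<cdot>\<^bsub>T\<^esub> Add T f f' = Add T (g \<cdot>\<^bsub>T\<^esub> f) (g \<cdot>\<^bsub>T\<^esub> f') \<and>
          Add T g g' \<cdot>\<^bsub>T\<^esub> f = Add T (g \<cdot>\<^bsub>T\<^esub> f) (g' \<cdot>\<^bsub>T\<^esub> f))"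

definition zero_object :: "('o, 'm, 'z) add_cat_scheme \<Rightarrow> 'o \<Rightarrow> bool" where
  "zero_object T Z \<longleftrightarrow> Z \<in> Obj T \<and>
     (\<forall>Y \<in> Obj T. (\<exists>!f. f \<in> Hom T Z Y) \<and> (\<exists>!f. f \<in> Hom T Y Z))"

definition isomorphism :: "('o, 'm, 'z) add_cat_scheme \<Rightarrow> 'o \<Rightarrow> 'o \<Rightarrow> 'm \<Rightarrow> bool" where
  "isomorphism T X Y f \<longleftrightarrow> f \<in> Hom T X Y \<and>
     (\<exists>g \<in> Hom T Y X. g \<cdot>\<^bsub>T\<^esub> f = Idn T X \<and> f \<cdot>\<^bsub>T\<^esub> g = Idn T Y)"

definition coproduct ::
  "('o, 'm, 'z) add_cat_scheme \<Rightarrow> 'i set \<Rightarrow> ('i \<Rightarrow> 'o) \<Rightarrow> 'o \<Rightarrow> ('i \<Rightarrow> 'm) \<Rightarrow> bool" where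
  "coproduct T I X P inc \<longleftrightarrow> P \<in> Obj T \<and> (\<forall>i \<in> I. inc i \<in> Hom T (X i) P) \<and>
     (\<forall>Y \<in> Obj T. \<forall>g. (\<forall>i \<in> I. g i \<in> Hom T (X i) Y) \<longrightarrow>
        (\<exists>!h. h \<in> Hom T P Y \<and> (\<forall>i \<in> I. h \<cdot>\<^bsub>T\<^esub> inc i = g i)))"

definition additive_category :: "('o, 'm, 'z) add_cat_scheme \<Rightarrow> bool" where
  "additive_category T \<longleftrightarrow> preadditive T \<and> (\<exists>Z. zero_object T Z) \<and>
     (\<forall>X. (\<forall>i. X i \<in> Obj T) \<longrightarrow> (\<exists>P inc. coproduct T (UNIV :: bool set) X P inc))"

record ('o, 'm) func =
  onO :: "'o \<Rightarrow> 'o"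
  onA :: "'m \<Rightarrow> 'm"

definition endofunctor :: "('o, 'm, 'z) add_cat_scheme \<Rightarrow> ('o, 'm) func \<Rightarrow> bool" where
  "endofunctor T F \<longleftrightarrow>
     (\<forall>X \<in> Obj T. onO F X \<in> Obj T \<and> onA F (Idn T X) = Idn T (onO F X)) \<and>
     (\<forall>f \<in> Arr T. onA F f \<in> Hom T (onO F (Dom T f)) (onO F (Cod T f))) \<and>
     (\<forall>f \<in> Arr T. \<forall>g \<in> Arr T. Cod T f = Dom T g \<longrightarrow>
        onA F (g \<cdot>\<^bsub>T\<^esub> f) = onA F g \<cdot>\<^bsub>T\<^esub> onA F f)"

definition additive_functor :: "('o, 'm, 'z) add_cat_scheme \<Rightarrow> ('o, 'm) func \<Rightarrow> bool" where
  "additive_functor T F \<longleftrightarrow> endofunctor T F \<and>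
     (\<forall>X \<in> Obj T. \<forall>Y \<in> Obj T. \<forall>f \<in> Hom T X Y. \<forall>g \<in> Hom T X Y.
        onA F (Add T f g) = Add T (onA F f) (onA F g))"

definition nat_trans ::
  "('o, 'm, 'z) add_cat_scheme \<Rightarrow> ('o, 'm) func \<Rightarrow> ('o, 'm) func \<Rightarrow> ('o \<Rightarrow> 'm) \<Rightarrow> bool" where
  "nat_trans T F G \<alpha> \<longleftrightarrow> (\<forall>X \<in> Obj T. \<alpha> X \<in> Hom T (onO F X) (onO G X)) \<and>
     (\<forall>f \<in> Arr T. \<alpha> (Cod T f) \<cdot>\<^bsub>T\<^esub> onA F f = onA G f \<cdot>\<^bsub>T\<^esub> \<alpha> (Dom T f))"

definition id_functor :: "('o, 'm) func" where
  "id_functor = \<lparr>onO = (\<lambda>X. X), onA = (\<lambda>f. f)\<rparr>"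

definition comp_functor :: "('o, 'm) func \<Rightarrow> ('o, 'm) func \<Rightarrow> ('o, 'm) func" where
  "comp_functor G F = \<lparr>onO = (\<lambda>X. onO G (onO F X)), onA = (\<lambda>f. onA G (onA F f))\<rparr>"

section \<open>Triangulated categories\<close>

text \<open>The suspension is a strict automorphism (as in Verdier's definition), so that the functors
  $\Sigma^n$, $n \in \mathbb{Z}$, satisfy $\Sigma^m\Sigma^n = \Sigma^{m+n}$ on the nose.  An element
  \<open>(f, g, h)\<close> of \<open>Tri T\<close> is an exact triangle $X \to Y \to Z \to \Sigma X$.\<close>

record ('o, 'm) tri_cat = "('o, 'm) add_cat" +
  SigO :: "'o \<Rightarrow> 'o"
  SigA :: "'m \<Rightarrow> 'm"
  Tri :: "('m \<times> 'm \<times> 'm) set"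

definition suspO :: "('o, 'm, 'z) tri_cat_scheme \<Rightarrow> int \<Rightarrow> 'o \<Rightarrow> 'o" where
  "suspO T n X = (if n \<ge> 0 then (SigO T ^^ nat n) X
                  else (inv_into (Obj T) (SigO T) ^^ nat (- n)) X)"

definition suspA :: "('o, 'm, 'z) tri_cat_scheme \<Rightarrow> int \<Rightarrow> 'm \<Rightarrow> 'm" where
  "suspA T n f = (if n \<ge> 0 then (SigA T ^^ nat n) f
                  else (inv_into (Arr T) (SigA T) ^^ nat (- n)) f)"

definition susp :: "('o, 'm, 'z) tri_cat_scheme \<Rightarrow> int \<Rightarrow> ('o, 'm) func" where
  "susp T n = \<lparr>onO = suspO T n, onA = suspA T n\<rparr>"

definition candidate_triangle :: "('o, 'm, 'z) tri_cat_scheme \<Rightarrow> 'm \<times> 'm \<times> 'm \<Rightarrow> bool" where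
  "candidate_triangle T = (\<lambda>(f, g, h). f \<in> Arr T \<and> g \<in> Arr T \<and> h \<in> Arr T \<and>
     Cod T f = Dom T g \<and> Cod T g = Dom T h \<and> Cod T h = SigO T (Dom T f))"

definition triangle_map ::
  "('o, 'm, 'z) tri_cat_scheme \<Rightarrow> 'm \<times> 'm \<times> 'm \<Rightarrow> 'm \<times> 'm \<times> 'm \<Rightarrow> 'm \<Rightarrow> 'm \<Rightarrow> 'm \<Rightarrow> bool" where
  "triangle_map T = (\<lambda>(f, g, h) (f', g', h') a b c.
     a \<in> Hom T (Dom T f) (Dom T f') \<and>
     b \<in> Hom T (Dom T g) (Dom T g') \<and>
     c \<in> Hom T (Dom T h) (Dom T h') \<and>
     b \<cdot>\<^bsub>T\<^esub> f = f' \<cdot>\<^bsub>T\<^esub> a \<and>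
     c \<cdot>\<^bsub>T\<^esub> g = g' \<cdot>\<^bsub>T\<^esub> b \<and>
     SigA T a \<cdot>\<^bsub>T\<^esub> h = h' \<cdot>\<^bsub>T\<^esub> c)"

definition triangulated :: "('o, 'm, 'z) tri_cat_scheme \<Rightarrow> bool" where
  "triangulated T \<longleftrightarrow> additive_category T \<and>
     \<comment> \<open>suspension\<close>
     additive_functor T \<lparr>onO = SigO T, onA = SigA T\<rparr> \<and>
     bij_betw (SigO T) (Obj T) (Obj T) \<and> bij_betw (SigA T) (Arr T) (Arr T) \<and>
     (\<forall>t \<in> Tri T. candidate_triangle T t) \<and>
     \<comment> \<open>TR1\<close>
     (\<forall>t t' a b c. t \<in> Tri T \<longrightarrow> candidate_triangle T t' \<longrightarrow> triangle_map T t t' a b c \<longrightarrow>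
        isomorphism T (Dom T a) (Cod T a) a \<longrightarrow> isomorphism T (Dom T b) (Cod T b) b \<longrightarrow>
        isomorphism T (Dom T c) (Cod T c) c \<longrightarrow> t' \<in> Tri T) \<and>
     (\<forall>X \<in> Obj T. \<forall>Z. zero_object T Z \<longrightarrow> (Idn T X, Zer T X Z, Zer T Z (SigO T X)) \<in> Tri T) \<and>
     (\<forall>f \<in> Arr T. \<exists>g h. (f, g, h) \<in> Tri T) \<and>
     \<comment> \<open>TR2\<close>
     (\<forall>f g h. candidate_triangle T (f, g, h) \<longrightarrow>
        ((f, g, h) \<in> Tri T \<longleftrightarrow> (g, h, neg T (SigA T f)) \<in> Tri T)) \<and>
     \<comment> \<open>TR3\<close>
     (\<forall>f g h f' g' h' a b. (f, g, h) \<in> Tri T \<longrightarrow> (f', g', h') \<in> Tri T \<longrightarrow>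
        a \<in> Hom T (Dom T f) (Dom T f') \<longrightarrow> b \<in> Hom T (Dom T g) (Dom T g') \<longrightarrow>
        b \<cdot>\<^bsub>T\<^esub> f = f' \<cdot>\<^bsub>T\<^esub> a \<longrightarrow> (\<exists>c. triangle_map T (f, g, h) (f', g', h') a b c)) \<and>
     \<comment> \<open>TR4, the octahedral axiom\<close>
     (\<forall>f f' f'' g g' g'' k k'. Cod T f = Dom T g \<longrightarrow>
        (f, f', f'') \<in> Tri T \<longrightarrow> (g, g', g'') \<in> Tri T \<longrightarrow> (g \<cdot>\<^bsub>T\<^esub> f, k, k') \<in> Tri T \<longrightarrow>
        (\<exists>a b. (a, b, SigA T f' \<cdot>\<^bsub>T\<^esub> g'') \<in> Tri T \<and>
               a \<in> Hom T (Cod T f') (Cod T k) \<and> b \<in> Hom T (Cod T k) (Cod T g') \<and>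
               a \<cdot>\<^bsub>T\<^esub> f' = k \<cdot>\<^bsub>T\<^esub> g \<and> k' \<cdot>\<^bsub>T\<^esub> a = f'' \<and>
               b \<cdot>\<^bsub>T\<^esub> k = g' \<and> g'' \<cdot>\<^bsub>T\<^esub> b = SigA T f \<cdot>\<^bsub>T\<^esub> k'))"

definition exact_functor :: "('o, 'm, 'z) tri_cat_scheme \<Rightarrow> ('o, 'm) func \<Rightarrow> bool" where
  "exact_functor T F \<longleftrightarrow> additive_functor T F \<and>
     (\<exists>\<theta>. nat_trans T (comp_functor F (susp T 1)) (comp_functor (susp T 1) F) \<theta> \<and>
          (\<forall>X \<in> Obj T. isomorphism T (onO F (SigO T X)) (SigO T (onO F X)) (\<theta> X)) \<and>
          (\<forall>f g h. (f, g, h) \<in> Tri T \<longrightarrow>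
             (onA F f, onA F g, \<theta> (Dom T f) \<cdot>\<^bsub>T\<^esub> onA F h) \<in> Tri T))"

section \<open>Smallness, compact generation, localizing subcategories\<close>

text \<open>A category with nonzero objects cannot have coproducts indexed by all sets as large as its set
  of arrows, so ``small'' must be made explicit.  A set is small if its cardinality is strictly below
  that of the type \<open>'u\<close>; usual foundations are recovered when \<open>'u\<close> has the cardinality of a
  Grothendieck universe, but nothing beyond smallness of countable sets will be required.
  Index sets may be taken to be subsets of \<open>'u\<close>, as every small set is equipotent to one.\<close>

definition small :: "'u itself \<Rightarrow> 'a set \<Rightarrow> bool" where
  "small U A \<longleftrightarrow> A \<prec> (UNIV :: 'u set)"

definition has_small_coproducts :: "'u itself \<Rightarrow> ('o, 'm, 'z) add_cat_scheme \<Rightarrow> bool" where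
  "has_small_coproducts U T \<longleftrightarrow>
     (\<forall>(I :: 'u set) X. small U I \<longrightarrow> (\<forall>i \<in> I. X i \<in> Obj T) \<longrightarrow> (\<exists>P inc. coproduct T I X P inc))"

text \<open>The canonical map $\bigoplus_i \mathrm{Hom}(C, X_i) \to \mathrm{Hom}(C, \coprod_i X_i)$ is
  bijective.\<close>

definition compact :: "'u itself \<Rightarrow> ('o, 'm, 'z) add_cat_scheme \<Rightarrow> 'o \<Rightarrow> bool" where
  "compact U T C \<longleftrightarrow> C \<in> Obj T \<and>
     (\<forall>(I :: 'u set) X P inc. small U I \<longrightarrow> (\<forall>i \<in> I. X i \<in> Obj T) \<longrightarrow> coproduct T I X P inc \<longrightarrow>
        bij_betw
          (\<lambda>\<phi>. finprod (hom_group T C P) (\<lambda>i. inc i \<cdot>\<^bsub>T\<^esub> \<phi> i) {i \<in> I. \<phi> i \<noteq> Zer T C (X i)})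
          (carrier (sum_group I (\<lambda>i. hom_group T C (X i))))
          (Hom T C P))"

definition compactly_generated :: "'u itself \<Rightarrow> ('o, 'm, 'z) tri_cat_scheme \<Rightarrow> bool" where
  "compactly_generated U T \<longleftrightarrow> has_small_coproducts U T \<and>
     (\<exists>S. small U S \<and> (\<forall>C \<in> S. compact U T C) \<and>
        (\<forall>X \<in> Obj T. (\<forall>C \<in> S. \<forall>n. Hom T C (suspO T n X) = {Zer T C (suspO T n X)}) \<longrightarrow>
           zero_object T X))"

definition localizing :: "'u itself \<Rightarrow> ('o, 'm, 'z) tri_cat_scheme \<Rightarrow> 'o set \<Rightarrow> bool" where
  "localizing U T S \<longleftrightarrow> S \<subseteq> Obj T \<and> {Z. zero_object T Z} \<subseteq> S \<and>
     (\<forall>X \<in> Obj T. SigO T X \<in> S \<longleftrightarrow> X \<in> S) \<and>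
     (\<forall>f g h. (f, g, h) \<in> Tri T \<longrightarrow>
        (Dom T f \<in> S \<longrightarrow> Dom T g \<in> S \<longrightarrow> Dom T h \<in> S) \<and>
        (Dom T g \<in> S \<longrightarrow> Dom T h \<in> S \<longrightarrow> Dom T f \<in> S) \<and>
        (Dom T f \<in> S \<longrightarrow> Dom T h \<in> S \<longrightarrow> Dom T g \<in> S)) \<and>
     (\<forall>(I :: 'u set) X P inc. small U I \<longrightarrow> (\<forall>i \<in> I. X i \<in> S) \<longrightarrow> coproduct T I X P inc \<longrightarrow> P \<in> S)"

definition localizing_generated_by :: "'u itself \<Rightarrow> ('o, 'm, 'z) tri_cat_scheme \<Rightarrow> 'o set \<Rightarrow> 'o set" where
  "localizing_generated_by U T C = \<Inter>{S. localizing U T S \<and> C \<subseteq> S}"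

section \<open>Graded rings\<close>

record 'r graded_ring = "'r ring" +
  gr :: "int \<Rightarrow> 'r set"

definition graded_ring :: "('r, 'z) graded_ring_scheme \<Rightarrow> bool" where
  "graded_ring R \<longleftrightarrow> ring R \<and> (\<forall>n. subgroup (gr R n) (add_monoid R)) \<and>
     \<one>\<^bsub>R\<^esub> \<in> gr R 0 \<and>
     (\<forall>m n. \<forall>x \<in> gr R m. \<forall>y \<in> gr R n. x \<otimes>\<^bsub>R\<^esub> y \<in> gr R (m + n)) \<and>
     (\<forall>r \<in> carrier R. \<exists>!c. (\<forall>n. c n \<in> gr R n) \<and> finite {n. c n \<noteq> \<zero>\<^bsub>R\<^esub>} \<and>
        r = finsum R c {n. c n \<noteq> \<zero>\<^bsub>R\<^esub>})"

definition graded_commutative :: "('r, 'z) graded_ring_scheme \<Rightarrow> bool" where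
  "graded_commutative R \<longleftrightarrow> graded_ring R \<and>
     (\<forall>m n. \<forall>x \<in> gr R m. \<forall>y \<in> gr R n.
        x \<otimes>\<^bsub>R\<^esub> y = (if even (m * n) then y \<otimes>\<^bsub>R\<^esub> x else \<ominus>\<^bsub>R\<^esub> (y \<otimes>\<^bsub>R\<^esub> x)))"

definition homogeneous_ideal :: "('r, 'z) graded_ring_scheme \<Rightarrow> 'r set \<Rightarrow> bool" where
  "homogeneous_ideal R I \<longleftrightarrow> ideal I R \<and>
     (\<forall>r \<in> I. \<exists>c. (\<forall>n. c n \<in> I \<inter> gr R n) \<and> finite {n. c n \<noteq> \<zero>\<^bsub>R\<^esub>} \<and>
        r = finsum R c {n. c n \<noteq> \<zero>\<^bsub>R\<^esub>})"

text \<open>Throughout, elements and ideals are homogeneous, so the noetherian condition and primality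
  refer to homogeneous ideals and elements.\<close>

definition graded_noetherian :: "('r, 'z) graded_ring_scheme \<Rightarrow> bool" where
  "graded_noetherian R \<longleftrightarrow>
     (\<forall>I. homogeneous_ideal R I \<longrightarrow> (\<exists>A. finite A \<and> A \<subseteq> (\<Union>n. gr R n) \<and> I = Idl\<^bsub>R\<^esub> A))"

definition Spec :: "('r, 'z) graded_ring_scheme \<Rightarrow> 'r set set" where
  "Spec R = {p. homogeneous_ideal R p \<and> p \<noteq> carrier R \<and>
     (\<forall>m n. \<forall>x \<in> gr R m. \<forall>y \<in> gr R n. x \<otimes>\<^bsub>R\<^esub> y \<in> p \<longrightarrow> x \<in> p \<or> y \<in> p)}"

definition closed_set :: "('r, 'z) graded_ring_scheme \<Rightarrow> 'r set \<Rightarrow> 'r set set" where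
  "closed_set R I = {p \<in> Spec R. I \<subseteq> p}"

text \<open>Localization of a graded left module $N = \bigoplus_n N_n$ at a homogeneous prime, as a module of
  left fractions with homogeneous denominators outside \<open>p\<close>.  \<open>sm j n a m\<close> is the product of
  $a \in R_j$ and $m \in N_n$.  The triple \<open>(k, s, m)\<close> stands for the fraction $s^{-1} m$ of
  degree \<open>d\<close>, where $|s| = k$ and $|m| = k + d$.  Two fractions are equal if they have a common
  expansion; this (Ore) form of the relation needs no signs.\<close>

definition fractions :: "('r, 'z) graded_ring_scheme \<Rightarrow> 'r set \<Rightarrow> (int \<Rightarrow> 'm set) \<Rightarrow> int \<Rightarrow>
    (int \<times> 'r \<times> 'm) set" where
  "fractions R p N d = {(k, s, m). s \<in> gr R k \<and> s \<notin> p \<and> m \<in> N (k + d)}"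

definition frac_rel :: "('r, 'z) graded_ring_scheme \<Rightarrow> 'r set \<Rightarrow> (int \<Rightarrow> 'm set) \<Rightarrow>
    (int \<Rightarrow> int \<Rightarrow> 'r \<Rightarrow> 'm \<Rightarrow> 'm) \<Rightarrow> int \<Rightarrow> ((int \<times> 'r \<times> 'm) \<times> (int \<times> 'r \<times> 'm)) set" where
  "frac_rel R p N sm d = {((k, s, m), (k', s', m')).
     (k, s, m) \<in> fractions R p N d \<and> (k', s', m') \<in> fractions R p N d \<and>
     (\<exists>j a j' b. a \<in> gr R j \<and> b \<in> gr R j' \<and> j + k = j' + k' \<and>
        a \<otimes>\<^bsub>R\<^esub> s = b \<otimes>\<^bsub>R\<^esub> s' \<and> a \<otimes>\<^bsub>R\<^esub> s \<notin> p \<and> sm j (k + d) a m = sm j' (k' + d) b m')}"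

definition localization :: "('r, 'z) graded_ring_scheme \<Rightarrow> 'r set \<Rightarrow> (int \<Rightarrow> 'm set) \<Rightarrow>
    (int \<Rightarrow> int \<Rightarrow> 'r \<Rightarrow> 'm \<Rightarrow> 'm) \<Rightarrow> int \<Rightarrow> (int \<times> 'r \<times> 'm) set set" where
  "localization R p N sm d = fractions R p N d // frac_rel R p N sm d"

definition localization_zero :: "('r, 'z) graded_ring_scheme \<Rightarrow> 'r set \<Rightarrow> (int \<Rightarrow> 'm set) \<Rightarrow>
    (int \<Rightarrow> int \<Rightarrow> 'r \<Rightarrow> 'm \<Rightarrow> 'm) \<Rightarrow> (int \<Rightarrow> 'm) \<Rightarrow> bool" where
  "localization_zero R p N sm z \<longleftrightarrow>
     (\<forall>d. localization R p N sm d = {frac_rel R p N sm d `` {(0, \<one>\<^bsub>R\<^esub>, z d)}})"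

section \<open>Linear triangulated categories\<close>

definition center :: "('o, 'm, 'z) tri_cat_scheme \<Rightarrow> int \<Rightarrow> ('o \<Rightarrow> 'm) set" where
  "center T n = {\<alpha>. nat_trans T id_functor (susp T n) \<alpha> \<and>
     (\<forall>X \<in> Obj T. \<alpha> (SigO T X) = signed T n (SigA T (\<alpha> X)))}"

text \<open>\<open>act n x M\<close> is the morphism $x \colon M \to \Sigma^n M$ for $x \in R_n$ (the degree is an
  argument since \<open>0\<close> has every degree).  The product in the graded center is the one for which
  evaluation at \<open>M\<close> is a ring homomorphism to $\mathrm{End}^*(M)$, where
  $f g = \Sigma^{|g|}(f) \circ g$.\<close>

definition linear_action :: "('o, 'm, 'z) tri_cat_scheme \<Rightarrow> ('r, 'y) graded_ring_scheme \<Rightarrow>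
    (int \<Rightarrow> 'r \<Rightarrow> 'o \<Rightarrow> 'm) \<Rightarrow> bool" where
  "linear_action T R act \<longleftrightarrow>
     (\<forall>n. \<forall>x \<in> gr R n. act n x \<in> center T n) \<and>
     (\<forall>n. \<forall>x \<in> gr R n. \<forall>y \<in> gr R n. \<forall>M \<in> Obj T.
        act n (x \<oplus>\<^bsub>R\<^esub> y) M = Add T (act n x M) (act n y M)) \<and>
     (\<forall>M \<in> Obj T. act 0 \<one>\<^bsub>R\<^esub> M = Idn T M) \<and>
     (\<forall>m n. \<forall>x \<in> gr R m. \<forall>y \<in> gr R n. \<forall>M \<in> Obj T.
        act (m + n) (x \<otimes>\<^bsub>R\<^esub> y) M = suspA T n (act m x M) \<cdot>\<^bsub>T\<^esub> act n y M)"

definition End_localization_zero :: "('o, 'm, 'z) tri_cat_scheme \<Rightarrow> ('r, 'y) graded_ring_scheme \<Rightarrow>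
    (int \<Rightarrow> 'r \<Rightarrow> 'o \<Rightarrow> 'm) \<Rightarrow> 'o \<Rightarrow> 'r set \<Rightarrow> bool" where
  "End_localization_zero T R act D p \<longleftrightarrow>
     localization_zero R p (\<lambda>n. Hom T D (suspO T n D))
       (\<lambda>j n a f. suspA T n (act j a D) \<cdot>\<^bsub>T\<^esub> f) (\<lambda>n. Zer T D (suspO T n D))"

section \<open>Local cohomology and localization\<close>

definition supported_subcategory :: "'u itself \<Rightarrow> ('o, 'm, 'z) tri_cat_scheme \<Rightarrow>
    ('r, 'y) graded_ring_scheme \<Rightarrow> (int \<Rightarrow> 'r \<Rightarrow> 'o \<Rightarrow> 'm) \<Rightarrow> 'r set set \<Rightarrow> 'o set" where
  "supported_subcategory U T R act V = localizing_generated_by U T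
     {D. compact U T D \<and> (\<forall>p \<in> Spec R - V. End_localization_zero T R act D p)}"

text \<open>The composite of the inclusion of the full subcategory \<open>S\<close> with a right adjoint of it, the
  adjunction being given by its counit \<open>\<epsilon>\<close>.\<close>

definition coreflection :: "('o, 'm, 'z) add_cat_scheme \<Rightarrow> 'o set \<Rightarrow> ('o, 'm) func \<Rightarrow>
    ('o \<Rightarrow> 'm) \<Rightarrow> bool" where
  "coreflection T S G \<epsilon> \<longleftrightarrow> endofunctor T G \<and> (\<forall>M \<in> Obj T. onO G M \<in> S) \<and>
     nat_trans T G id_functor \<epsilon> \<and>
     (\<forall>X \<in> S. \<forall>M \<in> Obj T. bij_betw (\<lambda>f. \<epsilon> M \<cdot>\<^bsub>T\<^esub> f) (Hom T X (onO G M)) (Hom T X M))"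

definition localization_functor :: "('o, 'm, 'z) tri_cat_scheme \<Rightarrow> ('o, 'm) func \<Rightarrow>
    ('o \<Rightarrow> 'm) \<Rightarrow> bool" where
  "localization_functor T L \<eta> \<longleftrightarrow> exact_functor T L \<and> nat_trans T id_functor L \<eta> \<and>
     (\<forall>X \<in> Obj T. isomorphism T (onO L X) (onO L (onO L X)) (onA L (\<eta> X)) \<and> onA L (\<eta> X) = \<eta> (onO L X))"

definition local_cohomology :: "'u itself \<Rightarrow> ('o, 'm, 'z) tri_cat_scheme \<Rightarrow>
    ('r, 'y) graded_ring_scheme \<Rightarrow> (int \<Rightarrow> 'r \<Rightarrow> 'o \<Rightarrow> 'm) \<Rightarrow> 'r set set \<Rightarrow>
    ('o, 'm) func \<Rightarrow> ('o \<Rightarrow> 'm) \<Rightarrow> ('o, 'm) func \<Rightarrow> ('o \<Rightarrow> 'm) \<Rightarrow> bool" where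
  "local_cohomology U T R act V \<Gamma> \<epsilon> L \<eta> \<longleftrightarrow>
     coreflection T (supported_subcategory U T R act V) \<Gamma> \<epsilon> \<and>
     localization_functor T L \<eta> \<and>
     {X \<in> Obj T. zero_object T (onO L X)} = supported_subcategory U T R act V \<and>
     (\<exists>\<delta>. nat_trans T L (comp_functor (susp T 1) \<Gamma>) \<delta> \<and>
          (\<forall>M \<in> Obj T. (\<epsilon> M, \<eta> M, \<delta> M) \<in> Tri T))"

section \<open>Homotopy colimits\<close>

text \<open>Sequences are indexed by $n \ge 1$.  \<open>\<iota> l\<close> is the canonical morphism from \<open>X l\<close> to the homotopy
  colimit \<open>H\<close>.\<close>

definition hocolim :: "('o, 'm, 'z) tri_cat_scheme \<Rightarrow> (nat \<Rightarrow> 'o) \<Rightarrow> (nat \<Rightarrow> 'm) \<Rightarrow> 'o \<Rightarrow>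
    (nat \<Rightarrow> 'm) \<Rightarrow> bool" where
  "hocolim T X f H \<iota> \<longleftrightarrow>
     (\<exists>P inc \<theta> \<pi> \<delta>. coproduct T {1..} X P inc \<and> \<theta> \<in> Hom T P P \<and>
        (\<forall>n \<ge> 1. \<theta> \<cdot>\<^bsub>T\<^esub> inc n = Add T (inc n) (neg T (inc (n + 1) \<cdot>\<^bsub>T\<^esub> f n))) \<and>
        (\<theta>, \<pi>, \<delta>) \<in> Tri T \<and> Cod T \<pi> = H \<and> (\<forall>l \<ge> 1. \<iota> l = \<pi> \<cdot>\<^bsub>T\<^esub> inc l))"

section \<open>Koszul objects and their systems\<close>

text \<open>The sequence is \<open>x 1, \<dots>, x t\<close> with $|x_i| = d_i$.  For $n \ge 1$, \<open>Kz s n\<close> is a choice of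
  the Koszul object of $x_1^n, \dots, x_s^n$ on \<open>M\<close>; \<open>kv s n\<close> and \<open>kw s n\<close> are the second and
  third map of the defining exact triangle.\<close>

definition koszul_objects :: "('o, 'm, 'z) tri_cat_scheme \<Rightarrow> ('r, 'y) graded_ring_scheme \<Rightarrow>
    (int \<Rightarrow> 'r \<Rightarrow> 'o \<Rightarrow> 'm) \<Rightarrow> (nat \<Rightarrow> int) \<Rightarrow> (nat \<Rightarrow> 'r) \<Rightarrow> nat \<Rightarrow> 'o \<Rightarrow>
    (nat \<Rightarrow> nat \<Rightarrow> 'o) \<Rightarrow> (nat \<Rightarrow> nat \<Rightarrow> 'm) \<Rightarrow> (nat \<Rightarrow> nat \<Rightarrow> 'm) \<Rightarrow> bool" where
  "koszul_objects T R act d x t M Kz kv kw \<longleftrightarrow>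
     (\<forall>n \<ge> 1. Kz 0 n = M \<and>
        (\<forall>s \<in> {1..t}. Cod T (kv s n) = Kz s n \<and>
           (act (int n * d s) (x s [^]\<^bsub>R\<^esub> n) (Kz (s - 1) n), kv s n, kw s n) \<in> Tri T))"

definition desusp_koszul :: "('o, 'm, 'z) tri_cat_scheme \<Rightarrow> (nat \<Rightarrow> nat \<Rightarrow> 'o) \<Rightarrow> nat \<Rightarrow> nat \<Rightarrow> 'o" where
  "desusp_koszul T Kz s n = suspO T (- int s) (Kz s n)"

text \<open>The morphism $K_{s,n} \to K_{s-1,n}$.\<close>

definition koszul_step :: "('o, 'm, 'z) tri_cat_scheme \<Rightarrow> (nat \<Rightarrow> nat \<Rightarrow> 'm) \<Rightarrow> nat \<Rightarrow> nat \<Rightarrow> 'm" where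
  "koszul_step T kw s n = suspA T (- int s) (kw s n)"

primrec koszul_canonical :: "('o, 'm, 'z) tri_cat_scheme \<Rightarrow> 'o \<Rightarrow> (nat \<Rightarrow> nat \<Rightarrow> 'm) \<Rightarrow>
    nat \<Rightarrow> nat \<Rightarrow> 'm" where
  "koszul_canonical T M kw 0 n = Idn T M"
| "koszul_canonical T M kw (Suc s) n = koszul_canonical T M kw s n \<cdot>\<^bsub>T\<^esub> koszul_step T kw (Suc s) n"

text \<open>The triangle $K_{s,n} \to K_{s-1,n} \to \Sigma^{n|x_s|} K_{s-1,n} \to \Sigma K_{s,n}$ whose first
  map is \<open>koszul_step\<close> and whose second map is $x_s^n$.  It arises from the defining triangle of
  \<open>Kz s n\<close> by rotating backwards and applying $\Sigma^{-(s-1)}$.  The sign of the third map collects the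
  signs from the rotation, from desuspending a triangle, and from
  $\Sigma^{-(s-1)} x_s^n = (-1)^{(s-1) n |x_s|} x_s^n$; it makes the triangle exact, see
  \<open>koszul_triangle_exact\<close> below.\<close>

definition koszul_triangle :: "('o, 'm, 'z) tri_cat_scheme \<Rightarrow> ('r, 'y) graded_ring_scheme \<Rightarrow>
    (int \<Rightarrow> 'r \<Rightarrow> 'o \<Rightarrow> 'm) \<Rightarrow> (nat \<Rightarrow> int) \<Rightarrow> (nat \<Rightarrow> 'r) \<Rightarrow>
    (nat \<Rightarrow> nat \<Rightarrow> 'o) \<Rightarrow> (nat \<Rightarrow> nat \<Rightarrow> 'm) \<Rightarrow> (nat \<Rightarrow> nat \<Rightarrow> 'm) \<Rightarrow> nat \<Rightarrow> nat \<Rightarrow> 'm \<times> 'm \<times> 'm" where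
  "koszul_triangle T R act d x Kz kv kw s n =
     (koszul_step T kw s n,
      act (int n * d s) (x s [^]\<^bsub>R\<^esub> n) (desusp_koszul T Kz (s - 1) n),
      signed T (int s + int (s - 1) * int n * d s) (suspA T (- int (s - 1)) (kv s n)))"

definition koszul_maps :: "('o, 'm, 'z) tri_cat_scheme \<Rightarrow> ('r, 'y) graded_ring_scheme \<Rightarrow>
    (int \<Rightarrow> 'r \<Rightarrow> 'o \<Rightarrow> 'm) \<Rightarrow> (nat \<Rightarrow> int) \<Rightarrow> (nat \<Rightarrow> 'r) \<Rightarrow> nat \<Rightarrow> 'o \<Rightarrow>
    (nat \<Rightarrow> nat \<Rightarrow> 'o) \<Rightarrow> (nat \<Rightarrow> nat \<Rightarrow> 'm) \<Rightarrow> (nat \<Rightarrow> nat \<Rightarrow> 'm) \<Rightarrow> (nat \<Rightarrow> nat \<Rightarrow> 'm) \<Rightarrow> bool" where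
  "koszul_maps T R act d x t M Kz kv kw u \<longleftrightarrow>
     (\<forall>n \<ge> 1. u 0 n = Idn T M \<and>
        (\<forall>s \<in> {1..t}. triangle_map T
           (koszul_triangle T R act d x Kz kv kw s n)
           (koszul_triangle T R act d x Kz kv kw s (n + 1))
           (u s n)
           (u (s - 1) n)
           (act (d s) (x s) (suspO T (int n * d s) (desusp_koszul T Kz (s - 1) (n + 1)))
              \<cdot>\<^bsub>T\<^esub> suspA T (int n * d s) (u (s - 1) n))))"

text \<open>For a fixed \<open>t\<close>: exact triangles $K_{t,n} \to M \to V_n \to \Sigma K_{t,n}$, with \<open>p n\<close> and
  \<open>q n\<close> the last two maps and \<open>c n\<close> the canonical morphism, and the maps \<open>v n\<close> between the cones.\<close>

definition cone_system :: "('o, 'm, 'z) tri_cat_scheme \<Rightarrow> 'o \<Rightarrow> (nat \<Rightarrow> 'm) \<Rightarrow> (nat \<Rightarrow> 'm) \<Rightarrow>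
    (nat \<Rightarrow> 'o) \<Rightarrow> (nat \<Rightarrow> 'm) \<Rightarrow> (nat \<Rightarrow> 'm) \<Rightarrow> (nat \<Rightarrow> 'm) \<Rightarrow> bool" where
  "cone_system T M c u V p q v \<longleftrightarrow>
     (\<forall>n \<ge> 1. (c n, p n, q n) \<in> Tri T \<and> Cod T (p n) = V n \<and>
        triangle_map T (c n, p n, q n) (c (n + 1), p (n + 1), q (n + 1)) (u n) (Idn T M) (v n))"

text \<open>The rest of this theory confirms the sign chosen in \<open>koszul_triangle\<close>.\<close>

context
  fixes T :: "('o, 'm, 'z) tri_cat_scheme"
  assumes tri: "triangulated T"
begin

abbreviation desA :: "'m \<Rightarrow> 'm" where "desA \<equiv> inv_into (Arr T) (SigA T)"
abbreviation desO :: "'o \<Rightarrow> 'o" where "desO \<equiv> inv_into (Obj T) (SigO T)"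

lemma tri_preadd: "preadditive T" and tri_cat: "category T"
  using tri by (simp_all add: triangulated_def additive_category_def preadditive_def)

lemma arr_Hom: "f \<in> Arr T \<longleftrightarrow> f \<in> Hom T (Dom T f) (Cod T f)"
  by (auto simp: Hom_def)

lemma arr_Obj: "f \<in> Arr T \<Longrightarrow> Dom T f \<in> Obj T" "f \<in> Arr T \<Longrightarrow> Cod T f \<in> Obj T"
  using tri_cat by (auto simp: category_def)

lemma cmp_Hom: "f \<in> Hom T A B \<Longrightarrow> g \<in> Hom T B C \<Longrightarrow> g \<cdot>\<^bsub>T\<^esub> f \<in> Hom T A C"
  using tri_cat by (auto simp: category_def Hom_def)

lemma hom_comm_group: "A \<in> Obj T \<Longrightarrow> B \<in> Obj T \<Longrightarrow> comm_group (hom_group T A B)"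
  using tri_preadd by (auto simp: preadditive_def)

lemma Hom_Obj: "f \<in> Hom T A B \<Longrightarrow> A \<in> Obj T \<and> B \<in> Obj T"
  using arr_Obj by (auto simp: Hom_def)

lemma neg_eq: "f \<in> Hom T A B \<Longrightarrow> neg T f = inv\<^bsub>hom_group T A B\<^esub> f"
  by (auto simp: Hom_def neg_def)

lemma neg_Hom: "f \<in> Hom T A B \<Longrightarrow> neg T f \<in> Hom T A B"
  using group.inv_closed[OF comm_group.axioms(2)[OF hom_comm_group], of A B f] Hom_Obj[of f A B]
  by (simp add: neg_eq hom_group_def)

lemma neg_neg: "f \<in> Hom T A B \<Longrightarrow> neg T (neg T f) = f"
  using group.inv_inv[OF comm_group.axioms(2)[OF hom_comm_group], of A B f] Hom_Obj[of f A B]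
    neg_eq[OF neg_Hom, of f A B] neg_eq[of f A B]
  unfolding hom_group_def by simp

lemma add_neg: "f \<in> Hom T A B \<Longrightarrow> Add T f (neg T f) = Zer T A B"
  using group.r_inv[OF comm_group.axioms(2)[OF hom_comm_group], of A B f] Hom_Obj[of f A B]
  by (simp add: neg_eq hom_group_def)

lemma neg_unique:
  assumes "f \<in> Hom T A B" "g \<in> Hom T A B" "Add T f g = Zer T A B" shows "g = neg T f"
proof -
  interpret G: comm_group "hom_group T A B" using hom_comm_group Hom_Obj[OF assms(1)] by auto
  show ?thesis using G.inv_unique'[of f g] assms G.m_comm[of f g]
    by (simp add: hom_group_def neg_eq[OF assms(1)])
qed

lemma add_idem_zero:
  assumes "f \<in> Hom T A B" "Add T f f = f" shows "f = Zer T A B"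
proof -
  interpret G: comm_group "hom_group T A B" using hom_comm_group Hom_Obj[OF assms(1)] by auto
  show ?thesis using G.l_cancel_one[of f f] assms unfolding hom_group_def by simp
qed

lemma Zer_Hom: "A \<in> Obj T \<Longrightarrow> B \<in> Obj T \<Longrightarrow> Zer T A B \<in> Hom T A B"
  using monoid.one_closed[OF group.axioms(1)[OF comm_group.axioms(2)[OF hom_comm_group]], of A B]
  by (simp add: hom_group_def)

lemma Zer_add: "A \<in> Obj T \<Longrightarrow> B \<in> Obj T \<Longrightarrow> Add T (Zer T A B) (Zer T A B) = Zer T A B"
  using monoid.l_one[OF group.axioms(1)[OF comm_group.axioms(2)[OF hom_comm_group]], of A B "Zer T A B"]
    Zer_Hom[of A B] by (simp add: hom_group_def)

lemma additive_map_neg: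
  assumes add: "\<And>f g. f \<in> Hom T A B \<Longrightarrow> g \<in> Hom T A B \<Longrightarrow> F (Add T f g) = Add T (F f) (F g)"
    and ty: "\<And>f. f \<in> Hom T A B \<Longrightarrow> F f \<in> Hom T C D" and f: "f \<in> Hom T A B"
  shows "F (neg T f) = neg T (F f)"
proof -
  have o: "A \<in> Obj T" "B \<in> Obj T" using Hom_Obj[OF f] by auto
  have z: "F (Zer T A B) = Zer T C D"
    using add_idem_zero[OF ty[OF Zer_Hom[OF o]]] add[OF Zer_Hom[OF o] Zer_Hom[OF o]] Zer_add[OF o]
    by simp
  show ?thesis
    using neg_unique[OF ty[OF f] ty[OF neg_Hom[OF f]]] add[OF f neg_Hom[OF f]] add_neg[OF f] z
    by simp
qed

lemma cmp_neg: "f \<in> Hom T A B \<Longrightarrow> g \<in> Hom T B C \<Longrightarrow> g \<cdot>\<^bsub>T\<^esub> neg T f = neg T (g \<cdot>\<^bsub>T\<^esub> f)"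
  using tri_preadd Hom_Obj
  by (intro additive_map_neg[of A B "\<lambda>f. g \<cdot>\<^bsub>T\<^esub> f" A C]) (auto simp: preadditive_def cmp_Hom, metis)

lemma neg_cmp: "f \<in> Hom T A B \<Longrightarrow> g \<in> Hom T B C \<Longrightarrow> neg T g \<cdot>\<^bsub>T\<^esub> f = neg T (g \<cdot>\<^bsub>T\<^esub> f)"
  using tri_preadd Hom_Obj
  by (intro additive_map_neg[of B C "\<lambda>g. g \<cdot>\<^bsub>T\<^esub> f" A C]) (auto simp: preadditive_def cmp_Hom, metis)

lemma Sig_functor: "additive_functor T \<lparr>onO = SigO T, onA = SigA T\<rparr>"
  using tri by (simp add: triangulated_def)

lemma Sig_Hom: "f \<in> Hom T A B \<Longrightarrow> SigA T f \<in> Hom T (SigO T A) (SigO T B)"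
  using Sig_functor by (auto simp: additive_functor_def endofunctor_def Hom_def)

lemma Sig_neg: "f \<in> Hom T A B \<Longrightarrow> SigA T (neg T f) = neg T (SigA T f)"
  using Sig_functor Hom_Obj[of f A B] Sig_Hom
  by (intro additive_map_neg[of A B "SigA T" "SigO T A" "SigO T B"])
     (auto simp: additive_functor_def)

lemma Sig_bij: "bij_betw (SigO T) (Obj T) (Obj T)" "bij_betw (SigA T) (Arr T) (Arr T)"
  using tri by (simp_all add: triangulated_def)

lemma Sig_des: "f \<in> Arr T \<Longrightarrow> SigA T (desA f) = f" "X \<in> Obj T \<Longrightarrow> SigO T (desO X) = X"
  using Sig_bij by (auto simp: bij_betw_def f_inv_into_f)

lemma des_Sig: "f \<in> Arr T \<Longrightarrow> desA (SigA T f) = f" "X \<in> Obj T \<Longrightarrow> desO (SigO T X) = X"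
  using Sig_bij by (auto simp: bij_betw_def)

lemma des_Obj: "X \<in> Obj T \<Longrightarrow> desO X \<in> Obj T" "f \<in> Arr T \<Longrightarrow> desA f \<in> Arr T"
  using Sig_bij by (auto simp: bij_betw_def inv_into_into)

lemma des_Hom: assumes "f \<in> Hom T A B" shows "desA f \<in> Hom T (desO A) (desO B)"
proof -
  have a: "f \<in> Arr T" using assms by (simp add: Hom_def)
  have h: "desA f \<in> Hom T (Dom T (desA f)) (Cod T (desA f))" using des_Obj(2)[OF a] arr_Hom by blast
  from Sig_Hom[OF h] Sig_des(1)[OF a] have "f \<in> Hom T (SigO T (Dom T (desA f))) (SigO T (Cod T (desA f)))"
    by simp
  then have "SigO T (Dom T (desA f)) = A" "SigO T (Cod T (desA f)) = B" using assms by (auto simp: Hom_def)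
  then have "Dom T (desA f) = desO A" "Cod T (desA f) = desO B"
    using des_Sig(2) Hom_Obj[OF h] by metis+
  then show ?thesis using h by simp
qed

lemma des_neg: assumes "f \<in> Hom T A B" shows "desA (neg T f) = neg T (desA f)"
proof -
  have "SigA T (neg T (desA f)) = neg T f"
    using Sig_neg[OF des_Hom[OF assms]] Sig_des(1) assms by (simp add: Hom_def)
  then show ?thesis using des_Sig(1)[of "neg T (desA f)"] neg_Hom[OF des_Hom[OF assms]]
    by (simp add: Hom_def)
qed

lemma signed_Hom: "f \<in> Hom T A B \<Longrightarrow> signed T k f \<in> Hom T A B"
  by (simp add: signed_def neg_Hom)

lemma signed_signed: "f \<in> Hom T A B \<Longrightarrow> signed T j (signed T k f) = signed T (j + k) f"
  by (auto simp: signed_def neg_neg)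

lemma signed_cmp: "f \<in> Hom T A B \<Longrightarrow> g \<in> Hom T B C \<Longrightarrow> signed T k g \<cdot>\<^bsub>T\<^esub> f = signed T k (g \<cdot>\<^bsub>T\<^esub> f)"
  and cmp_signed: "f \<in> Hom T A B \<Longrightarrow> g \<in> Hom T B C \<Longrightarrow> g \<cdot>\<^bsub>T\<^esub> signed T k f = signed T k (g \<cdot>\<^bsub>T\<^esub> f)"
  by (auto simp: signed_def neg_cmp cmp_neg)

lemma des_signed: "f \<in> Hom T A B \<Longrightarrow> desA (signed T k f) = signed T k (desA f)"
  by (auto simp: signed_def des_neg)

lemma Id_Hom: "A \<in> Obj T \<Longrightarrow> Idn T A \<in> Hom T A A"
  using tri_cat by (simp add: category_def)

lemma Id_cmp: "f \<in> Hom T A B \<Longrightarrow> Idn T B \<cdot>\<^bsub>T\<^esub> f = f" "f \<in> Hom T A B \<Longrightarrow> f \<cdot>\<^bsub>T\<^esub> Idn T A = f"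
  using tri_cat by (auto simp: category_def Hom_def)

lemma Sig_Id: "A \<in> Obj T \<Longrightarrow> SigA T (Idn T A) = Idn T (SigO T A)"
  using Sig_functor by (simp add: additive_functor_def endofunctor_def)

lemma signed_Id_isomorphism: assumes "A \<in> Obj T" shows "isomorphism T A A (signed T k (Idn T A))"
proof -
  note h = Id_Hom[OF assms]
  have "signed T k (Idn T A) \<cdot>\<^bsub>T\<^esub> signed T k (Idn T A) = Idn T A"
    using signed_cmp[OF signed_Hom[OF h] h] cmp_signed[OF h h] signed_signed[OF h] Id_cmp(1)[OF h]
    by (simp add: Id_cmp(1)[OF signed_Hom[OF h]]) (simp add: signed_def)
  then show ?thesis unfolding isomorphism_def using signed_Hom[OF h] by blast
qed

lemma Tri_candidate: "(f, g, h) \<in> Tri T \<Longrightarrow> candidate_triangle T (f, g, h)"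
proof -
  assume "(f, g, h) \<in> Tri T"
  moreover have "\<forall>t \<in> Tri T. candidate_triangle T t"
    using tri unfolding triangulated_def by (elim conjE) assumption
  ultimately show ?thesis by blast
qed

lemma candidate_Hom:
  "candidate_triangle T (f, g, h) \<longleftrightarrow>
     f \<in> Hom T (Dom T f) (Dom T g) \<and> g \<in> Hom T (Dom T g) (Dom T h) \<and> h \<in> Hom T (Dom T h) (SigO T (Dom T f))"
  by (auto simp: candidate_triangle_def Hom_def)

lemma candidate_HomI:
  "f \<in> Hom T A B \<Longrightarrow> g \<in> Hom T B C \<Longrightarrow> h \<in> Hom T C (SigO T A) \<Longrightarrow> candidate_triangle T (f, g, h)"
  by (auto simp: candidate_triangle_def Hom_def)

lemma Tri_signed:
  assumes t: "(f, g, h) \<in> Tri T" and e: "even (a + b + c)"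
  shows "(signed T a f, signed T b g, signed T c h) \<in> Tri T"
proof -
  let ?A = "Dom T f" and ?B = "Dom T g" and ?C = "Dom T h"
  have f: "f \<in> Hom T ?A ?B" and g: "g \<in> Hom T ?B ?C" and h: "h \<in> Hom T ?C (SigO T ?A)"
    using Tri_candidate[OF t] candidate_Hom by auto
  have o: "?A \<in> Obj T" "?B \<in> Obj T" "?C \<in> Obj T" using Hom_Obj f g h by auto
  note i = Id_Hom[OF o(1)] Id_Hom[OF o(2)] Id_Hom[OF o(3)]
  note s = signed_Hom[OF f, of a] signed_Hom[OF g, of b] signed_Hom[OF h, of c]
  have d: "Dom T (signed T a f) = ?A" "Dom T (signed T b g) = ?B" "Dom T (signed T c h) = ?C"
    using s by (auto simp: Hom_def)
  have di: "Dom T (signed T k (Idn T X)) = X" "Cod T (signed T k (Idn T X)) = X" if "X \<in> Obj T" for k X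
    using signed_Hom[OF Id_Hom[OF that], of k] by (auto simp: Hom_def)
  have m: "triangle_map T (f, g, h) (signed T a f, signed T b g, signed T c h)
     (signed T 0 (Idn T ?A)) (signed T a (Idn T ?B)) (signed T (a + b) (Idn T ?C))"
    unfolding triangle_map_def prod.case d
  proof (intro conjI)
    show "signed T a (Idn T ?B) \<cdot>\<^bsub>T\<^esub> f = signed T a f \<cdot>\<^bsub>T\<^esub> signed T 0 (Idn T ?A)"
      using signed_cmp[OF f i(2)] Id_cmp f s by (simp add: signed_def[of _ 0])
    show "signed T (a + b) (Idn T ?C) \<cdot>\<^bsub>T\<^esub> g = signed T b g \<cdot>\<^bsub>T\<^esub> signed T a (Idn T ?B)"
      using signed_cmp[OF g i(3)] Id_cmp(1)[OF g] cmp_signed[OF i(2) s(2)] Id_cmp(2)[OF s(2)]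
        signed_signed[OF g] by simp
    have "signed T c h \<cdot>\<^bsub>T\<^esub> signed T (a + b) (Idn T ?C) = signed T (a + b + c) h"
      using cmp_signed[OF i(3) s(3)] Id_cmp(2)[OF s(3)] signed_signed[OF h] by simp
    then show "SigA T (signed T 0 (Idn T ?A)) \<cdot>\<^bsub>T\<^esub> h = signed T c h \<cdot>\<^bsub>T\<^esub> signed T (a + b) (Idn T ?C)"
      using e Sig_Id[OF o(1)] Id_cmp(1)[OF h] by (simp add: signed_def[of _ 0] signed_def[of _ "a + b + c"])
  qed (use i signed_Hom in auto)
  note TR1 = tri[unfolded triangulated_def, THEN conjunct2, THEN conjunct2, THEN conjunct2,
      THEN conjunct2, THEN conjunct2, THEN conjunct1, rule_format]
  show ?thesis
    by (rule TR1[OF t candidate_HomI[OF s] m]) (simp_all add: di o signed_Id_isomorphism)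
qed

lemma rotate:
  "candidate_triangle T (f, g, h) \<Longrightarrow> (f, g, h) \<in> Tri T \<longleftrightarrow> (g, h, neg T (SigA T f)) \<in> Tri T"
  using tri[unfolded triangulated_def, THEN conjunct2, THEN conjunct2, THEN conjunct2, THEN conjunct2,
      THEN conjunct2, THEN conjunct2, THEN conjunct2, THEN conjunct2, THEN conjunct1] by blast

lemma Tri_des:
  assumes t: "(f, g, h) \<in> Tri T"
  shows "(desA f, desA g, neg T (desA h)) \<in> Tri T"
proof -
  let ?A = "Dom T f" and ?B = "Dom T g" and ?C = "Dom T h"
  have f: "f \<in> Hom T ?A ?B" and g: "g \<in> Hom T ?B ?C" and h: "h \<in> Hom T ?C (SigO T ?A)"
    using Tri_candidate[OF t] candidate_Hom by auto
  have o: "?A \<in> Obj T" "?B \<in> Obj T" "?C \<in> Obj T" using Hom_Obj f g h by auto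
  have S: "SigO T (desO ?A) = ?A" "SigO T (desO ?B) = ?B" "SigO T (desO ?C) = ?C" "desO (SigO T ?A) = ?A"
    using Sig_des des_Sig o by auto
  have f': "desA f \<in> Hom T (desO ?A) (desO ?B)" and g': "desA g \<in> Hom T (desO ?B) (desO ?C)"
    and k: "neg T (desA h) \<in> Hom T (desO ?C) ?A"
    using des_Hom[OF f] des_Hom[OF g] neg_Hom[OF des_Hom[OF h]] S by auto
  have e: "SigA T (desA f) = f" "SigA T (desA g) = g" "SigA T (neg T (desA h)) = neg T h"
    using Sig_des(1) Sig_neg[OF des_Hom[OF h]] f g h by (auto simp: Hom_def)
  have "(desA f, desA g, neg T (desA h)) \<in> Tri T \<longleftrightarrow> (desA g, neg T (desA h), neg T f) \<in> Tri T"
    using rotate[OF candidate_HomI[OF f' g']] k S e by simp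
  also have "\<dots> \<longleftrightarrow> (neg T (desA h), neg T f, neg T g) \<in> Tri T"
    using rotate[OF candidate_HomI[OF g' k]] neg_Hom[OF f] S e by simp
  also have "\<dots> \<longleftrightarrow> (neg T f, neg T g, neg T (neg T h)) \<in> Tri T"
    using rotate[OF candidate_HomI[OF k neg_Hom[OF f]]] neg_Hom[OF g] S e by simp
  finally show ?thesis using Tri_signed[OF t, of 1 1 0] neg_neg[OF h] by (simp add: signed_def)
qed

lemma des_pow_Hom: "f \<in> Hom T A B \<Longrightarrow> (desA ^^ j) f \<in> Hom T ((desO ^^ j) A) ((desO ^^ j) B)"
  by (induction j) (auto intro: des_Hom)

lemma des_pow_signed: "f \<in> Hom T A B \<Longrightarrow> (desA ^^ j) (signed T k f) = signed T k ((desA ^^ j) f)"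
  by (induction j) (auto simp: des_signed[OF des_pow_Hom])

lemma Tri_des_pow:
  assumes t: "(f, g, h) \<in> Tri T"
  shows "((desA ^^ j) f, (desA ^^ j) g, signed T (int j) ((desA ^^ j) h)) \<in> Tri T"
proof (induction j)
  case 0
  then show ?case using t by (simp add: signed_def)
next
  case (Suc j)
  have h: "(desA ^^ j) h \<in> Hom T ((desO ^^ j) (Dom T h)) ((desO ^^ j) (Cod T h))"
    using des_pow_Hom Tri_candidate[OF t] by (auto simp: candidate_triangle_def Hom_def)
  have "neg T (desA (signed T (int j) ((desA ^^ j) h))) = signed T (int (Suc j)) ((desA ^^ Suc j) h)"
    using des_neg[OF h] neg_neg[OF des_Hom[OF h]] by (simp add: signed_def)
  then show ?case using Tri_des[OF Suc] by simp
qed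

lemma center_des:
  assumes c: "\<alpha> \<in> center T n" and X: "X \<in> Obj T"
  shows "\<alpha> ((desO ^^ j) X) = signed T (int j * n) ((desA ^^ j) (\<alpha> X))"
proof (induction j)
  case 0
  then show ?case by (simp add: signed_def)
next
  case (Suc j)
  let ?Y = "(desO ^^ j) X"
  have Y: "?Y \<in> Obj T" by (induction j) (auto simp: X des_Obj)
  have hom: "\<alpha> Z \<in> Hom T Z (suspO T n Z)" if "Z \<in> Obj T" for Z
    using c that by (simp add: center_def nat_trans_def id_functor_def susp_def)
  have "\<alpha> ?Y = signed T n (SigA T (\<alpha> (desO ?Y)))"
    using c des_Obj(1)[OF Y] Sig_des(2)[OF Y] unfolding center_def by force
  moreover note hd = hom[OF des_Obj(1)[OF Y]]
  ultimately have "signed T n (\<alpha> ?Y) = SigA T (\<alpha> (desO ?Y))"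
    using signed_signed[OF Sig_Hom[OF hd]] by (simp add: signed_def)
  then have "\<alpha> (desO ?Y) = desA (signed T n (\<alpha> ?Y))"
    using des_Sig(1) hd by (simp add: Hom_def)
  also have "\<dots> = signed T n (desA (\<alpha> ?Y))" using des_signed[OF hom[OF Y]] .
  also have "\<dots> = signed T n (desA (signed T (int j * n) ((desA ^^ j) (\<alpha> X))))" using Suc by simp
  also have "\<dots> = signed T (int (Suc j) * n) ((desA ^^ Suc j) (\<alpha> X))"
    using des_signed[OF des_pow_Hom[OF hom[OF X]]] signed_signed[OF des_Hom[OF des_pow_Hom[OF hom[OF X]]]]
    by (simp add: algebra_simps)
  finally show ?case by simp
qed

lemma suspA_neg: "suspA T (- int j) f = (desA ^^ j) f" and suspO_neg: "suspO T (- int j) X = (desO ^^ j) X"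
  by (auto simp: suspA_def suspO_def)

lemma koszul_triangle_exact:
  assumes lin: "linear_action T R act" and M: "M \<in> Obj T"
    and K: "koszul_objects T R act d x t M Kz kv kw"
    and n: "n \<ge> 1" and s: "s \<in> {1..t}"
    and hom: "x s [^]\<^bsub>R\<^esub> n \<in> gr R (int n * d s)"
  shows "koszul_triangle T R act d x Kz kv kw s n \<in> Tri T"
proof -
  let ?e = "int n * d s" and ?X = "Kz (s - 1) n" and ?v = "kv s n" and ?w = "kw s n"
  let ?\<alpha> = "act ?e (x s [^]\<^bsub>R\<^esub> n)"
  obtain j where j: "s = Suc j" using s by (cases s) auto
  have t: "(?\<alpha> ?X, ?v, ?w) \<in> Tri T" using K n s by (simp add: koszul_objects_def)
  have c: "?\<alpha> \<in> center T ?e" using lin hom by (simp add: linear_action_def)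
  have f: "?\<alpha> ?X \<in> Hom T (Dom T (?\<alpha> ?X)) (Dom T ?v)" and v: "?v \<in> Hom T (Dom T ?v) (Dom T ?w)"
    and w: "?w \<in> Hom T (Dom T ?w) (SigO T (Dom T (?\<alpha> ?X)))"
    using Tri_candidate[OF t] candidate_Hom by auto
  let ?A = "Dom T (?\<alpha> ?X)"
  have A: "?A \<in> Obj T" using Hom_Obj[OF f] by simp
  have X: "?X \<in> Obj T"
  proof (cases j)
    case 0
    then show ?thesis using K n j M by (simp add: koszul_objects_def)
  next
    case (Suc i)
    have "Cod T (kv (s - 1) n) = ?X" "(act (int n * d (s - 1)) (x (s - 1) [^]\<^bsub>R\<^esub> n) (Kz (s - 1 - 1) n),
        kv (s - 1) n, kw (s - 1) n) \<in> Tri T"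
      using K[unfolded koszul_objects_def, rule_format, OF n, THEN conjunct2, THEN bspec, of "s - 1"]
        s j Suc by auto
    then show ?thesis
      using Tri_candidate arr_Obj(2)[of "kv (s - 1) n"] unfolding candidate_triangle_def by fastforce
  qed
  have XA: "?A = ?X"
    using c X by (auto simp: center_def nat_trans_def id_functor_def Hom_def)
  let ?a = "neg T (desA ?w)"
  have dw: "desA ?w \<in> Hom T (desO (Dom T ?w)) ?A" using des_Hom[OF w] des_Sig(2)[OF A] by simp
  have a: "?a \<in> Hom T (desO (Dom T ?w)) ?A" using neg_Hom[OF dw] .
  have "SigO T (desO (Dom T ?w)) = Dom T ?w" using Sig_des(2) Hom_Obj[OF w] by simp
  moreover have "neg T (SigA T ?a) = ?w"
    using Sig_neg[OF dw] Sig_des(1)[of ?w] w neg_neg[OF w] by (simp add: Hom_def)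
  ultimately have "(?a, ?\<alpha> ?X, ?v) \<in> Tri T"
    using rotate[OF candidate_HomI[OF a f]] v t by simp
  note t1 = Tri_des_pow[OF this, of j]
  have "(signed T 1 ((desA ^^ j) ?a), signed T (int j * ?e) ((desA ^^ j) (?\<alpha> ?X)),
         signed T (1 + int j * ?e) (signed T (int j) ((desA ^^ j) ?v))) \<in> Tri T"
    by (rule Tri_signed[OF t1]) simp
  moreover have "signed T 1 ((desA ^^ j) ?a) = (desA ^^ s) ?w"
    using des_pow_signed[OF dw, of j 1] neg_neg[OF des_pow_Hom[OF dw]] j
    by (simp add: signed_def funpow_swap1)
  moreover have "signed T (int j * ?e) ((desA ^^ j) (?\<alpha> ?X)) = ?\<alpha> ((desO ^^ j) ?X)"
    using center_des[OF c X] by simp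
  moreover have "signed T (1 + int j * ?e) (signed T (int j) ((desA ^^ j) ?v)) =
      signed T (int s + int j * int n * d s) ((desA ^^ j) ?v)"
    using signed_signed[OF des_pow_Hom[OF v]] j by (simp add: algebra_simps)
  ultimately show ?thesis
    using j by (simp add: koszul_triangle_def koszul_step_def desusp_koszul_def suspA_neg[of s, unfolded j]
        suspA_neg suspO_neg del: of_nat_Suc)
qed

end

end

theory Submission
  imports Defs
begin

text \<open>The subcategory that defines $\Gamma_{\mathcal V}$ is generated by compact objects, and support conditions on a
  compact object \<open>D\<close> become elementary: $\mathrm{End}^*(D)$ vanishes at all primes not containing
  $(x_1,\dots,x_t)$ iff a power of each $x_i$ acts as zero on \<open>D\<close>
  (\<open>supported_iff_nilpotent\<close>).  Call such compact objects the generators.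

  For a generator \<open>D\<close>, naturality turns the powers of $x_s$ occurring in the Koszul system into powers
  acting on \<open>D\<close>, which are eventually zero.  Going up the exact triangles
  $K_{s,n} \to K_{s-1,n} \to \Sigma^{n|x_s|}K_{s-1,n}$, every morphism $D \to M$ lifts to some $K_{t,n}$, and a
  morphism $D \to K_{t,n}$ that vanishes in \<open>M\<close> vanishes at a later stage (\<open>torsion_lift\<close>,
  \<open>torsion_dies\<close>).  A morphism from a compact object to a homotopy colimit comes from a finite
  stage (\<open>hocolim_compact_factor\<close>).  Hence $\mathrm{hocolim}_n K_{t,n} \to M$ is bijective on
  morphisms from generators, while there are no nonzero morphisms from generators to
  $\mathrm{hocolim}_n V_{t,n}$; both facts extend from the generators to the whole localizing subcategory.

  The Koszul objects $K_{t,n}$ themselves belong to the subcategory (\<open>koszul_supported\<close>): their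
  localization \<open>Y\<close> carries a nilpotent action of the $x_i$ and has no maps from generators.  For any compact
  \<open>C\<close>, a Koszul object of \<open>C\<close> on high powers of the $x_i$ is a generator, and nilpotence on \<open>Y\<close> passes the
  absence of maps from it down to \<open>C\<close>, so $Y = 0$ by compact generation.

  Therefore $\mathrm{hocolim}_n K_{t,n} \to M$ has the universal property of $\Gamma_{\mathcal V}M \to M$
  (\<open>coreflection_iso\<close>), and the morphism $M \to \mathrm{hocolim}_n V_{t,n}$ factors through $M \to L_{\mathcal V}M$.  That the
  resulting comparison is invertible is seen on compact objects (\<open>cone_hocolim_iso\<close>).  The maps
  $u_{t,n}$ and $v_{t,n}$ enter only through the commuting squares that define them, so their
  choice is irrelevant.\<close>

section \<open>Arrows\<close>

locale triangulated_category =
  fixes T :: "('o, 'm, 'z) tri_cat_scheme" (structure)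
  assumes tri: "triangulated T"
begin

lemma cmp_arr [simp]:
  assumes "f \<in> Arr T" "g \<in> Arr T" "Cod T f = Dom T g"
  shows "g \<cdot> f \<in> Arr T" "Dom T (g \<cdot> f) = Dom T f" "Cod T (g \<cdot> f) = Cod T g"
  using tri_cat[OF tri] assms by (auto simp: category_def Hom_def)

lemma cmp_assoc [simp]:
  assumes "f \<in> Arr T" "g \<in> Arr T" "h \<in> Arr T" "Cod T f = Dom T g" "Cod T g = Dom T h"
  shows "(h \<cdot> g) \<cdot> f = h \<cdot> (g \<cdot> f)"
  using tri_cat[OF tri] assms by (auto simp: category_def Hom_def)

lemma arr_obj [simp]: "f \<in> Arr T \<Longrightarrow> Dom T f \<in> Obj T" "f \<in> Arr T \<Longrightarrow> Cod T f \<in> Obj T"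
  using arr_Obj[OF tri] by auto

lemma id_arr [simp]:
  assumes "X \<in> Obj T" shows "Idn T X \<in> Arr T" "Dom T (Idn T X) = X" "Cod T (Idn T X) = X"
  using Id_Hom[OF tri assms] by (auto simp: Hom_def)

lemma id_cmp [simp]:
  "f \<in> Arr T \<Longrightarrow> X = Cod T f \<Longrightarrow> Idn T X \<cdot> f = f" "f \<in> Arr T \<Longrightarrow> X = Dom T f \<Longrightarrow> f \<cdot> Idn T X = f"
  using Id_cmp[OF tri] by (auto simp: Hom_def)

lemma zer_arr [simp]:
  assumes "X \<in> Obj T" "Y \<in> Obj T"
  shows "Zer T X Y \<in> Arr T" "Dom T (Zer T X Y) = X" "Cod T (Zer T X Y) = Y"
  using Zer_Hom[OF tri assms] by (auto simp: Hom_def)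

abbreviation parallel where
  "parallel f g \<equiv> f \<in> Arr T \<and> g \<in> Arr T \<and> Dom T f = Dom T g \<and> Cod T f = Cod T g"

lemma parallel_hom: "parallel f g \<Longrightarrow> f \<in> Hom T (Dom T f) (Cod T f) \<and> g \<in> Hom T (Dom T f) (Cod T f)"
  by (auto simp: Hom_def)

lemma add_arr [simp]:
  assumes "parallel f g"
  shows "Add T f g \<in> Arr T" "Dom T (Add T f g) = Dom T g" "Cod T (Add T f g) = Cod T g"
proof -
  interpret G: comm_group "hom_group T (Dom T f) (Cod T f)"
    using hom_comm_group[OF tri] assms by auto
  have "Add T f g \<in> Hom T (Dom T f) (Cod T f)"
    using G.m_closed[of f g] parallel_hom[OF assms] by (simp add: hom_group_def)
  then show "Add T f g \<in> Arr T" "Dom T (Add T f g) = Dom T g" "Cod T (Add T f g) = Cod T g"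
    using assms by (auto simp: Hom_def)
qed

lemma neg_arr [simp]:
  assumes "f \<in> Arr T"
  shows "neg T f \<in> Arr T" "Dom T (neg T f) = Dom T f" "Cod T (neg T f) = Cod T f"
  using neg_Hom[OF tri, of f "Dom T f" "Cod T f"] assms by (auto simp: Hom_def)

lemma cmp_add:
  assumes "parallel f f'" "g \<in> Arr T" "Cod T f = Dom T g"
  shows "g \<cdot> Add T f f' = Add T (g \<cdot> f) (g \<cdot> f')"
  using tri_preadd[OF tri, unfolded preadditive_def, THEN conjunct2, THEN conjunct2, rule_format,
      of "Dom T f" "Cod T f" "Cod T g" f f' g g] assms
  by (auto simp: Hom_def)

lemma add_cmp:
  assumes "parallel g g'" "f \<in> Arr T" "Cod T f = Dom T g"
  shows "Add T g g' \<cdot> f = Add T (g \<cdot> f) (g' \<cdot> f)"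
  using tri_preadd[OF tri, unfolded preadditive_def, THEN conjunct2, THEN conjunct2, rule_format,
      of "Dom T f" "Dom T g" "Cod T g" f f g g'] assms
  by (auto simp: Hom_def)

lemma neg_cmp' [simp]: "f \<in> Arr T \<Longrightarrow> g \<in> Arr T \<Longrightarrow> Cod T f = Dom T g \<Longrightarrow> neg T g \<cdot> f = neg T (g \<cdot> f)"
  using neg_cmp[OF tri] by (auto simp: Hom_def)

lemma cmp_neg' [simp]: "f \<in> Arr T \<Longrightarrow> g \<in> Arr T \<Longrightarrow> Cod T f = Dom T g \<Longrightarrow> g \<cdot> neg T f = neg T (g \<cdot> f)"
  using cmp_neg[OF tri] by (auto simp: Hom_def)

lemma neg_neg' [simp]: "f \<in> Arr T \<Longrightarrow> neg T (neg T f) = f"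
  using neg_neg[OF tri] by (auto simp: Hom_def)

lemma zer_cmp [simp]:
  assumes "f \<in> Arr T" "B = Cod T f" "C \<in> Obj T"
  shows "Zer T B C \<cdot> f = Zer T (Dom T f) C"
proof (rule add_idem_zero[OF tri])
  show "Zer T B C \<cdot> f \<in> Hom T (Dom T f) C" using assms by (simp add: Hom_def)
  show "Add T (Zer T B C \<cdot> f) (Zer T B C \<cdot> f) = Zer T B C \<cdot> f"
    using assms Zer_add[OF tri, of B C] by (subst add_cmp[symmetric]) auto
qed

lemma cmp_zer [simp]:
  assumes "f \<in> Arr T" "B = Dom T f" "C \<in> Obj T"
  shows "f \<cdot> Zer T C B = Zer T C (Cod T f)"
proof (rule add_idem_zero[OF tri])
  show "f \<cdot> Zer T C B \<in> Hom T C (Cod T f)" using assms by (simp add: Hom_def)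
  show "Add T (f \<cdot> Zer T C B) (f \<cdot> Zer T C B) = f \<cdot> Zer T C B"
    using assms Zer_add[OF tri, of C B] by (subst cmp_add[symmetric]) auto
qed

lemma add_zer [simp]:
  assumes "f \<in> Arr T" "A = Dom T f" "B = Cod T f"
  shows "Add T f (Zer T A B) = f" "Add T (Zer T A B) f = f"
proof -
  interpret G: comm_group "hom_group T A B" using hom_comm_group[OF tri] assms by auto
  show "Add T f (Zer T A B) = f" "Add T (Zer T A B) f = f"
    using G.r_one[of f] G.l_one[of f] assms by (simp_all add: hom_group_def Hom_def)
qed

lemma neg_zer [simp]: assumes "A \<in> Obj T" "B \<in> Obj T" shows "neg T (Zer T A B) = Zer T A B"
  using neg_unique[OF tri, of "Zer T A B" A B "Zer T A B"] assms by (simp add: Hom_def)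

lemma add_neg_iff:
  assumes "parallel f g"
  shows "Add T f (neg T g) = Zer T (Dom T f) (Cod T f) \<longleftrightarrow> f = g"
proof
  assume "Add T f (neg T g) = Zer T (Dom T f) (Cod T f)"
  from neg_unique[OF tri _ _ this] assms have "neg T g = neg T f" by (simp add: Hom_def)
  then have "neg T (neg T g) = neg T (neg T f)" by simp
  then show "f = g" using assms by simp
next
  assume "f = g" then show "Add T f (neg T g) = Zer T (Dom T f) (Cod T f)"
    using assms add_neg[OF tri, of f] by (simp add: Hom_def)
qed

lemma neg_eq_zer [simp]:
  assumes "f \<in> Arr T" "A = Dom T f" "B = Cod T f" shows "neg T f = Zer T A B \<longleftrightarrow> f = Zer T A B"
  using assms by (metis neg_neg' neg_zer arr_obj)

section \<open>Integral suspensions\<close>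

lemma sig_obj [simp]: "X \<in> Obj T \<Longrightarrow> SigO T X \<in> Obj T"
  using Sig_bij(1)[OF tri] by (auto simp: bij_betw_def)

lemma sig_arr [simp]:
  assumes "f \<in> Arr T"
  shows "SigA T f \<in> Arr T" "Dom T (SigA T f) = SigO T (Dom T f)" "Cod T (SigA T f) = SigO T (Cod T f)"
  using Sig_Hom[OF tri, of f "Dom T f" "Cod T f"] assms by (auto simp: Hom_def)

lemma sig_cmp: "f \<in> Arr T \<Longrightarrow> g \<in> Arr T \<Longrightarrow> Cod T f = Dom T g \<Longrightarrow> SigA T (g \<cdot> f) = SigA T g \<cdot> SigA T f"
  using Sig_functor[OF tri] by (simp add: additive_functor_def endofunctor_def)

lemma sig_add: "parallel f g \<Longrightarrow> SigA T (Add T f g) = Add T (SigA T f) (SigA T g)"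
  using Sig_functor[OF tri, unfolded additive_functor_def, THEN conjunct2, rule_format,
      of "Dom T f" "Cod T f" f g] by (auto simp: Hom_def)

lemma sig_zer: assumes "A \<in> Obj T" "B \<in> Obj T" shows "SigA T (Zer T A B) = Zer T (SigO T A) (SigO T B)"
proof (rule add_idem_zero[OF tri])
  show "SigA T (Zer T A B) \<in> Hom T (SigO T A) (SigO T B)" using assms by (simp add: Hom_def)
  show "Add T (SigA T (Zer T A B)) (SigA T (Zer T A B)) = SigA T (Zer T A B)"
    using assms Zer_add[OF tri, of A B] by (subst sig_add[symmetric]) auto
qed

lemma susp_step_up:
  "X \<in> Obj T \<Longrightarrow> suspO T (n + 1) X = SigO T (suspO T n X)"
  "f \<in> Arr T \<Longrightarrow> suspA T (n + 1) f = SigA T (suspA T n f)"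
proof -
  have des_obj: "(desO T ^^ k) X \<in> Obj T" if "X \<in> Obj T" for k X
    using that des_Obj(1)[OF tri] by (induction k) auto
  have des_arr: "(desA T ^^ k) f \<in> Arr T" if "f \<in> Arr T" for k f
    using that des_Obj(2)[OF tri] by (induction k) auto
  show "suspO T (n + 1) X = SigO T (suspO T n X)" if "X \<in> Obj T"
  proof (cases "n \<ge> 0")
    case True
    then show ?thesis by (simp add: suspO_def nat_add_distrib)
  next
    case False
    then have "nat (- n) = Suc (nat (- (n + 1)))" by simp
    moreover have "suspO T (n + 1) X = (desO T ^^ nat (- (n + 1))) X"
      using False by (cases "n + 1 = 0") (simp_all add: suspO_def)
    ultimately show ?thesis
      using False Sig_des(2)[OF tri des_obj[OF that, of "nat (- (n + 1))"]] by (simp add: suspO_def)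
  qed
  show "suspA T (n + 1) f = SigA T (suspA T n f)" if "f \<in> Arr T"
  proof (cases "n \<ge> 0")
    case True
    then show ?thesis by (simp add: suspA_def nat_add_distrib)
  next
    case False
    then have "nat (- n) = Suc (nat (- (n + 1)))" by simp
    moreover have "suspA T (n + 1) f = (desA T ^^ nat (- (n + 1))) f"
      using False by (cases "n + 1 = 0") (simp_all add: suspA_def)
    ultimately show ?thesis
      using False Sig_des(1)[OF tri des_arr[OF that, of "nat (- (n + 1))"]] by (simp add: suspA_def)
  qed
qed

lemma susp_0 [simp]: "suspO T 0 X = X" "suspA T 0 f = f"
  by (simp_all add: suspO_def suspA_def)

lemma susp_1: "suspO T 1 X = SigO T X" "suspA T 1 f = SigA T f"
  by (simp_all add: suspO_def suspA_def)

text \<open>A statement that an invertible operator preserves and reflects holds along a whole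
  $\mathbb{Z}$-orbit as soon as it holds at one point; the properties of the functors
  $\Sigma^n$ follow from those of $\Sigma$ in this way.\<close>

lemma int_orbit: assumes "P (0::int)" "\<And>n. P n \<longleftrightarrow> P (n + 1)" shows "P n"
  using assms(1)
  by (induction n rule: int_induct[where k = 0]) (use assms(2) in \<open>force simp: algebra_simps\<close>)+

lemma sig_inj: "X \<in> Obj T \<Longrightarrow> Y \<in> Obj T \<Longrightarrow> SigO T X = SigO T Y \<longleftrightarrow> X = Y"
    "f \<in> Arr T \<Longrightarrow> g \<in> Arr T \<Longrightarrow> SigA T f = SigA T g \<longleftrightarrow> f = g"
  using Sig_bij[OF tri] by (auto simp: bij_betw_def inj_on_def)

lemma susp_closed [simp]: "X \<in> Obj T \<Longrightarrow> suspO T n X \<in> Obj T" "f \<in> Arr T \<Longrightarrow> suspA T n f \<in> Arr T"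
proof -
  have "(desO T ^^ k) X \<in> Obj T" if "X \<in> Obj T" for k X
    using that des_Obj(1)[OF tri] by (induction k) auto
  moreover have "(desA T ^^ k) f \<in> Arr T" if "f \<in> Arr T" for k f
    using that des_Obj(2)[OF tri] by (induction k) auto
  moreover have "(SigO T ^^ k) X \<in> Obj T" if "X \<in> Obj T" for k X
    using that by (induction k) auto
  moreover have "(SigA T ^^ k) X \<in> Arr T" if "X \<in> Arr T" for k X
    using that by (induction k) auto
  ultimately show "X \<in> Obj T \<Longrightarrow> suspO T n X \<in> Obj T" "f \<in> Arr T \<Longrightarrow> suspA T n f \<in> Arr T"
    by (auto simp: suspO_def suspA_def)
qed

lemma susp_dom_cod [simp]:
  assumes "f \<in> Arr T"
  shows "Dom T (suspA T n f) = suspO T n (Dom T f)" "Cod T (suspA T n f) = suspO T n (Cod T f)"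
  by (rule int_orbit[of _ n]; use assms in \<open>simp add: susp_step_up sig_inj\<close>)+

lemma susp_cmp:
  assumes "f \<in> Arr T" "g \<in> Arr T" "Cod T f = Dom T g"
  shows "suspA T n (g \<cdot> f) = suspA T n g \<cdot> suspA T n f"
  by (rule int_orbit[of _ n]; use assms in \<open>simp add: susp_step_up sig_inj flip: sig_cmp\<close>)

lemma susp_zer:
  assumes "X \<in> Obj T" "Y \<in> Obj T" shows "suspA T n (Zer T X Y) = Zer T (suspO T n X) (suspO T n Y)"
  by (rule int_orbit[of _ n]; use assms in \<open>simp add: susp_step_up sig_inj flip: sig_zer\<close>)

lemma susp_susp:
  "X \<in> Obj T \<Longrightarrow> suspO T m (suspO T n X) = suspO T (m + n) X"
  "f \<in> Arr T \<Longrightarrow> suspA T m (suspA T n f) = suspA T (m + n) f"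
proof -
  have s: "m + 1 + n = m + n + 1" for m by simp
  show "suspO T m (suspO T n X) = suspO T (m + n) X" if "X \<in> Obj T"
    by (rule int_orbit[of _ m]; (simp only: s)?; use that in \<open>simp add: susp_step_up sig_inj\<close>)
  show "suspA T m (suspA T n f) = suspA T (m + n) f" if "f \<in> Arr T"
    by (rule int_orbit[of _ m]; (simp only: s)?; use that in \<open>simp add: susp_step_up sig_inj\<close>)
qed

lemma susp_inj: "f \<in> Arr T \<Longrightarrow> g \<in> Arr T \<Longrightarrow> suspA T n f = suspA T n g \<longleftrightarrow> f = g"
  by (metis susp_susp(2)[of _ "- n" n] susp_0(2) add.left_inverse)

lemma susp_eq_zer:
  assumes "f \<in> Arr T" "A = suspO T n (Dom T f)" "B = suspO T n (Cod T f)"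
  shows "suspA T n f = Zer T A B \<longleftrightarrow> f = Zer T (Dom T f) (Cod T f)"
  using susp_inj[of f "Zer T (Dom T f) (Cod T f)" n] assms by (simp add: susp_zer)

lemma susp_hom: "f \<in> Hom T X Y \<Longrightarrow> suspA T n f \<in> Hom T (suspO T n X) (suspO T n Y)"
  by (auto simp: Hom_def)

section \<open>Exact triangles\<close>

lemma TriD:
  assumes "(f, g, h) \<in> Tri T"
  shows "f \<in> Arr T" "g \<in> Arr T" "h \<in> Arr T"
    "Cod T f = Dom T g" "Cod T g = Dom T h" "Cod T h = SigO T (Dom T f)"
  using Tri_candidate[OF tri assms] by (auto simp: candidate_triangle_def)

lemma Tri_rotate: "(f, g, h) \<in> Tri T \<Longrightarrow> (g, h, neg T (SigA T f)) \<in> Tri T"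
  using rotate[OF tri Tri_candidate[OF tri]] by blast

lemma Tri_id: "X \<in> Obj T \<Longrightarrow> zero_object T Z \<Longrightarrow> (Idn T X, Zer T X Z, Zer T Z (SigO T X)) \<in> Tri T"
  using tri[unfolded triangulated_def, THEN conjunct2, THEN conjunct2, THEN conjunct2,
      THEN conjunct2, THEN conjunct2, THEN conjunct2, THEN conjunct1] by blast

lemma Tri_cone: "f \<in> Arr T \<Longrightarrow> \<exists>g h. (f, g, h) \<in> Tri T"
  using tri[unfolded triangulated_def, THEN conjunct2, THEN conjunct2, THEN conjunct2,
      THEN conjunct2, THEN conjunct2, THEN conjunct2, THEN conjunct2, THEN conjunct1] by blast

lemma Tri_complete:
  assumes "(f, g, h) \<in> Tri T" "(f', g', h') \<in> Tri T" "a \<in> Arr T" "b \<in> Arr T"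
    "Dom T a = Dom T f" "Cod T a = Dom T f'" "Dom T b = Dom T g" "Cod T b = Dom T g'"
    "b \<cdot> f = f' \<cdot> a"
  obtains c where "c \<in> Arr T" "Dom T c = Dom T h" "Cod T c = Dom T h'"
    "c \<cdot> g = g' \<cdot> b" "SigA T a \<cdot> h = h' \<cdot> c"
proof -
  have "\<exists>c. triangle_map T (f, g, h) (f', g', h') a b c"
    using tri[unfolded triangulated_def, THEN conjunct2, THEN conjunct2, THEN conjunct2,
        THEN conjunct2, THEN conjunct2, THEN conjunct2, THEN conjunct2, THEN conjunct2,
        THEN conjunct2, THEN conjunct1, rule_format, OF assms(1,2)] assms
    by (auto simp: Hom_def)
  then show ?thesis using that by (auto simp: triangle_map_def Hom_def)
qed

lemma ex_zero: obtains Z where "zero_object T Z" "Z \<in> Obj T"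
  using tri by (auto simp: triangulated_def additive_category_def zero_object_def)

lemma zero_object_iff: "zero_object T Z \<longleftrightarrow> Z \<in> Obj T \<and> Idn T Z = Zer T Z Z"
proof
  assume "zero_object T Z"
  then show "Z \<in> Obj T \<and> Idn T Z = Zer T Z Z"
    using Id_Hom[OF tri] Zer_Hom[OF tri] unfolding zero_object_def by blast
next
  assume z: "Z \<in> Obj T \<and> Idn T Z = Zer T Z Z"
  have "f = Zer T Z Y" if "Y \<in> Obj T" "f \<in> Hom T Z Y" for f Y
  proof -
    have "f = f \<cdot> Idn T Z" using that by (simp add: Hom_def)
    also have "\<dots> = Zer T Z Y" using that z cmp_zer[of f Z Z] by (auto simp: Hom_def)
    finally show ?thesis .
  qed
  moreover have "f = Zer T Y Z" if "Y \<in> Obj T" "f \<in> Hom T Y Z" for f Y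
  proof -
    have "f = Idn T Z \<cdot> f" using that by (simp add: Hom_def)
    also have "\<dots> = Zer T Y Z" using that z zer_cmp[of f Z Z] by (auto simp: Hom_def)
    finally show ?thesis .
  qed
  ultimately show "zero_object T Z"
    unfolding zero_object_def using z Zer_Hom[OF tri] by metis
qed

lemma zero_object_hom:
  assumes "zero_object T Z"
  shows "f \<in> Arr T \<Longrightarrow> Dom T f = Z \<Longrightarrow> f = Zer T Z (Cod T f)" "f \<in> Arr T \<Longrightarrow> Cod T f = Z \<Longrightarrow> f = Zer T (Dom T f) Z"
proof -
  have Z: "Z \<in> Obj T" "Idn T Z = Zer T Z Z" using assms by (auto simp: zero_object_iff)
  show "f \<in> Arr T \<Longrightarrow> Dom T f = Z \<Longrightarrow> f = Zer T Z (Cod T f)"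
    using id_cmp(2)[of f Z] cmp_zer[of f Z Z] Z by metis
  show "f \<in> Arr T \<Longrightarrow> Cod T f = Z \<Longrightarrow> f = Zer T (Dom T f) Z"
    using id_cmp(1)[of f Z] zer_cmp[of f Z Z] Z by metis
qed

lemma zero_object_sig: assumes "zero_object T Z" shows "zero_object T (SigO T Z)"
  using assms sig_zer[of Z Z] Sig_Id[OF tri, of Z] by (simp add: zero_object_iff)

lemma Tri_cmp:
  assumes "(f, g, h) \<in> Tri T" shows "g \<cdot> f = Zer T (Dom T f) (Cod T g)"
proof -
  note d = TriD[OF assms]
  obtain Z where Z: "zero_object T Z" "Z \<in> Obj T" using ex_zero by blast
  have o: "Dom T f \<in> Obj T" using d by simp
  obtain c where c: "c \<in> Arr T" "Dom T c = Z" "Cod T c = Dom T h" "c \<cdot> Zer T (Dom T f) Z = g \<cdot> f"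
    by (rule Tri_complete[OF Tri_id[OF o Z(1)] assms, of "Idn T (Dom T f)" f]) (use d o Z in auto)
  then show ?thesis using d Z by simp
qed

text \<open>The weak universal properties express that \<open>Hom\<close> into or out of a fixed object turns an exact triangle
  into an exact sequence; the numbered variants are the same statement at the rotated positions.
  All of them come from completing a partial map between the given triangle and a rotation of
  $W \to W \to 0 \to \Sigma W$.\<close>

lemma weak_kernel:
  assumes t: "(f, g, h) \<in> Tri T" and a: "a \<in> Hom T W (Dom T g)" "g \<cdot> a = Zer T W (Cod T g)"
  obtains b where "b \<in> Hom T W (Dom T f)" "f \<cdot> b = a"
proof -
  note d = TriD[OF t]
  have aa: "a \<in> Arr T" "Dom T a = W" "Cod T a = Dom T g" "W \<in> Obj T" using a by (auto simp: Hom_def)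
  obtain Z where Z: "zero_object T Z" "Z \<in> Obj T" using ex_zero by blast
  obtain c where c: "c \<in> Arr T" "Dom T c = SigO T W" "Cod T c = SigO T (Dom T f)"
      "SigA T a \<cdot> neg T (SigA T (Idn T W)) = neg T (SigA T f) \<cdot> c"
    by (rule Tri_complete[OF Tri_rotate[OF Tri_id[OF aa(4) Z(1)]] Tri_rotate[OF t], of a "Zer T Z (Cod T g)"])
      (use d aa Z a in auto)
  have e: "SigA T f \<cdot> c = SigA T a"
  proof -
    have "neg T (SigA T a) = neg T (SigA T f \<cdot> c)" using c aa d by (simp add: Sig_Id[OF tri])
    then have "neg T (neg T (SigA T a)) = neg T (neg T (SigA T f \<cdot> c))" by simp
    then show ?thesis using c aa d by simp
  qed
  let ?b = "suspA T (-1) c"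
  have b: "?b \<in> Hom T W (Dom T f)"
    using c aa d by (simp add: Hom_def susp_susp flip: susp_1)
  moreover have "SigA T (f \<cdot> ?b) = SigA T a"
    using b d e c by (simp add: sig_cmp Hom_def) (simp add: susp_susp flip: susp_1)
  then have "f \<cdot> ?b = a" using b d aa by (subst (asm) sig_inj) (auto simp: Hom_def)
  ultimately show ?thesis using that by blast
qed

lemma weak_cokernel:
  assumes t: "(f, g, h) \<in> Tri T" and a: "a \<in> Hom T (Dom T g) W" "a \<cdot> f = Zer T (Dom T f) W"
  obtains b where "b \<in> Hom T (Cod T g) W" "b \<cdot> g = a"
proof -
  note d = TriD[OF t]
  have aa: "a \<in> Arr T" "Dom T a = Dom T g" "Cod T a = W" "W \<in> Obj T" using a by (auto simp: Hom_def)
  obtain Z where Z: "zero_object T Z" "Z \<in> Obj T" using ex_zero by blast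
  have "(Zer T Z W, Idn T W, Zer T W (SigO T Z)) \<in> Tri T"
    using Tri_id[OF aa(4) zero_object_sig[OF Z(1)]] Z aa
    by (subst rotate[OF tri]) (auto simp: candidate_triangle_def sig_zer)
  from Tri_complete[OF t this, of "Zer T (Dom T f) Z" a] show ?thesis
    using d aa Z a that by (auto simp: Hom_def)
qed

lemma weak_kernel2:
  assumes t: "(f, g, h) \<in> Tri T" and a: "a \<in> Hom T W (Dom T h)" "h \<cdot> a = Zer T W (Cod T h)"
  obtains b where "b \<in> Hom T W (Dom T g)" "g \<cdot> b = a"
  using weak_kernel[OF Tri_rotate[OF t] a] by metis

lemma weak_kernel3:
  assumes t: "(f, g, h) \<in> Tri T"
    and a: "a \<in> Hom T W (SigO T (Dom T f))" "SigA T f \<cdot> a = Zer T W (SigO T (Cod T f))"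
  obtains b where "b \<in> Hom T W (Dom T h)" "h \<cdot> b = a"
proof -
  note d = TriD[OF t]
  have "neg T (SigA T f) \<cdot> a = Zer T W (SigO T (Cod T f))" using a d by (auto simp: Hom_def)
  then obtain b where "b \<in> Hom T W (Dom T h)" "h \<cdot> b = a"
    using a(1) d by (auto intro: weak_kernel[OF Tri_rotate[OF Tri_rotate[OF t]], of a W])
  then show ?thesis using that by blast
qed

lemma weak_cokernel2:
  assumes t: "(f, g, h) \<in> Tri T" and a: "a \<in> Hom T (Dom T h) W" "a \<cdot> g = Zer T (Dom T g) W"
  obtains b where "b \<in> Hom T (Cod T h) W" "b \<cdot> h = a"
  using weak_cokernel[OF Tri_rotate[OF t] a] by metis

lemma weak_cokernel3:
  assumes t: "(f, g, h) \<in> Tri T"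
    and a: "a \<in> Hom T (SigO T (Dom T f)) W" "a \<cdot> h = Zer T (Dom T h) W"
  obtains b where "b \<in> Hom T (SigO T (Cod T f)) W" "b \<cdot> SigA T f = a"
proof -
  note d = TriD[OF t]
  obtain b where b: "b \<in> Hom T (SigO T (Cod T f)) W" "b \<cdot> neg T (SigA T f) = a"
    using a d by (auto intro: weak_cokernel[OF Tri_rotate[OF Tri_rotate[OF t]], of a W])
  then show ?thesis using that[of "neg T b"] d by (auto simp: Hom_def)
qed

lemma Tri_cmp3: assumes t: "(f, g, h) \<in> Tri T" shows "SigA T f \<cdot> h = Zer T (Dom T h) (SigO T (Cod T f))"
  using Tri_cmp[OF Tri_rotate[OF Tri_rotate[OF t]]] TriD[OF t]
  by (metis (no_types, lifting) cmp_arr neg_arr neg_cmp' neg_eq_zer sig_arr)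

text \<open>The connecting part $h a$ of a morphism into a cone, moved one step back along the triangle.\<close>

lemma desuspended_connecting:
  assumes t: "(f, g, h) \<in> Tri T" and fg: "f \<in> Hom T A B" "g \<in> Hom T B C" and a: "a \<in> Hom T X C"
  obtains b where "b \<in> Hom T (suspO T (- 1) X) A" "SigA T b = h \<cdot> a" "f \<cdot> b = Zer T (suspO T (- 1) X) B"
proof -
  note d = TriD[OF t]
  have a': "a \<in> Arr T" "Dom T a = X" "Cod T a = Dom T h" "X \<in> Obj T" and f': "Dom T f = A" "Cod T f = B"
    using a fg d by (auto simp: Hom_def)
  have o: "A \<in> Obj T" "B \<in> Obj T" using f' d by auto
  let ?b = "suspA T (- 1) (h \<cdot> a)" and ?X = "suspO T (- 1) X"
  have b: "?b \<in> Hom T ?X A" using a' f' d o by (simp add: Hom_def susp_susp flip: susp_1)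
  have sb: "SigA T ?b = h \<cdot> a" using a' d by (simp add: susp_susp flip: susp_1)
  have sX: "SigO T ?X = X" using a' by (simp add: susp_susp flip: susp_1)
  have "SigA T (f \<cdot> ?b) = SigA T f \<cdot> (h \<cdot> a)" using b sb f' d by (simp add: sig_cmp Hom_def)
  also have "\<dots> = (SigA T f \<cdot> h) \<cdot> a" using a' d by simp
  also have "\<dots> = SigA T (Zer T ?X B)" unfolding Tri_cmp3[OF t] using a' f' o sX by (simp add: sig_zer)
  finally have "f \<cdot> ?b = Zer T ?X B"
    using sig_inj(2)[of "f \<cdot> ?b" "Zer T ?X B"] b d f' o a' by (simp add: Hom_def)
  then show ?thesis using that b sb by blast
qed

text \<open>The obstruction to lifting \<open>a\<close> along \<open>g\<close> is a desuspended morphism into the source of \<open>f\<close> that \<open>f\<close> kills.\<close>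

lemma lift_to_middle:
  assumes t: "(f, g, h) \<in> Tri T" and fg: "f \<in> Hom T A B" "g \<in> Hom T B C" and a: "a \<in> Hom T X C"
    and mono: "\<And>b. b \<in> Hom T (suspO T (- 1) X) A \<Longrightarrow> f \<cdot> b = Zer T (suspO T (- 1) X) B \<Longrightarrow>
      b = Zer T (suspO T (- 1) X) A"
  obtains k where "k \<in> Hom T X B" "g \<cdot> k = a"
proof -
  note d = TriD[OF t]
  have X: "X \<in> Obj T" and D: "Dom T g = B" "Cod T g = C" "Dom T f = A" using a fg by (auto simp: Hom_def)
  have A: "A \<in> Obj T" using D d by auto
  obtain b where b: "b \<in> Hom T (suspO T (- 1) X) A" "SigA T b = h \<cdot> a" "f \<cdot> b = Zer T (suspO T (- 1) X) B"
    using desuspended_connecting[OF t fg a] by metis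
  have "h \<cdot> a = SigA T (Zer T (suspO T (- 1) X) A)" using b(2) mono[OF b(1,3)] by simp
  also have "\<dots> = Zer T (SigO T (suspO T (- 1) X)) (SigO T A)" using X A by (simp add: sig_zer)
  also have "\<dots> = Zer T X (Cod T h)" using X D d by (simp add: susp_susp flip: susp_1)
  finally have "h \<cdot> a = Zer T X (Cod T h)" .
  then show ?thesis using weak_kernel2[OF t, of a X] a D d that by metis
qed

lemma iso_if_zero_cone:
  assumes t: "(f, g, h) \<in> Tri T" and Z: "zero_object T (Cod T g)"
  shows "isomorphism T (Dom T f) (Cod T f) f"
proof -
  note d = TriD[OF t]
  have mono: "a = Zer T W (Dom T f)" if a: "a \<in> Hom T W (Dom T f)" "f \<cdot> a = Zer T W (Cod T f)" for a W
  proof -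
    have aa: "a \<in> Arr T" "Dom T a = W" "Cod T a = Dom T f" "W \<in> Obj T" using a by (auto simp: Hom_def)
    have "SigA T f \<cdot> SigA T a = Zer T (SigO T W) (SigO T (Cod T f))"
      using aa d a(2) by (simp add: sig_zer flip: sig_cmp)
    then obtain b where b: "b \<in> Hom T (SigO T W) (Dom T h)" "h \<cdot> b = SigA T a"
      using weak_kernel3[OF t, of "SigA T a" "SigO T W"] aa d by (auto simp: Hom_def)
    have "b = Zer T (SigO T W) (Dom T h)" using zero_object_hom(2)[OF Z, of b] b d by (simp add: Hom_def)
    then have "SigA T a = SigA T (Zer T W (Dom T f))" using b d aa by (simp add: sig_zer)
    then show ?thesis using sig_inj(2) aa d by simp
  qed
  have "g = Zer T (Dom T g) (Cod T g)" using zero_object_hom(2)[OF Z] d by simp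
  then obtain s where s: "s \<in> Hom T (Cod T f) (Dom T f)" "f \<cdot> s = Idn T (Cod T f)"
    using weak_kernel[OF t, of "Idn T (Cod T f)" "Cod T f"] d
    by (auto simp: Hom_def)
  let ?a = "Add T (s \<cdot> f) (neg T (Idn T (Dom T f)))"
  have "f \<cdot> (s \<cdot> f) = f" using s d cmp_assoc[of f s f] by (simp add: Hom_def)
  then have "f \<cdot> ?a = Add T f (neg T f)" using s d by (simp add: Hom_def cmp_add)
  then have "?a = Zer T (Dom T f) (Dom T f)"
    using mono[of ?a "Dom T f"] s d add_neg_iff[of f f] by (simp add: Hom_def)
  then have "s \<cdot> f = Idn T (Dom T f)"
    using add_neg_iff[of "s \<cdot> f" "Idn T (Dom T f)"] s d by (simp add: Hom_def)
  then show ?thesis using s d unfolding isomorphism_def by (auto simp: Hom_def)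
qed


lemma cmp_reduce:
  assumes "g \<cdot> f = k" "a \<in> Hom T W X" "f \<in> Hom T X Y" "g \<in> Hom T Y Z"
  shows "g \<cdot> (f \<cdot> a) = k \<cdot> a"
  using assms cmp_assoc[of a f g] by (auto simp: Hom_def)

lemma hom_zer: "f \<in> Hom T X Y \<Longrightarrow> Z \<in> Obj T \<Longrightarrow> Zer T Y Z \<cdot> f = Zer T X Z"
  and zer_hom: "f \<in> Hom T X Y \<Longrightarrow> Z \<in> Obj T \<Longrightarrow> f \<cdot> Zer T Z X = Zer T Z Y"
  by (auto simp: Hom_def)

lemma hom_obj: "f \<in> Hom T X Y \<Longrightarrow> X \<in> Obj T" "f \<in> Hom T X Y \<Longrightarrow> Y \<in> Obj T"
  by (auto simp: Hom_def)

section \<open>Coproducts\<close>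

lemma coproduct_inc:
  assumes "coproduct T I X P inc" "i \<in> I"
  shows "inc i \<in> Arr T" "Dom T (inc i) = X i" "Cod T (inc i) = P"
  using assms by (auto simp: coproduct_def Hom_def)

lemma coproduct_obj:
  assumes "coproduct T I X P inc"
  shows "P \<in> Obj T" "i \<in> I \<Longrightarrow> X i \<in> Obj T"
  using assms coproduct_inc[OF assms, of i] arr_obj(1)[of "inc i"] by (auto simp: coproduct_def)

lemma coproduct_out:
  assumes "coproduct T I X P inc" "Y \<in> Obj T" "\<And>i. i \<in> I \<Longrightarrow> g i \<in> Hom T (X i) Y"
  obtains h where "h \<in> Hom T P Y" "\<And>i. i \<in> I \<Longrightarrow> h \<cdot> inc i = g i"
proof -
  have "\<exists>!h. h \<in> Hom T P Y \<and> (\<forall>i\<in>I. h \<cdot> inc i = g i)"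
    using assms unfolding coproduct_def by blast
  then show ?thesis using that by blast
qed

lemma coproduct_eqI:
  assumes c: "coproduct T I X P inc" and h: "h \<in> Hom T P Y" "h' \<in> Hom T P Y"
    and e: "\<And>i. i \<in> I \<Longrightarrow> h \<cdot> inc i = h' \<cdot> inc i"
  shows "h = h'"
proof -
  have "Y \<in> Obj T" using Hom_Obj[OF tri h(1)] by simp
  moreover have "h \<cdot> inc i \<in> Hom T (X i) Y" if "i \<in> I" for i
    using coproduct_inc[OF c that] h by (simp add: Hom_def)
  ultimately have "\<exists>!k. k \<in> Hom T P Y \<and> (\<forall>i\<in>I. k \<cdot> inc i = h \<cdot> inc i)"
    using c[unfolded coproduct_def, THEN conjunct2, THEN conjunct2, rule_format, of Y "\<lambda>i. h \<cdot> inc i"]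
    by blast
  then show ?thesis using h e by metis
qed

lemma coproduct_susp:
  assumes c: "coproduct T I X P inc"
  shows "coproduct T I (\<lambda>i. suspO T n (X i)) (suspO T n P) (\<lambda>i. suspA T n (inc i))"
  unfolding coproduct_def
proof (intro conjI ballI allI impI)
  note o = coproduct_obj[OF c] and i = coproduct_inc[OF c]
  show "suspO T n P \<in> Obj T" using o by simp
  show "suspA T n (inc i) \<in> Hom T (suspO T n (X i)) (suspO T n P)" if "i \<in> I" for i
    using i[OF that] by (simp add: Hom_def)
  fix Y g assume Y: "Y \<in> Obj T" and g: "\<forall>i\<in>I. g i \<in> Hom T (suspO T n (X i)) Y"
  have Yo: "suspO T (- n) Y \<in> Obj T" using Y by simp
  obtain h where h: "h \<in> Hom T P (suspO T (- n) Y)" "\<And>i. i \<in> I \<Longrightarrow> h \<cdot> inc i = suspA T (- n) (g i)"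
  proof (rule coproduct_out[OF c Yo, of "\<lambda>i. suspA T (- n) (g i)"])
    show "suspA T (- n) (g i) \<in> Hom T (X i) (suspO T (- n) Y)" if "i \<in> I" for i
      using g that susp_hom[of "g i" "suspO T n (X i)" Y "- n"] o(2)[OF that]
      by (simp add: susp_susp)
  qed auto
  show "\<exists>!h. h \<in> Hom T (suspO T n P) Y \<and> (\<forall>i\<in>I. h \<cdot> suspA T n (inc i) = g i)"
  proof (rule ex1I[of _ "suspA T n h"], intro conjI ballI)
    show "suspA T n h \<in> Hom T (suspO T n P) Y"
      using susp_hom[OF h(1), of n] Y by (simp add: susp_susp)
    fix j assume j: "j \<in> I"
    have "suspA T n h \<cdot> suspA T n (inc j) = suspA T n (h \<cdot> inc j)"
      using h i[OF j] by (simp add: susp_cmp Hom_def)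
    then show "suspA T n h \<cdot> suspA T n (inc j) = g j"
      using h(2)[OF j] g j by (simp add: susp_susp Hom_def)
  next
    fix k assume k: "k \<in> Hom T (suspO T n P) Y \<and> (\<forall>i\<in>I. k \<cdot> suspA T n (inc i) = g i)"
    have kk: "suspA T (- n) k \<in> Hom T P (suspO T (- n) Y)"
      using k susp_hom[of k "suspO T n P" Y "- n"] o(1) by (simp add: susp_susp)
    have "suspA T (- n) k = h"
    proof (rule coproduct_eqI[OF c kk h(1)])
      fix j assume j: "j \<in> I"
      have "suspA T (- n) k \<cdot> suspA T (- n) (suspA T n (inc j)) = suspA T (- n) (g j)"
        using k i[OF j] j by (subst susp_cmp[symmetric]) (auto simp: Hom_def)
      then show "suspA T (- n) k \<cdot> inc j = h \<cdot> inc j" using h(2)[OF j] i[OF j] by (simp add: susp_susp)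
    qed
    then have "suspA T n (suspA T (- n) k) = suspA T n h" by simp
    then show "k = suspA T n h" using k by (simp add: susp_susp Hom_def)
  qed
qed

lemma coproduct_reindex:
  assumes c: "coproduct T I X P inc" and g: "inj_on g I"
  shows "coproduct T (g ` I) (X \<circ> inv_into I g) P (inc \<circ> inv_into I g)"
  unfolding coproduct_def
proof (intro conjI ballI allI impI)
  show "P \<in> Obj T" using coproduct_obj[OF c] by simp
  show "(inc \<circ> inv_into I g) i \<in> Hom T ((X \<circ> inv_into I g) i) P" if "i \<in> g ` I" for i
    using that g coproduct_inc[OF c] by (auto simp: Hom_def)
  fix Y f assume Y: "Y \<in> Obj T" and f: "\<forall>i\<in>g ` I. f i \<in> Hom T ((X \<circ> inv_into I g) i) Y"
  have "\<exists>!h. h \<in> Hom T P Y \<and> (\<forall>i\<in>I. h \<cdot> inc i = f (g i))"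
    using c[unfolded coproduct_def, THEN conjunct2, THEN conjunct2, rule_format, of Y "\<lambda>i. f (g i)"] Y f g
    by simp
  then show "\<exists>!h. h \<in> Hom T P Y \<and> (\<forall>i\<in>g ` I. h \<cdot> (inc \<circ> inv_into I g) i = f i)"
    using g by simp
qed

definition projections where
  "projections I X P inc \<pi> \<longleftrightarrow> (\<forall>i \<in> I. \<pi> i \<in> Hom T P (X i) \<and>
     (\<forall>j \<in> I. \<pi> i \<cdot> inc j = (if i = j then Idn T (X i) else Zer T (X j) (X i))))"

lemma projectionsD:
  assumes "projections I X P inc \<pi>"
  shows "i \<in> I \<Longrightarrow> \<pi> i \<in> Hom T P (X i)"
    "i \<in> I \<Longrightarrow> \<pi> i \<cdot> inc i = Idn T (X i)"
    "i \<in> I \<Longrightarrow> j \<in> I \<Longrightarrow> i \<noteq> j \<Longrightarrow> \<pi> i \<cdot> inc j = Zer T (X j) (X i)"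
  using assms by (auto simp: projections_def)

lemma coproduct_projections:
  assumes c: "coproduct T I X P inc"
  obtains \<pi> where "projections I X P inc \<pi>"
proof -
  have "\<exists>h. h \<in> Hom T P (X i) \<and> (\<forall>j\<in>I. h \<cdot> inc j = (if i = j then Idn T (X i) else Zer T (X j) (X i)))"
    if "i \<in> I" for i
    by (rule coproduct_out[OF c coproduct_obj(2)[OF c that], of "\<lambda>j. if i = j then Idn T (X i) else Zer T (X j) (X i)"])
      (use that coproduct_obj(2)[OF c] in \<open>auto simp: Hom_def\<close>)
  then obtain \<pi> where "\<forall>i\<in>I. \<pi> i \<in> Hom T P (X i) \<and> (\<forall>j\<in>I. \<pi> i \<cdot> inc j = (if i = j then Idn T (X i) else Zer T (X j) (X i)))"
    by metis
  then show ?thesis using that[of \<pi>] by (auto simp: projections_def)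
qed

abbreviation hsum where "hsum C P \<equiv> finprod (hom_group T C P)"

lemma hom_group_simps [simp]:
  "carrier (hom_group T C P) = Hom T C P" "mult (hom_group T C P) = Add T" "one (hom_group T C P) = Zer T C P"
  by (simp_all add: hom_group_def)

text \<open>Sums are taken in the group of morphisms with fixed ends, since that is where the comparison map in the
  definition of compactness lives.\<close>

lemma hom_comm_monoid: "C \<in> Obj T \<Longrightarrow> P \<in> Obj T \<Longrightarrow> comm_monoid (hom_group T C P)"
  using hom_comm_group[OF tri] comm_group.axioms(1) by blast

lemma hsum_empty [simp]: "C \<in> Obj T \<Longrightarrow> P \<in> Obj T \<Longrightarrow> hsum C P g {} = Zer T C P"
  using comm_monoid.finprod_empty[OF hom_comm_monoid] by simp

lemma hsum_insert:
  assumes "C \<in> Obj T" "P \<in> Obj T" "finite F" "i \<notin> F" "\<And>j. j \<in> insert i F \<Longrightarrow> g j \<in> Hom T C P"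
  shows "hsum C P g (insert i F) = Add T (g i) (hsum C P g F)"
  using comm_monoid.finprod_insert[OF hom_comm_monoid[OF assms(1,2)] assms(3,4), of g] assms(5)
  by auto

lemma hsum_hom:
  assumes "C \<in> Obj T" "P \<in> Obj T" "\<And>i. i \<in> F \<Longrightarrow> g i \<in> Hom T C P"
  shows "hsum C P g F \<in> Hom T C P"
  using comm_monoid.finprod_closed[OF hom_comm_monoid[OF assms(1,2)], of g F] assms(3) by auto

lemma cmp_hsum:
  assumes "C \<in> Obj T" "P \<in> Obj T" "finite F" "\<And>i. i \<in> F \<Longrightarrow> g i \<in> Hom T C P" "h \<in> Hom T P Y"
  shows "h \<cdot> hsum C P g F = hsum C Y (\<lambda>i. h \<cdot> g i) F"
  using assms(3,4)
proof (induction F rule: finite_induct)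
  case empty
  then show ?case using assms by (auto simp: Hom_def)
next
  case (insert i F)
  have Y: "Y \<in> Obj T" using Hom_Obj[OF tri assms(5)] by simp
  have "hsum C P g F \<in> Hom T C P" using assms(1,2) insert(4) by (intro hsum_hom) auto
  moreover have "g i \<in> Hom T C P" using insert by auto
  moreover have "h \<cdot> g j \<in> Hom T C Y" if "j \<in> insert i F" for j
    using insert(4)[OF that] assms(5) by (auto simp: Hom_def)
  ultimately show ?case
    using insert.IH insert.prems assms(1,2,5) Y hsum_insert[OF assms(1,2) insert(1,2), of g]
      hsum_insert[OF assms(1) Y insert(1,2), of "\<lambda>i. h \<cdot> g i"]
    by (simp add: cmp_add Hom_def)
qed

lemma hsum_cmp:
  assumes "C \<in> Obj T" "P \<in> Obj T" "finite F" "\<And>i. i \<in> F \<Longrightarrow> g i \<in> Hom T C P" "h \<in> Hom T Y C"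
  shows "hsum C P g F \<cdot> h = hsum Y P (\<lambda>i. g i \<cdot> h) F"
  using assms(3,4)
proof (induction F rule: finite_induct)
  case empty
  then show ?case using assms by (auto simp: Hom_def)
next
  case (insert i F)
  have Y: "Y \<in> Obj T" using Hom_Obj[OF tri assms(5)] by simp
  have "hsum C P g F \<in> Hom T C P" using assms(1,2) insert(4) by (intro hsum_hom) auto
  moreover have "g i \<in> Hom T C P" using insert by auto
  moreover have "g j \<cdot> h \<in> Hom T Y P" if "j \<in> insert i F" for j
    using insert(4)[OF that] assms(5) by (auto simp: Hom_def)
  ultimately show ?case
    using insert.IH insert.prems assms(1,2,5) Y hsum_insert[OF assms(1,2) insert(1,2), of g]
      hsum_insert[OF Y assms(2) insert(1,2), of "\<lambda>i. g i \<cdot> h"]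
    by (simp add: add_cmp Hom_def)
qed

lemma hsum_zero:
  assumes "C \<in> Obj T" "P \<in> Obj T" "finite F" "\<And>i. i \<in> F \<Longrightarrow> g i = Zer T C P"
  shows "hsum C P g F = Zer T C P"
  using comm_monoid.finprod_one_eqI[OF hom_comm_monoid[OF assms(1,2)], of F g] assms(4) by simp

lemma hsum_single:
  assumes "C \<in> Obj T" "P \<in> Obj T" "finite F" "j \<in> F" "g j \<in> Hom T C P"
    "\<And>i. i \<in> F \<Longrightarrow> i \<noteq> j \<Longrightarrow> g i = Zer T C P"
  shows "hsum C P g F = g j"
proof -
  have m: "F = insert j (F - {j})" using assms(4) by auto
  have "hsum C P g (F - {j}) = Zer T C P" using hsum_zero[of C P "F - {j}" g] assms by auto
  moreover have "g i \<in> Hom T C P" if "i \<in> insert j (F - {j})" for i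
    using assms(5,6) that Zer_Hom[OF tri assms(1,2)] by (cases "i = j") auto
  then have "hsum C P g (insert j (F - {j})) = Add T (g j) (hsum C P g (F - {j}))"
    using assms hsum_insert[of C P "F - {j}" j g] by auto
  ultimately show ?thesis using m assms by (auto simp: Hom_def)
qed

section \<open>Compact objects\<close>

text \<open>Surjectivity of the comparison map in the definition of compactness, in the form in which it is used: the
  morphisms that come from a single summand generate all others.\<close>

lemma compact_induct:
  fixes U :: "'u itself" and I :: "'u set"
  assumes C: "compact U T C" and I: "small U I" and c: "coproduct T I X P inc" and f: "f \<in> Hom T C P"
    and zer: "Q (Zer T C P)"
    and add: "\<And>a b. a \<in> Hom T C P \<Longrightarrow> b \<in> Hom T C P \<Longrightarrow> Q a \<Longrightarrow> Q b \<Longrightarrow> Q (Add T a b)"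
    and inc: "\<And>i \<phi>. i \<in> I \<Longrightarrow> \<phi> \<in> Hom T C (X i) \<Longrightarrow> Q (inc i \<cdot> \<phi>)"
  shows "Q f"
proof -
  have Co: "C \<in> Obj T" using C by (simp add: compact_def)
  note o = coproduct_obj[OF c] and i = coproduct_inc[OF c]
  have "bij_betw (\<lambda>\<phi>. hsum C P (\<lambda>i. inc i \<cdot> \<phi> i) {i \<in> I. \<phi> i \<noteq> Zer T C (X i)})
          (carrier (sum_group I (\<lambda>i. hom_group T C (X i)))) (Hom T C P)"
    by (rule C[unfolded compact_def, THEN conjunct2, rule_format, OF I o(2) c])
  then obtain \<phi> where \<phi>: "\<phi> \<in> carrier (sum_group I (\<lambda>i. hom_group T C (X i)))"
      "f = hsum C P (\<lambda>i. inc i \<cdot> \<phi> i) {i \<in> I. \<phi> i \<noteq> Zer T C (X i)}"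
    using f unfolding bij_betw_def by blast
  let ?F = "{i \<in> I. \<phi> i \<noteq> Zer T C (X i)}"
  have gr: "group (hom_group T C (X i))" if "i \<in> I" for i
    using hom_comm_group[OF tri Co o(2)[OF that]] comm_group.axioms(2) by blast
  have F: "finite ?F" and ty: "\<And>i. i \<in> I \<Longrightarrow> \<phi> i \<in> Hom T C (X i)"
    using \<phi>(1) gr by (auto simp: carrier_sum_group)
  have "Q (hsum C P (\<lambda>i. inc i \<cdot> \<phi> i) G)" if "finite G" "G \<subseteq> I" for G
    using that
  proof (induction G rule: finite_induct)
    case empty
    then show ?case using zer o Co by simp
  next
    case (insert j G)
    have ty': "inc k \<cdot> \<phi> k \<in> Hom T C P" if "k \<in> I" for k
      using i[OF that] ty[OF that] by (auto simp: Hom_def)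
    have "hsum C P (\<lambda>i. inc i \<cdot> \<phi> i) G \<in> Hom T C P"
      using insert ty' o Co by (auto intro!: hsum_hom)
    moreover have "hsum C P (\<lambda>i. inc i \<cdot> \<phi> i) (insert j G) = Add T (inc j \<cdot> \<phi> j) (hsum C P (\<lambda>i. inc i \<cdot> \<phi> i) G)"
      using insert ty' o Co by (intro hsum_insert) auto
    ultimately show ?case using add inc ty ty' insert by auto
  qed
  then show ?thesis using \<phi>(2) F by simp
qed

text \<open>Landing in finitely many summands, expressed by what annihilates \<open>f\<close>.  This form
  passes through compositions and triangles without mentioning sums.\<close>

definition finitely_supported where
  "finitely_supported I inc P f \<longleftrightarrow> (\<exists>F. finite F \<and> F \<subseteq> I \<and>
     (\<forall>Y. \<forall>h \<in> Hom T P Y. (\<forall>i\<in>F. h \<cdot> inc i = Zer T (Dom T (inc i)) Y) \<longrightarrow> h \<cdot> f = Zer T (Dom T f) Y))"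

lemma compact_finitely_supported:
  fixes U :: "'u itself" and I :: "'u set"
  assumes "compact U T C" "small U I" and c: "coproduct T I X P inc" and f: "f \<in> Hom T C P"
  shows "finitely_supported I inc P f"
proof (rule compact_induct[OF assms])
  have Co: "C \<in> Obj T" using Hom_Obj[OF tri f] by simp
  note o = coproduct_obj[OF c] and i = coproduct_inc[OF c]
  show "finitely_supported I inc P (Zer T C P)"
    using o Co unfolding finitely_supported_def by (intro exI[of _ "{}"]) (auto simp: Hom_def)
next
  fix a b assume h: "a \<in> Hom T C P" "b \<in> Hom T C P" "finitely_supported I inc P a" "finitely_supported I inc P b"
  then obtain F G where FG: "finite F" "F \<subseteq> I" "finite G" "G \<subseteq> I"
    "\<And>Y h. h \<in> Hom T P Y \<Longrightarrow> (\<forall>i\<in>F. h \<cdot> inc i = Zer T (Dom T (inc i)) Y) \<Longrightarrow> h \<cdot> a = Zer T (Dom T a) Y"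
    "\<And>Y h. h \<in> Hom T P Y \<Longrightarrow> (\<forall>i\<in>G. h \<cdot> inc i = Zer T (Dom T (inc i)) Y) \<Longrightarrow> h \<cdot> b = Zer T (Dom T b) Y"
    unfolding finitely_supported_def by metis
  show "finitely_supported I inc P (Add T a b)"
    unfolding finitely_supported_def
  proof (intro exI[of _ "F \<union> G"] conjI allI impI ballI)
    fix Y k assume k: "k \<in> Hom T P Y" "\<forall>i\<in>F \<union> G. k \<cdot> inc i = Zer T (Dom T (inc i)) Y"
    have "k \<cdot> a = Zer T C Y" "k \<cdot> b = Zer T C Y" using FG(5,6)[OF k(1)] k(2) h by (auto simp: Hom_def)
    then show "k \<cdot> Add T a b = Zer T (Dom T (Add T a b)) Y"
      using h k by (auto simp: Hom_def cmp_add)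
  qed (use FG in auto)
next
  fix i \<phi> assume i: "i \<in> I" "\<phi> \<in> Hom T C (X i)"
  show "finitely_supported I inc P (inc i \<cdot> \<phi>)"
    unfolding finitely_supported_def
  proof (intro exI[of _ "{i}"] conjI allI impI ballI)
    fix Y k assume k: "k \<in> Hom T P Y" "\<forall>j\<in>{i}. k \<cdot> inc j = Zer T (Dom T (inc j)) Y"
    note i' = coproduct_inc[OF c i(1)]
    have "k \<cdot> (inc i \<cdot> \<phi>) = Zer T (X i) Y \<cdot> \<phi>"
      by (rule cmp_reduce[OF _ i(2) _ k(1)]) (use k(2) i' in \<open>simp_all add: Hom_def\<close>)
    then show "k \<cdot> (inc i \<cdot> \<phi>) = Zer T (Dom T (inc i \<cdot> \<phi>)) Y"
      using hom_zer[OF i(2) hom_obj(2)[OF k(1)]] i(2) i' by (simp add: Hom_def)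
  qed (use i in auto)
qed

text \<open>Here $r = \mathrm{id} - \sum_{i \in F} \iota_i \pi_i$ is the projection away from the summands in \<open>F\<close>.\<close>

lemma coproduct_complement:
  assumes c: "coproduct T I X P inc" and F: "finite F" "F \<subseteq> I"
    and p: "projections I X P inc \<pi>"
  obtains r where "r \<in> Hom T P P" "\<And>j. j \<in> F \<Longrightarrow> r \<cdot> inc j = Zer T (Dom T (inc j)) P"
    "\<And>h Y. h \<in> Hom T P Y \<Longrightarrow> (\<And>i. i \<in> F \<Longrightarrow> h \<cdot> inc i = Zer T (X i) Y) \<Longrightarrow> h \<cdot> r = h"
    "\<And>g W. g \<in> Hom T W P \<Longrightarrow> r \<cdot> g = Zer T W P \<Longrightarrow> g = hsum W P (\<lambda>i. inc i \<cdot> (\<pi> i \<cdot> g)) F"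
proof -
  define e where "e = hsum P P (\<lambda>i. inc i \<cdot> \<pi> i) F"
  note o = coproduct_obj[OF c] and i = coproduct_inc[OF c]
  note \<pi> = projectionsD[OF p]
  have ty: "inc i \<cdot> \<pi> i \<in> Hom T P P" if "i \<in> I" for i
    using i[OF that] \<pi>(1)[OF that] by (auto simp: Hom_def)
  have e: "e \<in> Hom T P P" unfolding e_def using ty o F by (intro hsum_hom) auto
  have exp: "e \<cdot> g = hsum W P (\<lambda>i. inc i \<cdot> (\<pi> i \<cdot> g)) F" if g: "g \<in> Hom T W P" for g W
  proof -
    have W: "W \<in> Obj T" using Hom_Obj[OF tri g] by simp
    have "e \<cdot> g = hsum W P (\<lambda>i. (inc i \<cdot> \<pi> i) \<cdot> g) F"
      unfolding e_def using ty F o g by (intro hsum_cmp) auto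
    also have "\<dots> = hsum W P (\<lambda>i. inc i \<cdot> (\<pi> i \<cdot> g)) F"
    proof (rule comm_monoid.finprod_cong'[OF hom_comm_monoid[OF W o(1)]])
      fix k assume "k \<in> F"
      then have "k \<in> I" using F by auto
      then show "(inc k \<cdot> \<pi> k) \<cdot> g = inc k \<cdot> (\<pi> k \<cdot> g)" using i \<pi>(1)[of k] g by (simp add: Hom_def)
    next
      show "(\<lambda>i. inc i \<cdot> (\<pi> i \<cdot> g)) \<in> F \<rightarrow> carrier (hom_group T W P)"
      proof
        fix k assume "k \<in> F"
        then have "k \<in> I" using F by auto
        then show "inc k \<cdot> (\<pi> k \<cdot> g) \<in> carrier (hom_group T W P)" using i \<pi>(1)[of k] g by (simp add: Hom_def)
      qed
    qed simp
    finally show ?thesis .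
  qed
  have einc: "e \<cdot> inc j = inc j" if j: "j \<in> F" for j
  proof -
    have jI: "j \<in> I" using j F by auto
    have "e \<cdot> inc j = hsum (X j) P (\<lambda>i. inc i \<cdot> (\<pi> i \<cdot> inc j)) F"
      using exp[of "inc j" "X j"] i[OF jI] by (simp add: Hom_def)
    also have "\<dots> = inc j \<cdot> (\<pi> j \<cdot> inc j)"
    proof (rule hsum_single)
      fix k assume k: "k \<in> F" "k \<noteq> j"
      have "k \<in> I" using k F by auto
      then show "inc k \<cdot> (\<pi> k \<cdot> inc j) = Zer T (X j) P"
        using \<pi>(3)[of k j] jI k i o by simp
    qed (use o jI j F i \<pi> in \<open>auto simp: Hom_def\<close>)
    finally show ?thesis using \<pi>(2)[OF jI] i[OF jI] by simp
  qed
  have he: "h \<cdot> e = Zer T P Y" if h: "h \<in> Hom T P Y" "\<And>i. i \<in> F \<Longrightarrow> h \<cdot> inc i = Zer T (X i) Y" for h Y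
  proof -
    have Y: "Y \<in> Obj T" using Hom_Obj[OF tri h(1)] by simp
    have "h \<cdot> e = hsum P Y (\<lambda>i. h \<cdot> (inc i \<cdot> \<pi> i)) F"
      unfolding e_def using ty F o h by (intro cmp_hsum) auto
    also have "\<dots> = Zer T P Y"
    proof (rule hsum_zero)
      fix k assume k: "k \<in> F"
      then have kI: "k \<in> I" using F by auto
      have "h \<cdot> (inc k \<cdot> \<pi> k) = (h \<cdot> inc k) \<cdot> \<pi> k" using h(1) i[OF kI] \<pi>(1)[OF kI] by (simp add: Hom_def)
      then show "h \<cdot> (inc k \<cdot> \<pi> k) = Zer T P Y" using h(2)[OF k] \<pi>(1)[OF kI] Y by (simp add: Hom_def)
    qed (use o Y F in auto)
    finally show ?thesis .
  qed
  let ?r = "Add T (Idn T P) (neg T e)"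
  have ep: "parallel (Idn T P) e" using e o by (auto simp: Hom_def)
  show ?thesis
  proof (rule that[of ?r])
    show "?r \<in> Hom T P P" using ep o by (auto simp: Hom_def)
    show "?r \<cdot> inc j = Zer T (Dom T (inc j)) P" if "j \<in> F" for j
      using einc[OF that] ep F(2) that i[of j] o add_neg_iff[of "inc j" "inc j"] by (auto simp: add_cmp)
    show "h \<cdot> ?r = h" if h: "h \<in> Hom T P Y" "\<And>i. i \<in> F \<Longrightarrow> h \<cdot> inc i = Zer T (X i) Y" for h Y
      using he[OF h] h(1) ep hom_obj(2)[OF h(1)] o by (auto simp: cmp_add Hom_def)
    fix g W assume g: "g \<in> Hom T W P" and z: "?r \<cdot> g = Zer T W P"
    have "Add T g (neg T (e \<cdot> g)) = Zer T W P" using z g e o by (auto simp: Hom_def add_cmp)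
    moreover have "parallel g (e \<cdot> g)" using g e by (auto simp: Hom_def)
    ultimately have "g = e \<cdot> g" using add_neg_iff[of g "e \<cdot> g"] g by (simp add: Hom_def)
    then show "g = hsum W P (\<lambda>i. inc i \<cdot> (\<pi> i \<cdot> g)) F" using exp[OF g] by simp
  qed
qed

text \<open>Injectivity of the comparison map is automatic because the summands have projections.  For surjectivity,
  the complement of a finite support annihilates \<open>f\<close>, which writes \<open>f\<close> as a finite sum.\<close>

lemma compactI:
  assumes Co: "C \<in> Obj T"
    and fs: "\<And>(I :: 'u set) X P inc f. small (U :: 'u itself) I \<Longrightarrow> coproduct T I X P inc \<Longrightarrow> f \<in> Hom T C P \<Longrightarrow>
      finitely_supported I inc P f"
  shows "compact U T C"
  unfolding compact_def
proof (intro conjI allI impI)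
  fix I :: "'u set" and X P inc
  assume I: "small U I" and c: "coproduct T I X P inc"
  note o = coproduct_obj[OF c] and i = coproduct_inc[OF c]
  have gr: "group (hom_group T C (X i))" if "i \<in> I" for i
    using hom_comm_group[OF tri Co o(2)[OF that]] comm_group.axioms(2) by blast
  have car: "carrier (sum_group I (\<lambda>i. hom_group T C (X i))) =
      {\<phi> \<in> \<Pi>\<^sub>E i\<in>I. Hom T C (X i). finite {i \<in> I. \<phi> i \<noteq> Zer T C (X i)}}"
    using gr by (subst carrier_sum_group) auto
  obtain \<pi> where p: "projections I X P inc \<pi>"
    using coproduct_projections[OF c] by metis
  note \<pi> = projectionsD[OF p]
  let ?s = "\<lambda>\<phi>. {i \<in> I. \<phi> i \<noteq> Zer T C (X i)}"
  let ?\<Phi> = "\<lambda>\<phi>. hsum C P (\<lambda>i. inc i \<cdot> \<phi> i) (?s \<phi>)"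
  have ty: "inc k \<cdot> \<phi> k \<in> Hom T C P" if "k \<in> I" "\<phi> k \<in> Hom T C (X k)" for k \<phi>
    using i[OF that(1)] that(2) by (auto simp: Hom_def)
  have proj: "\<pi> j \<cdot> ?\<Phi> \<phi> = \<phi> j"
    if \<phi>: "\<And>i. i \<in> I \<Longrightarrow> \<phi> i \<in> Hom T C (X i)" "finite (?s \<phi>)" and j: "j \<in> I" for \<phi> j
  proof -
    have "\<pi> j \<cdot> ?\<Phi> \<phi> = hsum C (X j) (\<lambda>i. \<pi> j \<cdot> (inc i \<cdot> \<phi> i)) (?s \<phi>)"
      using \<phi> j \<pi> Co o ty by (intro cmp_hsum) auto
    also have "\<dots> = \<phi> j"
    proof -
      have t: "\<pi> j \<cdot> (inc i \<cdot> \<phi> i) = (\<pi> j \<cdot> inc i) \<cdot> \<phi> i" if "i \<in> I" for i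
        using i[OF that] \<phi>(1)[OF that] \<pi>(1)[OF j] by (simp add: Hom_def)
      have z: "\<pi> j \<cdot> (inc i \<cdot> \<phi> i) = Zer T C (X j)" if "i \<in> I" "i \<noteq> j" for i
        using t[OF that(1)] \<pi>(3)[OF j that(1)] that \<phi>(1)[OF that(1)] o j by (auto simp: Hom_def)
      have y: "\<pi> j \<cdot> (inc j \<cdot> \<phi> j) = \<phi> j" using t[OF j] \<pi>(2)[OF j] \<phi>(1)[OF j] by (simp add: Hom_def)
      show ?thesis
      proof (cases "\<phi> j = Zer T C (X j)")
        case True
        then show ?thesis using z \<phi> o j Co by (subst hsum_zero) auto
      next
        case False
        then have "hsum C (X j) (\<lambda>i. \<pi> j \<cdot> (inc i \<cdot> \<phi> i)) (?s \<phi>) = \<pi> j \<cdot> (inc j \<cdot> \<phi> j)"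
          using z \<phi> o j Co y by (intro hsum_single) auto
        then show ?thesis using y by simp
      qed
    qed
    finally show ?thesis .
  qed
  show "bij_betw ?\<Phi> (carrier (sum_group I (\<lambda>i. hom_group T C (X i)))) (Hom T C P)"
    unfolding car bij_betw_def
  proof (intro conjI inj_onI subset_antisym subsetI)
    fix \<phi> \<psi> assume h: "\<phi> \<in> {\<phi> \<in> \<Pi>\<^sub>E i\<in>I. Hom T C (X i). finite (?s \<phi>)}"
      "\<psi> \<in> {\<phi> \<in> \<Pi>\<^sub>E i\<in>I. Hom T C (X i). finite (?s \<phi>)}" "?\<Phi> \<phi> = ?\<Phi> \<psi>"
    have pe: "\<phi> \<in> (\<Pi>\<^sub>E i\<in>I. Hom T C (X i))" "\<psi> \<in> (\<Pi>\<^sub>E i\<in>I. Hom T C (X i))"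
      and fin: "finite (?s \<phi>)" "finite (?s \<psi>)" using h(1,2) by blast+
    show "\<phi> = \<psi>"
    proof (rule PiE_ext[OF pe])
      fix j assume j: "j \<in> I"
      have "\<pi> j \<cdot> ?\<Phi> \<phi> = \<phi> j" by (rule proj[OF PiE_mem[OF pe(1)] fin(1) j])
      moreover have "\<pi> j \<cdot> ?\<Phi> \<psi> = \<psi> j" by (rule proj[OF PiE_mem[OF pe(2)] fin(2) j])
      ultimately show "\<phi> j = \<psi> j" using h(3) by simp
    qed
  next
    fix f assume "f \<in> ?\<Phi> ` {\<phi> \<in> \<Pi>\<^sub>E i\<in>I. Hom T C (X i). finite (?s \<phi>)}"
    then show "f \<in> Hom T C P" using ty Co o by (auto intro!: hsum_hom)
  next
    fix f assume f: "f \<in> Hom T C P"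
    obtain F where F: "finite F" "F \<subseteq> I"
      "\<And>Y h. h \<in> Hom T P Y \<Longrightarrow> (\<forall>i\<in>F. h \<cdot> inc i = Zer T (Dom T (inc i)) Y) \<Longrightarrow> h \<cdot> f = Zer T (Dom T f) Y"
      using fs[OF I c f] unfolding finitely_supported_def by metis
    obtain r where r: "r \<in> Hom T P P" "\<And>j. j \<in> F \<Longrightarrow> r \<cdot> inc j = Zer T (Dom T (inc j)) P"
      "\<And>h Y. h \<in> Hom T P Y \<Longrightarrow> (\<And>i. i \<in> F \<Longrightarrow> h \<cdot> inc i = Zer T (X i) Y) \<Longrightarrow> h \<cdot> r = h"
      "\<And>g W. g \<in> Hom T W P \<Longrightarrow> r \<cdot> g = Zer T W P \<Longrightarrow> g = hsum W P (\<lambda>i. inc i \<cdot> (\<pi> i \<cdot> g)) F"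
      by (rule coproduct_complement[OF c F(1,2) p]) blast
    have "r \<cdot> f = Zer T C P" using F(3)[OF r(1)] r(2) f by (auto simp: Hom_def)
    then have fe: "f = hsum C P (\<lambda>i. inc i \<cdot> (\<pi> i \<cdot> f)) F" using r(4)[OF f] by blast
    \<comment> \<open>the preimage under the comparison map\<close>
    define \<phi> where "\<phi> = (\<lambda>i\<in>I. if i \<in> F then \<pi> i \<cdot> f else Zer T C (X i))"
    have \<phi>: "\<phi> k \<in> Hom T C (X k)" if "k \<in> I" for k
      using \<pi>(1)[OF that] f o that Co unfolding \<phi>_def by (auto simp: Hom_def)
    have s: "?s \<phi> \<subseteq> F" using F(2) by (auto simp: \<phi>_def)
    have "hsum C P (\<lambda>i. inc i \<cdot> \<phi> i) (?s \<phi>) = hsum C P (\<lambda>i. inc i \<cdot> (\<pi> i \<cdot> f)) F"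
    proof (rule comm_monoid.finprod_mono_neutral_cong_left[OF hom_comm_monoid[OF Co o(1)] F(1) s])
      fix k assume "k \<in> F - ?s \<phi>"
      then have "k \<in> I" "\<pi> k \<cdot> f = Zer T C (X k)" using F(2) by (auto simp: \<phi>_def)
      then show "inc k \<cdot> (\<pi> k \<cdot> f) = one (hom_group T C P)" using i o Co by simp
    next
      show "inc k \<cdot> \<phi> k = inc k \<cdot> (\<pi> k \<cdot> f)" if "k \<in> ?s \<phi>" for k using that s by (auto simp: \<phi>_def)
      show "(\<lambda>i. inc i \<cdot> (\<pi> i \<cdot> f)) \<in> F \<rightarrow> carrier (hom_group T C P)"
      proof
        fix k assume "k \<in> F"
        then have "k \<in> I" using F by auto
        then show "inc k \<cdot> (\<pi> k \<cdot> f) \<in> carrier (hom_group T C P)" using i \<pi>(1)[of k] f by (simp add: Hom_def)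
      qed
    qed
    then have "f = ?\<Phi> \<phi>" using fe by simp
    moreover have "\<phi> \<in> {\<phi> \<in> \<Pi>\<^sub>E i\<in>I. Hom T C (X i). finite (?s \<phi>)}"
      using \<phi> finite_subset[OF s F(1)] by (auto simp: \<phi>_def)
    ultimately show "f \<in> ?\<Phi> ` {\<phi> \<in> \<Pi>\<^sub>E i\<in>I. Hom T C (X i). finite (?s \<phi>)}" by (rule image_eqI)
  qed
qed (rule Co)

lemma compact_obj: "compact U T C \<Longrightarrow> C \<in> Obj T" by (simp add: compact_def)

lemma compact_susp:
  fixes U :: "'u itself"
  assumes C: "compact U T C" shows "compact U T (suspO T n C)"
proof (rule compactI)
  show "suspO T n C \<in> Obj T" using compact_obj[OF C] by simp
  fix I :: "'u set" and X P inc f assume I: "small U I" and c: "coproduct T I X P inc" and f: "f \<in> Hom T (suspO T n C) P"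
  note o = coproduct_obj[OF c] and i = coproduct_inc[OF c]
  have "suspA T (- n) f \<in> Hom T C (suspO T (- n) P)"
    using susp_hom[OF f, of "- n"] compact_obj[OF C] by (simp add: susp_susp)
  from compact_finitely_supported[OF C I coproduct_susp[OF c, of "- n"] this]
  obtain F where F: "finite F" "F \<subseteq> I"
      "\<And>Y h. h \<in> Hom T (suspO T (- n) P) Y \<Longrightarrow> (\<forall>i\<in>F. h \<cdot> suspA T (- n) (inc i) = Zer T (Dom T (suspA T (- n) (inc i))) Y)
        \<Longrightarrow> h \<cdot> suspA T (- n) f = Zer T (Dom T (suspA T (- n) f)) Y"
    unfolding finitely_supported_def by metis
  show "finitely_supported I inc P f"
    unfolding finitely_supported_def
  proof (intro exI[of _ F] conjI allI impI ballI)
    fix Y h assume h: "h \<in> Hom T P Y" "\<forall>i\<in>F. h \<cdot> inc i = Zer T (Dom T (inc i)) Y"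
    have "suspA T (- n) h \<cdot> suspA T (- n) f = Zer T (Dom T (suspA T (- n) f)) (suspO T (- n) Y)"
    proof (rule F(3)[OF susp_hom[OF h(1)]], intro ballI)
      fix k assume k: "k \<in> F"
      have "suspA T (- n) (h \<cdot> inc k) = suspA T (- n) (Zer T (Dom T (inc k)) Y)" using h k by simp
      then show "suspA T (- n) h \<cdot> suspA T (- n) (inc k) = Zer T (Dom T (suspA T (- n) (inc k))) (suspO T (- n) Y)"
        using i[of k] k F(2) h(1) Hom_Obj[OF tri h(1)] o by (auto simp: Hom_def susp_cmp susp_zer)
    qed
    then have "suspA T (- n) (h \<cdot> f) = Zer T (suspO T (- n) (Dom T (h \<cdot> f))) (suspO T (- n) (Cod T (h \<cdot> f)))"
      using h(1) f by (auto simp: Hom_def susp_cmp)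
    then show "h \<cdot> f = Zer T (Dom T f) Y"
      using h(1) f susp_eq_zer[of "h \<cdot> f" _ "- n"] by (auto simp: Hom_def)
  qed (use F in auto)
qed

text \<open>A morphism \<open>k\<close> out of the cone has finite support after composition with \<open>g\<close>.  Off that support it
  factors through the suspension of the first object, which is compact as well.\<close>

lemma compact_cone:
  fixes U :: "'u itself"
  assumes t: "(f, g, h) \<in> Tri T" and C: "compact U T (Dom T f)" "compact U T (Dom T g)"
  shows "compact U T (Dom T h)"
proof (rule compactI)
  note d = TriD[OF t]
  show "Dom T h \<in> Obj T" using d by simp
  fix I :: "'u set" and X P inc k assume I: "small U I" and c: "coproduct T I X P inc" and k: "k \<in> Hom T (Dom T h) P"
  note o = coproduct_obj[OF c] and i = coproduct_inc[OF c]
  have "k \<cdot> g \<in> Hom T (Dom T g) P" using k d by (simp add: Hom_def)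
  from compact_finitely_supported[OF C(2) I c this] obtain F where F: "finite F" "F \<subseteq> I"
      "\<And>Y h. h \<in> Hom T P Y \<Longrightarrow> (\<forall>i\<in>F. h \<cdot> inc i = Zer T (Dom T (inc i)) Y) \<Longrightarrow> h \<cdot> (k \<cdot> g) = Zer T (Dom T (k \<cdot> g)) Y"
    unfolding finitely_supported_def by metis
  obtain \<pi> where p: "projections I X P inc \<pi>"
    using coproduct_projections[OF c] by metis
  obtain r where r: "r \<in> Hom T P P" "\<And>j. j \<in> F \<Longrightarrow> r \<cdot> inc j = Zer T (Dom T (inc j)) P"
    "\<And>h Y. h \<in> Hom T P Y \<Longrightarrow> (\<And>i. i \<in> F \<Longrightarrow> h \<cdot> inc i = Zer T (X i) Y) \<Longrightarrow> h \<cdot> r = h"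
    "\<And>g W. g \<in> Hom T W P \<Longrightarrow> r \<cdot> g = Zer T W P \<Longrightarrow> g = hsum W P (\<lambda>i. inc i \<cdot> (\<pi> i \<cdot> g)) F"
    by (rule coproduct_complement[OF c F(1,2) p]) blast
  have "r \<cdot> (k \<cdot> g) = Zer T (Dom T g) P" using F(3)[OF r(1)] r(2) d k by (auto simp: Hom_def)
  then have "(r \<cdot> k) \<cdot> g = Zer T (Dom T g) P" using r(1) d k by (auto simp: Hom_def)
  moreover have "r \<cdot> k \<in> Hom T (Dom T h) P" using r(1) k by (auto simp: Hom_def)
  ultimately obtain b where b: "b \<in> Hom T (Cod T h) P" "b \<cdot> h = r \<cdot> k"
    using weak_cokernel2[OF t] by metis
  have "b \<in> Hom T (suspO T 1 (Dom T f)) P" using b(1) d by (simp add: susp_1)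
  from compact_finitely_supported[OF compact_susp[OF C(1)] I c this] obtain G where G: "finite G" "G \<subseteq> I"
      "\<And>Y h. h \<in> Hom T P Y \<Longrightarrow> (\<forall>i\<in>G. h \<cdot> inc i = Zer T (Dom T (inc i)) Y) \<Longrightarrow> h \<cdot> b = Zer T (Dom T b) Y"
    unfolding finitely_supported_def by metis
  show "finitely_supported I inc P k"
    unfolding finitely_supported_def
  proof (intro exI[of _ "F \<union> G"] conjI allI impI ballI)
    fix Y l assume l: "l \<in> Hom T P Y" "\<forall>i\<in>F \<union> G. l \<cdot> inc i = Zer T (Dom T (inc i)) Y"
    have Y: "Y \<in> Obj T" using Hom_Obj[OF tri l(1)] by simp
    have "l \<cdot> r = l" by (rule r(3)[OF l(1)]) (use l(2) i F in auto)
    then have "l \<cdot> k = l \<cdot> (r \<cdot> k)" using l(1) r(1) k cmp_assoc[of k r l] by (auto simp: Hom_def)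
    also have "\<dots> = (l \<cdot> b) \<cdot> h" using b d l(1) by (auto simp: Hom_def)
    also have "\<dots> = Zer T (Dom T k) Y" using G(3)[OF l(1)] l b(1) d k Y by (auto simp: Hom_def)
    finally show "l \<cdot> k = Zer T (Dom T k) Y" .
  qed (use F G in auto)
qed

lemma small_countable:
  assumes "uncountable (UNIV :: 'u set)" "countable (A :: 'u set)" shows "small TYPE('u) A"
  unfolding small_def lesspoll_def
proof
  show "A \<lesssim> (UNIV :: 'u set)" by (simp add: subset_imp_lepoll)
  show "\<not> A \<approx> (UNIV :: 'u set)"
  proof
    assume "A \<approx> (UNIV :: 'u set)"
    then obtain g where "bij_betw g A (UNIV :: 'u set)" by (auto simp: eqpoll_def)
    then show False using assms by (metis bij_betw_def countable_image)
  qed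
qed

text \<open>Homotopy colimits use sequences indexed by natural numbers, whereas compact objects and localizing
  subcategories refer to small index sets in the type \<open>'u\<close>.\<close>

lemma sequence_coproduct_small:
  fixes X :: "nat \<Rightarrow> 'o"
  assumes u: "uncountable (UNIV :: 'u set)" and c: "coproduct T {1..} X P inc"
  obtains I :: "'u set" and g where "small TYPE('u) I" "g ` I = {1..}"
    "coproduct T I (X \<circ> g) P (inc \<circ> g)"
proof -
  have "infinite (UNIV :: 'u set)" using u countable_finite by blast
  then obtain g :: "nat \<Rightarrow> 'u" where "inj g" using infinite_countable_subset by blast
  then have g: "inj_on g {1..}" by (rule inj_on_subset) simp
  show ?thesis
  proof (rule that[OF _ _ coproduct_reindex[OF c g]])
    show "small TYPE('u) (g ` {1..})" using u by (intro small_countable) auto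
    show "inv_into {1..} g ` g ` {1..} = {1..}" using g by (intro inv_into_image_cancel) auto
  qed
qed


section \<open>Localizing subcategories and orthogonality\<close>

definition orthogonal where
  "orthogonal X Y \<longleftrightarrow> (\<forall>f \<in> Hom T X Y. f = Zer T X Y)"

lemma orthogonal_susp:
  assumes "X \<in> Obj T" "Y \<in> Obj T" "orthogonal X Y" shows "orthogonal (suspO T n X) (suspO T n Y)"
  unfolding orthogonal_def
proof
  fix f assume f: "f \<in> Hom T (suspO T n X) (suspO T n Y)"
  have "suspA T (- n) f \<in> Hom T X Y" using susp_hom[OF f, of "- n"] assms by (simp add: susp_susp)
  then have "suspA T (- n) f = Zer T X Y" using assms(3) by (simp add: orthogonal_def)
  then have "suspA T n (suspA T (- n) f) = suspA T n (Zer T X Y)" by simp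
  then show "f = Zer T (suspO T n X) (suspO T n Y)"
    using f assms by (simp add: susp_susp susp_zer Hom_def)
qed

lemma orthogonal_shift:
  assumes "X \<in> Obj T" "Y \<in> Obj T"
  shows "orthogonal (suspO T n X) (suspO T m Y) \<longleftrightarrow> orthogonal X (suspO T (m - n) Y)"
  using orthogonal_susp[of X "suspO T (m - n) Y" n] orthogonal_susp[of "suspO T n X" "suspO T m Y" "- n"] assms
  by (auto simp: susp_susp)

text \<open>All suspensions of \<open>Y\<close> are needed to make the class closed under suspension.\<close>

lemma localizing_left_orthogonal:
  assumes Y: "Y \<in> Obj T"
  shows "localizing U T {X \<in> Obj T. \<forall>n. orthogonal X (suspO T n Y)}"
  unfolding localizing_def
proof (intro conjI ballI allI impI)
  let ?S = "{X \<in> Obj T. \<forall>n. orthogonal X (suspO T n Y)}"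
  show "?S \<subseteq> Obj T" by auto
  show "{Z. zero_object T Z} \<subseteq> ?S"
  proof
    fix Z assume "Z \<in> {Z. zero_object T Z}"
    then have Z: "zero_object T Z" by simp
    have "f = Zer T Z (suspO T n Y)" if f: "f \<in> Hom T Z (suspO T n Y)" for f n
    proof -
      have "Cod T f = suspO T n Y" using f by (simp add: Hom_def)
      moreover have "f = Zer T Z (Cod T f)" by (rule zero_object_hom(1)[OF Z]) (use f in \<open>simp_all add: Hom_def\<close>)
      ultimately show ?thesis by metis
    qed
    then show "Z \<in> ?S" using Z by (auto simp: orthogonal_def zero_object_def)
  qed
  show "SigO T X \<in> ?S \<longleftrightarrow> X \<in> ?S" if X: "X \<in> Obj T" for X
  proof -
    have e: "orthogonal (SigO T X) (suspO T n Y) \<longleftrightarrow> orthogonal X (suspO T (n - 1) Y)" for n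
      using orthogonal_shift[OF X Y, of 1 n] by (simp add: susp_1)
    have "(\<forall>n. orthogonal X (suspO T (n - 1) Y)) \<longleftrightarrow> (\<forall>n. orthogonal X (suspO T n Y))"
      by (metis diff_add_cancel add_diff_cancel_right')
    then show ?thesis using X e by simp
  qed
  fix f g h assume t: "(f, g, h) \<in> Tri T"
  note d = TriD[OF t]
  have sig: "orthogonal (SigO T X) (suspO T n Y)" if "X \<in> ?S" for X n
    using orthogonal_shift[of X Y 1 n] that Y by (simp add: susp_1)
  show "Dom T h \<in> ?S" if s: "Dom T f \<in> ?S" "Dom T g \<in> ?S"
    unfolding orthogonal_def
  proof (intro CollectI conjI allI ballI)
    fix n k assume k: "k \<in> Hom T (Dom T h) (suspO T n Y)"
    have "k \<cdot> g = Zer T (Dom T g) (suspO T n Y)" using s(2) k d by (simp add: orthogonal_def Hom_def)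
    then obtain b where b: "b \<in> Hom T (Cod T h) (suspO T n Y)" "b \<cdot> h = k" using weak_cokernel2[OF t k] by metis
    then have "b = Zer T (Cod T h) (suspO T n Y)" using sig[OF s(1), of n] d by (simp add: orthogonal_def)
    then show "k = Zer T (Dom T h) (suspO T n Y)" using b d Y by simp
  qed (use d in simp)
  show "Dom T f \<in> ?S" if s: "Dom T g \<in> ?S" "Dom T h \<in> ?S"
    unfolding orthogonal_def
  proof (intro CollectI conjI allI ballI)
    fix n k assume k: "k \<in> Hom T (Dom T f) (suspO T n Y)"
    have sk: "SigA T k \<in> Hom T (SigO T (Dom T f)) (suspO T (n + 1) Y)" using k Y by (simp add: Hom_def susp_step_up)
    have "SigA T k \<cdot> h \<in> Hom T (Dom T h) (suspO T (n + 1) Y)" using sk d by (simp add: Hom_def)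
    then have "SigA T k \<cdot> h = Zer T (Dom T h) (suspO T (n + 1) Y)" using s(2) by (simp add: orthogonal_def)
    then obtain b where b: "b \<in> Hom T (SigO T (Cod T f)) (suspO T (n + 1) Y)" "b \<cdot> SigA T f = SigA T k"
      using weak_cokernel3[OF t sk] by metis
    then have "b = Zer T (SigO T (Cod T f)) (suspO T (n + 1) Y)"
      using sig[OF s(1), of "n + 1"] d by (simp add: orthogonal_def)
    then have "SigA T k = Zer T (SigO T (Dom T f)) (suspO T (n + 1) Y)" using b d Y by simp
    then have "SigA T k = SigA T (Zer T (Dom T f) (suspO T n Y))" using sig_zer d Y by (simp add: susp_step_up)
    then show "k = Zer T (Dom T f) (suspO T n Y)" using sig_inj(2) k d Y by (simp add: Hom_def)
  qed (use d in simp)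
  show "Dom T g \<in> ?S" if s: "Dom T f \<in> ?S" "Dom T h \<in> ?S"
    unfolding orthogonal_def
  proof (intro CollectI conjI allI ballI)
    fix n k assume k: "k \<in> Hom T (Dom T g) (suspO T n Y)"
    have "k \<cdot> f = Zer T (Dom T f) (suspO T n Y)" using s(1) k d by (simp add: orthogonal_def Hom_def)
    then obtain b where b: "b \<in> Hom T (Cod T g) (suspO T n Y)" "b \<cdot> g = k" using weak_cokernel[OF t k] by metis
    then have "b = Zer T (Cod T g) (suspO T n Y)" using s(2) d by (simp add: orthogonal_def)
    then show "k = Zer T (Dom T g) (suspO T n Y)" using b d Y by simp
  qed (use d in simp)
next
  let ?S = "{X \<in> Obj T. \<forall>n. orthogonal X (suspO T n Y)}"
  fix I :: "'a set" and X P inc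
  assume s: "\<forall>i\<in>I. X i \<in> ?S" and c: "coproduct T I X P inc"
  show "P \<in> ?S" unfolding orthogonal_def
  proof (intro CollectI conjI allI ballI)
    fix n k assume k: "k \<in> Hom T P (suspO T n Y)"
    show "k = Zer T P (suspO T n Y)"
    proof (rule coproduct_eqI[OF c k])
      show "Zer T P (suspO T n Y) \<in> Hom T P (suspO T n Y)" using Y coproduct_obj[OF c] by (simp add: Hom_def)
      fix i assume i: "i \<in> I"
      have "k \<cdot> inc i = Zer T (X i) (suspO T n Y)"
        using s i k coproduct_inc[OF c i] by (simp add: orthogonal_def Hom_def)
      then show "k \<cdot> inc i = Zer T P (suspO T n Y) \<cdot> inc i" using coproduct_inc[OF c i] Y by simp
    qed
  qed (use coproduct_obj[OF c] in simp)
qed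

lemma localizing_generated:
  fixes U :: "'u itself"
  assumes "G \<subseteq> Obj T"
  shows "localizing U T (localizing_generated_by U T G)" "G \<subseteq> localizing_generated_by U T G"
proof -
  have "localizing U T (Obj T)"
    unfolding localizing_def
  proof (intro conjI ballI allI impI)
    show "Dom T f \<in> Obj T" "Dom T g \<in> Obj T" "Dom T h \<in> Obj T" if "(f, g, h) \<in> Tri T" for f g h
      using TriD[OF that] by simp_all
  qed (auto simp: zero_object_iff dest: coproduct_obj(1))
  then have o: "localizing_generated_by U T G \<subseteq> Obj T"
    using assms unfolding localizing_generated_by_def by blast
  show "G \<subseteq> localizing_generated_by U T G" unfolding localizing_generated_by_def by blast
  show "localizing U T (localizing_generated_by U T G)"
    unfolding localizing_def
  proof (intro conjI ballI allI impI o)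
    let ?L = "localizing_generated_by U T G"
    show "{Z. zero_object T Z} \<subseteq> ?L"
      unfolding localizing_generated_by_def by (auto simp: localizing_def)
    show "SigO T X \<in> ?L \<longleftrightarrow> X \<in> ?L" if X: "X \<in> Obj T" for X
      using X unfolding localizing_generated_by_def by (auto simp: localizing_def)
    fix f g h assume t: "(f, g, h) \<in> Tri T"
    show "Dom T h \<in> ?L" if "Dom T f \<in> ?L" "Dom T g \<in> ?L"
      using t that unfolding localizing_generated_by_def localizing_def by blast
    show "Dom T f \<in> ?L" if "Dom T g \<in> ?L" "Dom T h \<in> ?L"
      using t that unfolding localizing_generated_by_def localizing_def by blast
    show "Dom T g \<in> ?L" if "Dom T f \<in> ?L" "Dom T h \<in> ?L"
      using t that unfolding localizing_generated_by_def localizing_def by blast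
  next
    let ?L = "localizing_generated_by U T G"
    fix I :: "'u set" and X P inc
    assume h: "small U I" "\<forall>i\<in>I. X i \<in> ?L" "coproduct T I X P inc"
    show "P \<in> ?L"
      unfolding localizing_generated_by_def
    proof (intro InterI, elim CollectE conjE)
      fix S assume S: "localizing U T S" "G \<subseteq> S"
      then have "\<forall>i\<in>I. X i \<in> S" using h(2) unfolding localizing_generated_by_def by blast
      then show "P \<in> S" using S(1) h(1,3) unfolding localizing_def by blast
    qed
  qed
qed

lemma generated_left_orthogonal:
  fixes U :: "'u itself"
  assumes G: "G \<subseteq> Obj T" "\<And>X n. X \<in> G \<Longrightarrow> suspO T n X \<in> G" and Y: "Y \<in> Obj T"
    and o: "\<And>X. X \<in> G \<Longrightarrow> orthogonal X Y" and X: "X \<in> localizing_generated_by U T G"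
  shows "orthogonal X Y"
proof -
  let ?S = "{X \<in> Obj T. \<forall>n. orthogonal X (suspO T n Y)}"
  have "orthogonal D (suspO T n Y)" if "D \<in> G" for D n
    using orthogonal_shift[of D Y "- n" 0] o[OF G(2)[OF that, of "- n"]] that G(1) Y by auto
  then have "G \<subseteq> ?S" using G(1) by auto
  then have "X \<in> ?S"
    using X localizing_left_orthogonal[OF Y, of U] unfolding localizing_generated_by_def by blast
  then show ?thesis using susp_0 by (metis (mono_tags, lifting) mem_Collect_eq)
qed

lemma localizing_susp:
  assumes S: "localizing U T S" and X: "X \<in> S" shows "suspO T n X \<in> S"
proof -
  have o: "X \<in> Obj T" using assms by (auto simp: localizing_def)
  show ?thesis
    by (rule int_orbit[of _ n]) (use S X o in \<open>simp_all add: susp_step_up localizing_def\<close>)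
qed

lemma localizing_cone:
  assumes S: "localizing U T S" and t: "(f, g, h) \<in> Tri T"
  shows "Dom T f \<in> S \<Longrightarrow> Dom T g \<in> S \<Longrightarrow> Cod T g \<in> S" "Dom T f \<in> S \<Longrightarrow> Cod T g \<in> S \<Longrightarrow> Dom T g \<in> S"
  using S t TriD[OF t] unfolding localizing_def by metis+

section \<open>Homotopy colimits\<close>

primrec transition where
  "transition X f i 0 = Idn T (X i)"
| "transition X f i (Suc k) = f (i + k) \<cdot> transition X f i k"

lemma transition_hom:
  assumes "\<And>n. n \<ge> 1 \<Longrightarrow> f n \<in> Hom T (X n) (X (n + 1))" "i \<ge> (1::nat)"
  shows "transition X f i k \<in> Hom T (X i) (X (i + k))"
proof (induction k)
  case 0
  then show ?case using Id_Hom[OF tri hom_obj(1)[OF assms(1)[OF assms(2)]]] by simp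
next
  case (Suc k)
  then show ?case using assms(1)[of "i + k"] assms(2) by (simp add: Hom_def)
qed

lemma transition_cocone:
  assumes f: "\<And>n. n \<ge> 1 \<Longrightarrow> f n \<in> Hom T (X n) (X (n + 1))" and i: "i \<ge> (1::nat)"
    and c: "\<And>n. n \<ge> 1 \<Longrightarrow> c n \<in> Hom T (X n) Y" "\<And>n. n \<ge> 1 \<Longrightarrow> c (n + 1) \<cdot> f n = c n"
  shows "c (i + k) \<cdot> transition X f i k = c i"
proof (induction k)
  case 0
  then show ?case using c(1)[OF i] by (simp add: Hom_def)
next
  case (Suc k)
  have ik: "i + k \<ge> 1" using i by simp
  have "c (i + k + 1) \<cdot> (f (i + k) \<cdot> transition X f i k) = c (i + k) \<cdot> transition X f i k"
    by (rule cmp_reduce[OF c(2)[OF ik] transition_hom[where f = f and X = X, OF f i] f[OF ik]])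
      (use c(1)[of "i + k + 1"] in simp_all)
  then show ?case using Suc by simp
qed

lemma transition_natural:
  assumes f: "\<And>n. n \<ge> 1 \<Longrightarrow> f n \<in> Hom T (X n) (X (n + 1))" and f': "\<And>n. n \<ge> 1 \<Longrightarrow> f' n \<in> Hom T (X' n) (X' (n + 1))"
    and a: "\<And>n. n \<ge> 1 \<Longrightarrow> a n \<in> Hom T (X n) (X' n)" "\<And>n. n \<ge> 1 \<Longrightarrow> a (n + 1) \<cdot> f n = f' n \<cdot> a n"
    and i: "i \<ge> 1"
  shows "a (i + k) \<cdot> transition X f i k = transition X' f' i k \<cdot> a i"
proof (induction k)
  case 0
  then show ?case using a(1)[OF i] by (simp add: Hom_def)
next
  case (Suc k)
  have ik: "i + k \<ge> 1" using i by simp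
  have to: "transition X f i k \<in> Hom T (X i) (X (i + k))" by (rule transition_hom) (use f i in blast)+
  have to': "transition X' f' i k \<in> Hom T (X' i) (X' (i + k))" by (rule transition_hom) (use f' i in blast)+
  have a1: "a (i + k + 1) \<in> Hom T (X (i + k + 1)) (X' (i + k + 1))" using a(1)[of "i + k + 1"] by simp
  have "a (i + k + 1) \<cdot> (f (i + k) \<cdot> transition X f i k) = (f' (i + k) \<cdot> a (i + k)) \<cdot> transition X f i k"
    by (rule cmp_reduce[OF a(2)[OF ik] to f[OF ik] a1])
  also have "\<dots> = f' (i + k) \<cdot> (a (i + k) \<cdot> transition X f i k)"
    using f'[OF ik] a(1)[OF ik] to by (simp add: Hom_def)
  also have "\<dots> = (f' (i + k) \<cdot> transition X' f' i k) \<cdot> a i"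
    unfolding Suc using f'[OF ik] a(1)[OF i] to' by (simp add: Hom_def)
  finally show ?case by simp
qed

lemma transition_add:
  assumes f: "\<And>n. n \<ge> 1 \<Longrightarrow> f n \<in> Hom T (X n) (X (n + 1))" and i: "i \<ge> 1"
  shows "transition X f (i + k) l \<cdot> transition X f i k = transition X f i (k + l)"
proof (induction l)
  case 0
  have "transition X f i k \<in> Hom T (X i) (X (i + k))" by (rule transition_hom) (use f i in blast)+
  then show ?case by (simp add: Hom_def)
next
  case (Suc l)
  have to: "transition X f i k \<in> Hom T (X i) (X (i + k))" by (rule transition_hom) (use f i in blast)+
  have "1 \<le> i + k" using i by simp
  then have to': "transition X f (i + k) l \<in> Hom T (X (i + k)) (X (i + k + l))"
    by (intro transition_hom) (use f in blast)+
  have "f (i + k + l) \<in> Hom T (X (i + k + l)) (X (i + k + l + 1))" using f[of "i + k + l"] i by simp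
  then have "(f (i + k + l) \<cdot> transition X f (i + k) l) \<cdot> transition X f i k = f (i + k + l) \<cdot> transition X f i (k + l)"
    using to to' Suc by (simp add: Hom_def)
  then show ?case by (simp add: add.assoc)
qed

text \<open>A morphism into a coproduct need not be determined by its projections; one with finite support is.\<close>

lemma finitely_supported_zero:
  assumes c: "coproduct T I X P inc" and p: "projections I X P inc \<pi>" and b: "b \<in> Hom T C P"
    and fs: "finitely_supported I inc P b" and z: "\<And>i. i \<in> I \<Longrightarrow> \<pi> i \<cdot> b = Zer T C (X i)"
  shows "b = Zer T C P"
proof -
  note o = coproduct_obj[OF c] and i = coproduct_inc[OF c]
  obtain F where F: "finite F" "F \<subseteq> I"
    "\<And>Y h. h \<in> Hom T P Y \<Longrightarrow> (\<forall>i\<in>F. h \<cdot> inc i = Zer T (Dom T (inc i)) Y) \<Longrightarrow> h \<cdot> b = Zer T (Dom T b) Y"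
    using fs unfolding finitely_supported_def by metis
  obtain r where r: "r \<in> Hom T P P" "\<And>j. j \<in> F \<Longrightarrow> r \<cdot> inc j = Zer T (Dom T (inc j)) P"
    "\<And>h Y. h \<in> Hom T P Y \<Longrightarrow> (\<And>i. i \<in> F \<Longrightarrow> h \<cdot> inc i = Zer T (X i) Y) \<Longrightarrow> h \<cdot> r = h"
    "\<And>g W. g \<in> Hom T W P \<Longrightarrow> r \<cdot> g = Zer T W P \<Longrightarrow> g = hsum W P (\<lambda>i. inc i \<cdot> (\<pi> i \<cdot> g)) F"
    by (rule coproduct_complement[OF c F(1,2) p]) blast
  have "r \<cdot> b = Zer T C P" using F(3)[OF r(1)] r(2) b by (auto simp: Hom_def)
  then have "b = hsum C P (\<lambda>i. inc i \<cdot> (\<pi> i \<cdot> b)) F" using r(4)[OF b] by blast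
  also have "\<dots> = Zer T C P"
    using F z i o hom_obj[OF b] by (intro hsum_zero) (auto simp: subset_iff)
  finally show ?thesis .
qed

lemma hocolim_obtain:
  assumes h: "hocolim T X f H \<iota>" and f: "\<And>n. n \<ge> 1 \<Longrightarrow> f n \<in> Hom T (X n) (X (n + 1))"
  obtains P inc \<theta> \<pi> \<delta> where "coproduct T {1..} X P inc" "\<theta> \<in> Hom T P P" "\<pi> \<in> Hom T P H" "\<delta> \<in> Hom T H (SigO T P)"
    "\<And>n. n \<ge> 1 \<Longrightarrow> \<theta> \<cdot> inc n = Add T (inc n) (neg T (inc (n + 1) \<cdot> f n))"
    "(\<theta>, \<pi>, \<delta>) \<in> Tri T" "\<And>l. l \<ge> 1 \<Longrightarrow> \<iota> l = \<pi> \<cdot> inc l"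
proof -
  obtain P inc \<theta> \<pi> \<delta> where *: "coproduct T {1..} X P inc" "\<theta> \<in> Hom T P P"
    "\<forall>n \<ge> 1. \<theta> \<cdot> inc n = Add T (inc n) (neg T (inc (n + 1) \<cdot> f n))"
    "(\<theta>, \<pi>, \<delta>) \<in> Tri T" "Cod T \<pi> = H" "\<forall>l \<ge> 1. \<iota> l = \<pi> \<cdot> inc l"
    using h unfolding hocolim_def by blast
  have "\<pi> \<in> Hom T P H" "\<delta> \<in> Hom T H (SigO T P)" using TriD[OF *(4)] *(2,5) by (auto simp: Hom_def)
  then show ?thesis using that * by blast
qed

lemma hocolim_inc:
  assumes h: "hocolim T X f H \<iota>" and f: "\<And>n. n \<ge> 1 \<Longrightarrow> f n \<in> Hom T (X n) (X (n + 1))" and l: "l \<ge> 1"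
  shows "\<iota> l \<in> Hom T (X l) H" "\<iota> (l + 1) \<cdot> f l = \<iota> l"
proof -
  obtain P inc \<theta> \<pi> \<delta> where *: "coproduct T {1..} X P inc" "\<theta> \<in> Hom T P P" "\<pi> \<in> Hom T P H" "\<delta> \<in> Hom T H (SigO T P)"
    "\<And>n. n \<ge> 1 \<Longrightarrow> \<theta> \<cdot> inc n = Add T (inc n) (neg T (inc (n + 1) \<cdot> f n))"
    "(\<theta>, \<pi>, \<delta>) \<in> Tri T" "\<And>l. l \<ge> 1 \<Longrightarrow> \<iota> l = \<pi> \<cdot> inc l"
    using hocolim_obtain[OF h f] by metis
  have i: "inc l \<in> Hom T (X l) P" "inc (l + 1) \<in> Hom T (X (l + 1)) P"
    using coproduct_inc[OF *(1), of l] coproduct_inc[OF *(1), of "l + 1"] l by (auto simp: Hom_def)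
  show "\<iota> l \<in> Hom T (X l) H" using *(3,7) l i by (simp add: Hom_def)
  have "\<pi> \<cdot> \<theta> = Zer T P H" using Tri_cmp[OF *(6)] *(2,3) by (simp add: Hom_def)
  then have "\<pi> \<cdot> (\<theta> \<cdot> inc l) = Zer T P H \<cdot> inc l" using cmp_reduce[OF _ i(1) *(2,3)] by simp
  then have "\<pi> \<cdot> Add T (inc l) (neg T (inc (l + 1) \<cdot> f l)) = Zer T (X l) H"
    using *(5)[OF l] hom_zer[OF i(1) hom_obj(2)[OF *(3)]] by simp
  then have "Add T (\<iota> l) (neg T (\<iota> (l + 1) \<cdot> f l)) = Zer T (X l) H"
    using *(3) *(7)[OF l] *(7)[of "l + 1"] i f[OF l] by (simp add: Hom_def cmp_add)
  then show "\<iota> (l + 1) \<cdot> f l = \<iota> l"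
    using add_neg_iff[of "\<iota> l" "\<iota> (l + 1) \<cdot> f l"] *(3) *(7)[OF l] *(7)[of "l + 1"] i f[OF l] by (simp add: Hom_def)
qed

lemma hocolim_out:
  assumes h: "hocolim T X f H \<iota>" and f: "\<And>n. n \<ge> 1 \<Longrightarrow> f n \<in> Hom T (X n) (X (n + 1))"
    and Y: "Y \<in> Obj T" and c: "\<And>n. n \<ge> 1 \<Longrightarrow> c n \<in> Hom T (X n) Y" "\<And>n. n \<ge> 1 \<Longrightarrow> c (n + 1) \<cdot> f n = c n"
  obtains a where "a \<in> Hom T H Y" "\<And>l. l \<ge> 1 \<Longrightarrow> a \<cdot> \<iota> l = c l"
proof -
  obtain P inc \<theta> \<pi> \<delta> where *: "coproduct T {1..} X P inc" "\<theta> \<in> Hom T P P" "\<pi> \<in> Hom T P H" "\<delta> \<in> Hom T H (SigO T P)"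
    "\<And>n. n \<ge> 1 \<Longrightarrow> \<theta> \<cdot> inc n = Add T (inc n) (neg T (inc (n + 1) \<cdot> f n))"
    "(\<theta>, \<pi>, \<delta>) \<in> Tri T" "\<And>l. l \<ge> 1 \<Longrightarrow> \<iota> l = \<pi> \<cdot> inc l"
    using hocolim_obtain[OF h f] by metis
  have i: "inc l \<in> Hom T (X l) P" if "l \<ge> 1" for l
    using coproduct_inc[OF *(1), of l] that by (auto simp: Hom_def)
  obtain b where b: "b \<in> Hom T P Y" "\<And>i. i \<in> {1..} \<Longrightarrow> b \<cdot> inc i = c i"
    using coproduct_out[OF *(1) Y, of c] c(1) by auto
  have "b \<cdot> \<theta> = Zer T P Y"
  proof (rule coproduct_eqI[OF *(1)])
    show "b \<cdot> \<theta> \<in> Hom T P Y" "Zer T P Y \<in> Hom T P Y" using b *(2) Y by (auto simp: Hom_def)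
    fix n assume n: "n \<in> {1::nat..}"
    then have n1: "n \<ge> 1" "n + 1 \<ge> 1" by auto
    have i1: "inc (n + 1) \<in> Hom T (X (n + 1)) P" using i by simp
    have e: "b \<cdot> (inc (n + 1) \<cdot> f n) = c n"
      using cmp_reduce[OF b(2)[of "n + 1"] f[OF n1(1)] i1 b(1)] c(2)[OF n1(1)] by simp
    have "(b \<cdot> \<theta>) \<cdot> inc n = b \<cdot> Add T (inc n) (neg T (inc (n + 1) \<cdot> f n))"
      using *(2,5) b(1) i n1 by (simp add: Hom_def)
    also have "\<dots> = Add T (c n) (neg T (c n))"
      using b(1) b(2)[OF n] e i[OF n1(1)] i1 f[OF n1(1)] by (simp add: Hom_def cmp_add)
    also have "\<dots> = Zer T P Y \<cdot> inc n"
      using c(1)[OF n1(1)] add_neg_iff[of "c n" "c n"] i[OF n1(1)] Y by (simp add: Hom_def)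
    finally show "(b \<cdot> \<theta>) \<cdot> inc n = Zer T P Y \<cdot> inc n" .
  qed
  then obtain a where a: "a \<in> Hom T H Y" "a \<cdot> \<pi> = b"
    using weak_cokernel[OF *(6), of b Y] b(1) *(2,3) by (auto simp: Hom_def)
  have "a \<cdot> \<iota> l = c l" if "l \<ge> 1" for l
    using cmp_reduce[OF a(2) i[OF that] *(3) a(1)] *(7)[OF that] b(2)[of l] that by simp
  then show ?thesis using that a(1) by blast
qed

lemma hocolim_localizing:
  assumes u: "uncountable (UNIV :: 'u set)"
    and h: "hocolim T X f H \<iota>" and f: "\<And>n. n \<ge> 1 \<Longrightarrow> f n \<in> Hom T (X n) (X (n + 1))"
    and S: "localizing TYPE('u) T S" "\<And>n. n \<ge> 1 \<Longrightarrow> X n \<in> S"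
  shows "H \<in> S"
proof -
  obtain P inc \<theta> \<pi> \<delta> where *: "coproduct T {1..} X P inc" "\<theta> \<in> Hom T P P" "\<pi> \<in> Hom T P H" "\<delta> \<in> Hom T H (SigO T P)"
    "\<And>n. n \<ge> 1 \<Longrightarrow> \<theta> \<cdot> inc n = Add T (inc n) (neg T (inc (n + 1) \<cdot> f n))"
    "(\<theta>, \<pi>, \<delta>) \<in> Tri T" "\<And>l. l \<ge> 1 \<Longrightarrow> \<iota> l = \<pi> \<cdot> inc l"
    using hocolim_obtain[OF h f] by metis
  obtain I :: "'u set" and g where I: "small TYPE('u) I" "g ` I = {1..}" "coproduct T I (X \<circ> g) P (inc \<circ> g)"
    using sequence_coproduct_small[OF u *(1)] by metis
  have "\<forall>i\<in>I. (X \<circ> g) i \<in> S" using S(2) I(2) by (metis atLeast_iff comp_apply image_eqI)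
  then have "P \<in> S" using S(1) I(1,3) unfolding localizing_def by blast
  then show ?thesis using localizing_cone(1)[OF S(1) *(6)] *(2,3) by (auto simp: Hom_def)
qed

text \<open>The projections of \<open>b\<close> satisfy $\pi_1 b = \pi_1\theta b = 0$ and
  $\pi_{n+1} b - f_n \pi_n b = \pi_{n+1}\theta b = 0$, so they all vanish.\<close>

lemma id_minus_shift_injective:
  fixes X :: "nat \<Rightarrow> 'o"
  assumes u: "uncountable (UNIV :: 'u set)" and c: "coproduct T {1..} X P inc"
    and f: "\<And>n. n \<ge> 1 \<Longrightarrow> f n \<in> Hom T (X n) (X (n + 1))" and \<theta>: "\<theta> \<in> Hom T P P"
    and shift: "\<And>n. n \<ge> 1 \<Longrightarrow> \<theta> \<cdot> inc n = Add T (inc n) (neg T (inc (n + 1) \<cdot> f n))"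
    and D: "compact TYPE('u) T D" and b: "b \<in> Hom T D P" and tb: "\<theta> \<cdot> b = Zer T D P"
  shows "b = Zer T D P"
proof -
  note * = c \<theta> shift
  note o = coproduct_obj[OF *(1)]
  have i: "inc l \<in> Hom T (X l) P" if "l \<ge> 1" for l
    using coproduct_inc[OF *(1), of l] that by (auto simp: Hom_def)
  have Xo: "X l \<in> Obj T" if "l \<ge> 1" for l using o(2) that by simp
  obtain I :: "'u set" and r where I: "small TYPE('u) I" "r ` I = {1..}" "coproduct T I (X \<circ> r) P (inc \<circ> r)"
    using sequence_coproduct_small[OF u *(1)] by metis
  obtain p where p: "projections {1..} X P inc p" using coproduct_projections[OF *(1)] by metis
  note pD = projectionsD[OF p]
  have thinc: "p m \<cdot> (\<theta> \<cdot> inc n) = Add T (p m \<cdot> inc n) (neg T ((p m \<cdot> inc (n + 1)) \<cdot> f n))"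
    if "m \<ge> 1" "n \<ge> 1" for m n
    using *(3)[OF that(2)] pD(1)[of m] i[OF that(2)] i[of "n + 1"] f[OF that(2)] that(1)
    by (simp add: Hom_def cmp_add)
  have pb: "p (Suc m) \<cdot> b = Zer T D (X (Suc m))" for m
  proof (induction m)
    case 0
    have "p 1 \<cdot> \<theta> = p 1"
    proof (rule coproduct_eqI[OF *(1)])
      show "p 1 \<cdot> \<theta> \<in> Hom T P (X 1)" "p 1 \<in> Hom T P (X 1)" using pD(1)[of 1] *(2) by (auto simp: Hom_def)
      fix n assume n: "n \<in> {1::nat..}"
      have "(p 1 \<cdot> \<theta>) \<cdot> inc n = p 1 \<cdot> (\<theta> \<cdot> inc n)"
        using pD(1)[of 1] *(2) i[of n] n by (simp add: Hom_def)
      also have "\<dots> = Add T (p 1 \<cdot> inc n) (neg T ((p 1 \<cdot> inc (n + 1)) \<cdot> f n))" using thinc n by simp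
      also have "p 1 \<cdot> inc (n + 1) = Zer T (X (n + 1)) (X 1)" using pD(3)[of 1 "n + 1"] n by simp
      also have "Zer T (X (n + 1)) (X 1) \<cdot> f n = Zer T (X n) (X 1)" using hom_zer[OF f, of n "X 1"] n Xo by simp
      also have "Add T (p 1 \<cdot> inc n) (neg T (Zer T (X n) (X 1))) = p 1 \<cdot> inc n"
        using n Xo pD(1)[of 1] i[of n] by (simp add: Hom_def)
      finally show "(p 1 \<cdot> \<theta>) \<cdot> inc n = p 1 \<cdot> inc n" .
    qed
    then have "p 1 \<cdot> (\<theta> \<cdot> b) = p 1 \<cdot> b" using cmp_reduce[OF _ b *(2) pD(1)[of 1]] by simp
    then show ?case using tb zer_hom[OF pD(1)[of 1]] hom_obj(1)[OF b] by simp
  next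
    case (Suc m)
    let ?n = "Suc m"
    have "p (Suc ?n) \<cdot> \<theta> = Add T (p (Suc ?n)) (neg T (f ?n \<cdot> p ?n))"
    proof (rule coproduct_eqI[OF *(1)])
      have ty: "p (Suc ?n) \<in> Hom T P (X (Suc ?n))" "p ?n \<in> Hom T P (X ?n)" "f ?n \<in> Hom T (X ?n) (X (Suc ?n))"
        using pD(1) f[of ?n] by auto
      then have par: "parallel (p (Suc ?n)) (f ?n \<cdot> p ?n)" by (simp add: Hom_def)
      show "p (Suc ?n) \<cdot> \<theta> \<in> Hom T P (X (Suc ?n))" using ty *(2) by (simp add: Hom_def)
      show "Add T (p (Suc ?n)) (neg T (f ?n \<cdot> p ?n)) \<in> Hom T P (X (Suc ?n))" using ty par by (simp add: Hom_def)
      fix n assume n: "n \<in> {1::nat..}"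
      have L: "(p (Suc ?n) \<cdot> \<theta>) \<cdot> inc n = Add T (p (Suc ?n) \<cdot> inc n) (neg T ((p (Suc ?n) \<cdot> inc (n + 1)) \<cdot> f n))"
        using thinc[of "Suc ?n" n] ty *(2) i[of n] n by (simp add: Hom_def)
      have R: "Add T (p (Suc ?n)) (neg T (f ?n \<cdot> p ?n)) \<cdot> inc n = Add T (p (Suc ?n) \<cdot> inc n) (neg T (f ?n \<cdot> (p ?n \<cdot> inc n)))"
        using ty i[of n] n by (simp add: Hom_def add_cmp)
      have "(p (Suc ?n) \<cdot> inc (n + 1)) \<cdot> f n = f ?n \<cdot> (p ?n \<cdot> inc n)"
      proof (cases "n = ?n")
        case True
        then show ?thesis using pD(2)[of "Suc ?n"] pD(2)[of ?n] f[of ?n] Xo by (simp add: Hom_def)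
      next
        case False
        then have "p (Suc ?n) \<cdot> inc (n + 1) = Zer T (X (n + 1)) (X (Suc ?n))" "p ?n \<cdot> inc n = Zer T (X n) (X ?n)"
          using pD(3)[of "Suc ?n" "n + 1"] pD(3)[of ?n n] n by auto
        then show ?thesis using hom_zer[OF f, of n "X (Suc ?n)"] zer_hom[OF ty(3), of "X n"] n Xo by simp
      qed
      then show "(p (Suc ?n) \<cdot> \<theta>) \<cdot> inc n = Add T (p (Suc ?n)) (neg T (f ?n \<cdot> p ?n)) \<cdot> inc n"
        using L R by simp
    qed
    then have "p (Suc ?n) \<cdot> (\<theta> \<cdot> b) = Add T (p (Suc ?n)) (neg T (f ?n \<cdot> p ?n)) \<cdot> b"
      using cmp_reduce[OF _ b *(2) pD(1)[of "Suc ?n"]] by simp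
    also have "\<dots> = Add T (p (Suc ?n) \<cdot> b) (neg T (f ?n \<cdot> (p ?n \<cdot> b)))"
      using b pD(1)[of "Suc ?n"] pD(1)[of ?n] f[of ?n] by (simp add: Hom_def add_cmp)
    also have "\<dots> = p (Suc ?n) \<cdot> b"
      using Suc b pD(1)[of "Suc ?n"] zer_hom[OF f[of ?n], of D] Xo hom_obj[OF b] by (simp add: Hom_def)
    finally show ?case using tb zer_hom[OF pD(1)[of "Suc ?n"]] hom_obj(1)[OF b] by simp
  qed
  have "finitely_supported {1..} inc P b"
  proof -
    obtain F where F: "finite F" "F \<subseteq> I"
      "\<And>Y h. h \<in> Hom T P Y \<Longrightarrow> (\<forall>i\<in>F. h \<cdot> (inc \<circ> r) i = Zer T (Dom T ((inc \<circ> r) i)) Y) \<Longrightarrow> h \<cdot> b = Zer T (Dom T b) Y"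
      using compact_finitely_supported[OF D I(1,3) b] unfolding finitely_supported_def by metis
    show ?thesis unfolding finitely_supported_def
      using F I(2)[symmetric] by (intro exI[of _ "r ` F"] conjI) (simp_all add: image_mono)
  qed
  then show ?thesis
    by (rule finitely_supported_zero[OF *(1) p b]) (metis pb atLeast_iff Suc_le_D One_nat_def)
qed

text \<open>By injectivity of $\mathrm{id} - \mathrm{shift}$ on morphisms from compact objects, \<open>g\<close> lifts to the
  coproduct.  The lift is a finite sum of morphisms from single stages, and these can be moved to a common
  stage.\<close>

lemma hocolim_compact_factor:
  assumes u: "uncountable (UNIV :: 'u set)"
    and h: "hocolim T X f H \<iota>" and f: "\<And>n. n \<ge> 1 \<Longrightarrow> f n \<in> Hom T (X n) (X (n + 1))"
    and C: "compact TYPE('u) T C" and g: "g \<in> Hom T C H"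
  obtains N \<phi> where "N \<ge> 1" "\<phi> \<in> Hom T C (X N)" "g = \<iota> N \<cdot> \<phi>"
proof -
  obtain P inc \<theta> \<pi> \<delta> where *: "coproduct T {1..} X P inc" "\<theta> \<in> Hom T P P" "\<pi> \<in> Hom T P H" "\<delta> \<in> Hom T H (SigO T P)"
    "\<And>n. n \<ge> 1 \<Longrightarrow> \<theta> \<cdot> inc n = Add T (inc n) (neg T (inc (n + 1) \<cdot> f n))"
    "(\<theta>, \<pi>, \<delta>) \<in> Tri T" "\<And>l. l \<ge> 1 \<Longrightarrow> \<iota> l = \<pi> \<cdot> inc l"
    using hocolim_obtain[OF h f] by metis
  note o = coproduct_obj[OF *(1)]
  have i: "inc l \<in> Hom T (X l) P" if "l \<ge> 1" for l
    using coproduct_inc[OF *(1), of l] that by (auto simp: Hom_def)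
  have Xo: "X l \<in> Obj T" if "l \<ge> 1" for l using o(2) that by simp
  obtain I :: "'u set" and r where I: "small TYPE('u) I" "r ` I = {1..}" "coproduct T I (X \<circ> r) P (inc \<circ> r)"
    using sequence_coproduct_small[OF u *(1)] by metis
  have Co: "C \<in> Obj T" using compact_obj[OF C] .
  have mono: "b = Zer T (suspO T (- 1) C) P"
    if "b \<in> Hom T (suspO T (- 1) C) P" "\<theta> \<cdot> b = Zer T (suspO T (- 1) C) P" for b
    by (rule id_minus_shift_injective[OF u *(1) f *(2,5) compact_susp[OF C] that])
  obtain k where k: "k \<in> Hom T C P" "\<pi> \<cdot> k = g"
    by (rule lift_to_middle[OF *(6,2,3) g]) (use mono in blast)+
  have "\<exists>N \<phi>. N \<ge> 1 \<and> \<phi> \<in> Hom T C (X N) \<and> \<pi> \<cdot> k = \<iota> N \<cdot> \<phi>"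
  proof (rule compact_induct[OF C I(1,3) k(1)])
    have "Zer T C (X 1) \<in> Hom T C (X 1)" using Co Xo by (simp add: Hom_def)
    moreover have "\<pi> \<cdot> Zer T C P = \<iota> 1 \<cdot> Zer T C (X 1)"
      using zer_hom[OF *(3) Co] zer_hom[OF hocolim_inc(1)[OF h f order_refl] Co] by simp
    ultimately show "\<exists>N \<phi>. N \<ge> 1 \<and> \<phi> \<in> Hom T C (X N) \<and> \<pi> \<cdot> Zer T C P = \<iota> N \<cdot> \<phi>" by blast
  next
    fix a c assume a: "a \<in> Hom T C P" and c: "c \<in> Hom T C P"
      and ea: "\<exists>N \<phi>. N \<ge> 1 \<and> \<phi> \<in> Hom T C (X N) \<and> \<pi> \<cdot> a = \<iota> N \<cdot> \<phi>"
      and ec: "\<exists>N \<phi>. N \<ge> 1 \<and> \<phi> \<in> Hom T C (X N) \<and> \<pi> \<cdot> c = \<iota> N \<cdot> \<phi>"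
    obtain N \<phi> where N: "N \<ge> 1" "\<phi> \<in> Hom T C (X N)" "\<pi> \<cdot> a = \<iota> N \<cdot> \<phi>" using ea by auto
    obtain K \<psi> where K: "K \<ge> 1" "\<psi> \<in> Hom T C (X K)" "\<pi> \<cdot> c = \<iota> K \<cdot> \<psi>" using ec by auto
    have to: "transition X f i k \<in> Hom T (X i) (X (i + k))" if "i \<ge> 1" for i k
      by (rule transition_hom) (use f that in blast)+
    have co: "\<iota> (i + k) \<cdot> transition X f i k = \<iota> i" if "i \<ge> 1" for i k
      by (rule transition_cocone) (use f that hocolim_inc[OF h f] in blast)+
    have tN: "transition X f N K \<in> Hom T (X N) (X (N + K))" "\<iota> (N + K) \<cdot> transition X f N K = \<iota> N"
      and tK: "transition X f K N \<in> Hom T (X K) (X (N + K))" "\<iota> (N + K) \<cdot> transition X f K N = \<iota> K"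
      using to[OF N(1), of K] to[OF K(1), of N] co[OF N(1), of K] co[OF K(1), of N] by (auto simp: add.commute)
    have iNK: "\<iota> (N + K) \<in> Hom T (X (N + K)) H" using hocolim_inc(1)[OF h f, of "N + K"] N(1) by simp
    let ?\<chi> = "Add T (transition X f N K \<cdot> \<phi>) (transition X f K N \<cdot> \<psi>)"
    have par: "parallel (transition X f N K \<cdot> \<phi>) (transition X f K N \<cdot> \<psi>)" using tN tK N K by (simp add: Hom_def)
    have "?\<chi> \<in> Hom T C (X (N + K))" using par tK K by (simp add: Hom_def)
    moreover have "\<pi> \<cdot> Add T a c = \<iota> (N + K) \<cdot> ?\<chi>"
      using cmp_reduce[OF tN(2) N(2) tN(1) iNK] cmp_reduce[OF tK(2) K(2) tK(1) iNK] N(3) K(3) par iNK a c *(3) tK(1) K(2)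
      by (simp add: Hom_def cmp_add)
    ultimately show "\<exists>N \<phi>. N \<ge> 1 \<and> \<phi> \<in> Hom T C (X N) \<and> \<pi> \<cdot> Add T a c = \<iota> N \<cdot> \<phi>"
      using N(1) by (intro exI[of _ "N + K"] exI[of _ ?\<chi>]) auto
  next
    fix j \<phi> assume j: "j \<in> I" "\<phi> \<in> Hom T C ((X \<circ> r) j)"
    then have rj: "r j \<ge> 1" using I(2) by auto
    have "\<pi> \<cdot> (inc (r j) \<cdot> \<phi>) = \<iota> (r j) \<cdot> \<phi>"
      by (rule cmp_reduce[OF _ _ i[OF rj] *(3)]) (use *(7)[OF rj] j in simp_all)
    then show "\<exists>N \<phi>'. N \<ge> 1 \<and> \<phi>' \<in> Hom T C (X N) \<and> \<pi> \<cdot> ((inc \<circ> r) j \<cdot> \<phi>) = \<iota> N \<cdot> \<phi>'"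
      using rj j by auto
  qed
  then show ?thesis using that k(2) by metis
qed

section \<open>Coreflections\<close>

text \<open>The difference of \<open>a\<close> and \<open>b\<close> factors through the suspension of the first object.\<close>

lemma unique_extension:
  assumes t: "(f, g, h) \<in> Tri T" and a: "a \<in> Hom T (Cod T g) W" "b \<in> Hom T (Cod T g) W" "a \<cdot> g = b \<cdot> g"
    and o: "orthogonal (SigO T (Dom T f)) W"
  shows "a = b"
proof -
  note d = TriD[OF t]
  have par: "parallel a b" using a by (simp add: Hom_def)
  let ?c = "Add T a (neg T b)"
  have c: "?c \<in> Hom T (Dom T h) W" using par a d by (simp add: Hom_def)
  have W: "W \<in> Obj T" using hom_obj(2)[OF a(1)] .
  have "?c \<cdot> g = Add T (a \<cdot> g) (neg T (b \<cdot> g))" using par a d by (simp add: Hom_def add_cmp)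
  also have "\<dots> = Zer T (Dom T g) W" using a d add_neg_iff[of "a \<cdot> g" "b \<cdot> g"] by (simp add: Hom_def)
  finally obtain k where k: "k \<in> Hom T (Cod T h) W" "k \<cdot> h = ?c" using weak_cokernel2[OF t c] by metis
  then have "k = Zer T (Cod T h) W" using o d by (simp add: orthogonal_def)
  then have "?c = Zer T (Dom T a) (Cod T a)" using k d W a by (simp add: Hom_def)
  then show ?thesis using add_neg_iff[OF par] by simp
qed

lemma coreflectionD:
  assumes c: "coreflection T S \<Gamma> \<epsilon>" and M: "M \<in> Obj T"
  shows "onO \<Gamma> M \<in> S" "\<epsilon> M \<in> Hom T (onO \<Gamma> M) M"
  using c M by (simp_all add: coreflection_def nat_trans_def id_functor_def)

lemma coreflection_lift:
  assumes c: "coreflection T S \<Gamma> \<epsilon>" and M: "M \<in> Obj T" and Y: "Y \<in> S" and g: "g \<in> Hom T Y M"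
  obtains k where "k \<in> Hom T Y (onO \<Gamma> M)" "\<epsilon> M \<cdot> k = g"
proof -
  have "bij_betw (\<lambda>f. \<epsilon> M \<cdot> f) (Hom T Y (onO \<Gamma> M)) (Hom T Y M)"
    using c M Y by (simp add: coreflection_def)
  then have "g \<in> (\<lambda>f. \<epsilon> M \<cdot> f) ` Hom T Y (onO \<Gamma> M)" using g by (simp add: bij_betw_imp_surj_on)
  then show ?thesis using that by (elim imageE) simp
qed

lemma coreflection_unique:
  assumes c: "coreflection T S \<Gamma> \<epsilon>" and M: "M \<in> Obj T" and Y: "Y \<in> S"
    and k: "k \<in> Hom T Y (onO \<Gamma> M)" "k' \<in> Hom T Y (onO \<Gamma> M)" "\<epsilon> M \<cdot> k = \<epsilon> M \<cdot> k'"
  shows "k = k'"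
proof -
  have "bij_betw (\<lambda>f. \<epsilon> M \<cdot> f) (Hom T Y (onO \<Gamma> M)) (Hom T Y M)"
    using c M Y by (simp add: coreflection_def)
  from inj_onD[OF bij_betw_imp_inj_on[OF this] k(3)] k(1,2) show ?thesis by blast
qed

text \<open>Morphisms from \<open>S\<close> into the third object measure the failure of \<open>\<epsilon> M\<close> to be bijective on
  morphisms from \<open>S\<close>, and \<open>\<epsilon> M\<close> is bijective on them.\<close>

lemma coreflection_orthogonal:
  fixes U :: "'u itself"
  assumes S: "localizing U T S" and c: "coreflection T S \<Gamma> \<epsilon>" and X: "X \<in> S" and M: "M \<in> Obj T"
    and t: "(\<epsilon> M, \<eta>, \<delta>) \<in> Tri T"
  shows "orthogonal X (Cod T \<eta>)"
  unfolding orthogonal_def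
proof
  note d = TriD[OF t]
  note e = coreflectionD(2)[OF c M]
  have Xo: "X \<in> Obj T" using S X by (auto simp: localizing_def)
  fix f assume f: "f \<in> Hom T X (Cod T \<eta>)"
  let ?G = "onO \<Gamma> M"
  have mono: "b = Zer T (suspO T (- 1) X) ?G"
    if b: "b \<in> Hom T (suspO T (- 1) X) ?G" "\<epsilon> M \<cdot> b = Zer T (suspO T (- 1) X) M" for b
    by (rule coreflection_unique[OF c M localizing_susp[OF S X] b(1)])
      (use b(2) zer_hom[OF e] Zer_Hom[OF tri] Xo hom_obj(1)[OF e] in auto)
  have eta: "\<eta> \<in> Hom T M (Cod T \<eta>)" using d e by (simp add: Hom_def)
  obtain g where g: "g \<in> Hom T X M" "\<eta> \<cdot> g = f"
    by (rule lift_to_middle[OF t e eta f]) (use mono in blast)+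
  obtain k where k: "k \<in> Hom T X ?G" "\<epsilon> M \<cdot> k = g" using coreflection_lift[OF c M X g(1)] by blast
  have "\<eta> \<cdot> (\<epsilon> M \<cdot> k) = Zer T ?G (Cod T \<eta>) \<cdot> k"
    by (rule cmp_reduce[OF _ k(1) e]) (use Tri_cmp[OF t] d e in \<open>simp_all add: Hom_def\<close>)
  then show "f = Zer T X (Cod T \<eta>)" using g k hom_zer[OF k(1)] d by simp
qed

text \<open>If the cone of \<open>\<alpha>\<close> is orthogonal to \<open>S\<close>, then morphisms from \<open>S\<close> to \<open>M\<close> factor uniquely through \<open>\<alpha>\<close>.
  As the source of \<open>\<alpha>\<close> is in \<open>S\<close>, it has the universal property of the coreflection.\<close>

lemma coreflection_iso:
  fixes U :: "'u itself"
  assumes S: "localizing U T S" and c: "coreflection T S \<Gamma> \<epsilon>" and M: "M \<in> Obj T"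
    and H: "H \<in> S" and \<alpha>: "\<alpha> \<in> Hom T H M" and t: "(\<alpha>, g, h) \<in> Tri T"
    and orth: "\<And>X. X \<in> S \<Longrightarrow> orthogonal X (Cod T g)"
  obtains \<psi> where "isomorphism T H (onO \<Gamma> M) \<psi>" "\<epsilon> M \<cdot> \<psi> = \<alpha>"
proof -
  note d = TriD[OF t]
  let ?G = "onO \<Gamma> M"
  note G = coreflectionD(1)[OF c M] and e = coreflectionD(2)[OF c M]
  have Ho: "H \<in> Obj T" and Go: "?G \<in> Obj T" using hom_obj \<alpha> e by auto
  obtain \<psi> where \<psi>: "\<psi> \<in> Hom T H ?G" "\<epsilon> M \<cdot> \<psi> = \<alpha>" using coreflection_lift[OF c M H \<alpha>] by blast
  have "g \<cdot> \<epsilon> M = Zer T ?G (Cod T g)" using orth[OF G] e \<alpha> d unfolding orthogonal_def by (simp add: Hom_def)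
  then obtain \<chi> where \<chi>: "\<chi> \<in> Hom T ?G H" "\<alpha> \<cdot> \<chi> = \<epsilon> M"
    using e \<alpha> d by (auto intro: weak_kernel[OF t, of "\<epsilon> M" ?G] simp: Hom_def)
  have "\<epsilon> M \<cdot> (\<psi> \<cdot> \<chi>) = \<epsilon> M \<cdot> Idn T ?G"
    using cmp_reduce[OF \<psi>(2) \<chi>(1) \<psi>(1) e] \<chi>(2) e by (simp add: Hom_def)
  then have pc: "\<psi> \<cdot> \<chi> = Idn T ?G"
    using coreflection_unique[OF c M G, of "\<psi> \<cdot> \<chi>" "Idn T ?G"] \<psi>(1) \<chi>(1) Go by (simp add: Hom_def)
  let ?c = "Add T (\<chi> \<cdot> \<psi>) (neg T (Idn T H))"
  have par: "parallel (\<chi> \<cdot> \<psi>) (Idn T H)" using \<psi> \<chi> Ho by (simp add: Hom_def)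
  have cc: "?c \<in> Hom T H H" using par Ho by (simp add: Hom_def)
  have "\<alpha> \<cdot> ?c = Add T (\<alpha> \<cdot> (\<chi> \<cdot> \<psi>)) (neg T \<alpha>)" using \<alpha> par Ho by (simp add: Hom_def cmp_add)
  also have "\<alpha> \<cdot> (\<chi> \<cdot> \<psi>) = \<alpha>" using cmp_reduce[OF \<chi>(2) \<psi>(1) \<chi>(1) \<alpha>] \<psi>(2) by simp
  also have "Add T \<alpha> (neg T \<alpha>) = Zer T H M" using add_neg_iff[of \<alpha> \<alpha>] \<alpha> by (simp add: Hom_def)
  finally have ac: "\<alpha> \<cdot> ?c = Zer T H M" .
  have "SigA T \<alpha> \<cdot> SigA T ?c = Zer T (SigO T H) (SigO T M)"
    using ac cc \<alpha> Ho M by (simp add: sig_zer Hom_def flip: sig_cmp)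
  then obtain b where b: "b \<in> Hom T (SigO T H) (Dom T h)" "h \<cdot> b = SigA T ?c"
    using cc \<alpha> d by (auto intro: weak_kernel3[OF t, of "SigA T ?c" "SigO T H"] simp: Hom_def)
  have "SigO T H \<in> S" using localizing_susp[OF S H, of 1] by (simp add: susp_1)
  then have "b = Zer T (SigO T H) (Dom T h)" using orth b(1) d unfolding orthogonal_def by simp
  then have "SigA T ?c = SigA T (Zer T H H)" using b d \<alpha> Ho by (simp add: sig_zer Hom_def)
  then have "?c = Zer T H H" using sig_inj(2)[of ?c "Zer T H H"] cc Ho by (simp add: Hom_def)
  then have "\<chi> \<cdot> \<psi> = Idn T H" using add_neg_iff[OF par] \<psi> \<chi> by (simp add: Hom_def)
  then have "isomorphism T H ?G \<psi>" using pc \<psi> \<chi> unfolding isomorphism_def by blast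
  then show ?thesis using that \<psi>(2) by blast
qed

lemma zero_object_if_compact_orthogonal:
  fixes U :: "'u itself"
  assumes cg: "compactly_generated U T" and X: "X \<in> Obj T" and o: "\<And>C. compact U T C \<Longrightarrow> orthogonal C X"
  shows "zero_object T X"
proof -
  obtain S where S: "\<forall>C \<in> S. compact U T C"
    "\<forall>X \<in> Obj T. (\<forall>C \<in> S. \<forall>n. Hom T C (suspO T n X) = {Zer T C (suspO T n X)}) \<longrightarrow> zero_object T X"
    using cg unfolding compactly_generated_def by blast
  have "Hom T C (suspO T n X) = {Zer T C (suspO T n X)}" if "C \<in> S" for C n
  proof -
    have C: "compact U T C" using S(1) that by blast
    have "orthogonal C (suspO T n X)"
      using orthogonal_shift[OF compact_obj[OF C] X, of "- n" 0] o[OF compact_susp[OF C, of "- n"]] by simp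
    moreover have "Zer T C (suspO T n X) \<in> Hom T C (suspO T n X)"
      using Zer_Hom[OF tri compact_obj[OF C]] X by simp
    ultimately show ?thesis unfolding orthogonal_def by blast
  qed
  then show ?thesis using S(2) X by blast
qed

end

section \<open>Homogeneous primes\<close>

locale graded_commutative_ring =
  fixes R :: "('r, 'y) graded_ring_scheme" (structure)
  assumes gc: "graded_commutative R"
begin

lemma gr_ring: "graded_ring R" using gc by (simp add: graded_commutative_def)

sublocale ring R using gr_ring by (simp add: graded_ring_def)

lemma gr_closed [simp]: "a \<in> gr R n \<Longrightarrow> a \<in> carrier R"
  and gr_zero [simp]: "\<zero> \<in> gr R n"
  and gr_add: "a \<in> gr R n \<Longrightarrow> b \<in> gr R n \<Longrightarrow> a \<oplus> b \<in> gr R n"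
  and gr_neg: "a \<in> gr R n \<Longrightarrow> \<ominus> a \<in> gr R n"
  and gr_one [simp]: "\<one> \<in> gr R 0"
  and gr_mult: "a \<in> gr R m \<Longrightarrow> b \<in> gr R n \<Longrightarrow> a \<otimes> b \<in> gr R (m + n)"
proof -
  have s: "subgroup (gr R n) (add_monoid R)" using gr_ring by (simp add: graded_ring_def)
  show "a \<in> gr R n \<Longrightarrow> a \<in> carrier R" using subgroup.mem_carrier[OF s] by simp
  show "\<zero> \<in> gr R n" using subgroup.one_closed[OF s] by simp
  show "a \<in> gr R n \<Longrightarrow> b \<in> gr R n \<Longrightarrow> a \<oplus> b \<in> gr R n" using subgroup.m_closed[OF s] by simp
  show "a \<in> gr R n \<Longrightarrow> \<ominus> a \<in> gr R n" using subgroup.m_inv_closed[OF s] by (simp add: a_inv_def)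
  show "\<one> \<in> gr R 0" "a \<in> gr R m \<Longrightarrow> b \<in> gr R n \<Longrightarrow> a \<otimes> b \<in> gr R (m + n)"
    using gr_ring by (simp_all add: graded_ring_def)
qed

lemma gr_commute:
  assumes "a \<in> gr R m" "b \<in> gr R n"
  shows "a \<otimes> b = (if even (m * n) then b \<otimes> a else \<ominus> (b \<otimes> a))"
  using gc assms unfolding graded_commutative_def by blast

text \<open>The sign becomes a factor $\pm 1$ of degree 0, so that closure of ideals under multiplication absorbs it.\<close>

lemma gr_commute_unit:
  assumes "a \<in> gr R m" "b \<in> gr R n"
  obtains s where "s \<in> gr R 0" "a \<otimes> b = s \<otimes> (b \<otimes> a)"
proof (cases "even (m * n)")
  case True
  then show ?thesis using that[of \<one>] gr_commute[OF assms] assms by simp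
next
  case False
  then show ?thesis using that[of "\<ominus> \<one>"] gr_commute[OF assms] assms gr_neg[OF gr_one] by (simp add: l_minus)
qed

lemma gr_pow: "z \<in> gr R e \<Longrightarrow> z [^] (N::nat) \<in> gr R (int N * e)"
proof (induction N)
  case (Suc N)
  then show ?case using gr_mult[of "z [^] N" "int N * e" z e] by (simp add: algebra_simps)
qed simp

definition decomposition :: "'r \<Rightarrow> (int \<Rightarrow> 'r) \<Rightarrow> bool" where
  "decomposition r c \<longleftrightarrow> (\<forall>n. c n \<in> gr R n) \<and> finite {n. c n \<noteq> \<zero>} \<and> r = finsum R c {n. c n \<noteq> \<zero>}"

lemma decomposition_ex: "r \<in> carrier R \<Longrightarrow> \<exists>c. decomposition r c"
  and decomposition_unique: "r \<in> carrier R \<Longrightarrow> decomposition r c \<Longrightarrow> decomposition r c' \<Longrightarrow> c = c'"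
  using gr_ring unfolding graded_ring_def decomposition_def by blast+

lemma decomposition_mem: "decomposition r c \<Longrightarrow> c n \<in> gr R n"
  by (simp add: decomposition_def)

lemma decompositionI:
  assumes F: "finite F" "\<And>n. c n \<in> gr R n" "\<And>n. n \<notin> F \<Longrightarrow> c n = \<zero>" and r: "r = finsum R c F"
  shows "decomposition r c"
proof -
  have s: "{n. c n \<noteq> \<zero>} \<subseteq> F" using F(3) by auto
  have "finsum R c {n. c n \<noteq> \<zero>} = finsum R c F"
    by (rule add.finprod_mono_neutral_cong_left) (use F s gr_closed[OF F(2)] in auto)
  then show ?thesis using F r finite_subset[OF s] by (simp add: decomposition_def)
qed

lemma decompositionD:
  assumes "decomposition r c"
  obtains F where "finite F" "\<And>n. c n \<in> gr R n" "\<And>n. n \<notin> F \<Longrightarrow> c n = \<zero>" "r = finsum R c F" "r \<in> carrier R"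
proof (rule that[of "{n. c n \<noteq> \<zero>}"])
  have c: "c \<in> {n. c n \<noteq> \<zero>} \<rightarrow> carrier R" using gr_closed[OF decomposition_mem[OF assms]] by auto
  show "r \<in> carrier R" using assms finsum_closed[OF c] by (simp add: decomposition_def)
qed (use assms in \<open>auto simp: decomposition_def\<close>)

lemma decomposition_extend:
  assumes "finite F" "\<And>n. c n \<in> gr R n" "\<And>n. n \<notin> F \<Longrightarrow> c n = \<zero>" "finite G" "F \<subseteq> G"
  shows "finsum R c F = finsum R c G"
  by (rule add.finprod_mono_neutral_cong_left) (use assms gr_closed[OF assms(2)] in auto)

lemma decomposition_add:
  assumes "decomposition r c" "decomposition s e" shows "decomposition (r \<oplus> s) (\<lambda>n. c n \<oplus> e n)"
proof -
  obtain F where F: "finite F" "\<And>n. c n \<in> gr R n" "\<And>n. n \<notin> F \<Longrightarrow> c n = \<zero>" "r = finsum R c F"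
    using decompositionD[OF assms(1)] by metis
  obtain G where G: "finite G" "\<And>n. e n \<in> gr R n" "\<And>n. n \<notin> G \<Longrightarrow> e n = \<zero>" "s = finsum R e G"
    using decompositionD[OF assms(2)] by metis
  have "r = finsum R c (F \<union> G)" "s = finsum R e (F \<union> G)"
    using decomposition_extend[of F c "F \<union> G"] decomposition_extend[of G e "F \<union> G"] F G by auto
  then have "r \<oplus> s = finsum R (\<lambda>n. c n \<oplus> e n) (F \<union> G)"
    using finsum_addf[of c "F \<union> G" e] gr_closed[OF F(2)] gr_closed[OF G(2)] by auto
  then show ?thesis using F G gr_add by (intro decompositionI[of "F \<union> G"]) auto
qed

lemma decomposition_zero: "decomposition \<zero> (\<lambda>n. \<zero>)"
  by (rule decompositionI[of "{}"]) auto

lemma decomposition_homogeneous: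
  assumes "r \<in> gr R n" shows "decomposition r (\<lambda>k. if k = n then r else \<zero>)"
  by (rule decompositionI[of "{n}"]) (use assms gr_closed[OF assms] in auto)

lemma decomposition_lmult:
  assumes d: "decomposition r c" and s: "s \<in> gr R m"
  shows "decomposition (s \<otimes> r) (\<lambda>n. s \<otimes> c (n - m))"
proof -
  obtain F where F: "finite F" "\<And>n. c n \<in> gr R n" "\<And>n. n \<notin> F \<Longrightarrow> c n = \<zero>" "r = finsum R c F"
    using decompositionD[OF d] by metis
  note cc = gr_closed[OF F(2)] gr_closed[OF s]
  let ?G = "(\<lambda>n. n + m) ` F"
  show ?thesis
  proof (rule decompositionI[of ?G])
    show "s \<otimes> c (n - m) \<in> gr R n" for n using gr_mult[OF s F(2), of "n - m"] by simp
    show "s \<otimes> c (n - m) = \<zero>" if "n \<notin> ?G" for n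
    proof -
      have "n - m \<notin> F" using that image_eqI[of n "\<lambda>n. n + m" "n - m" F] by auto
      then show ?thesis using F(3) cc by simp
    qed
    have "s \<otimes> r = finsum R (\<lambda>n. s \<otimes> c n) F" using F(1,4) cc finsum_rdistr[of F s c] by auto
    also have "\<dots> = finsum R (\<lambda>n. s \<otimes> c (n - m)) ?G"
      using finsum_reindex[of "\<lambda>n. s \<otimes> c (n - m)" "\<lambda>n. n + m" F] cc by (auto simp: inj_on_def)
    finally show "s \<otimes> r = finsum R (\<lambda>n. s \<otimes> c (n - m)) ?G" .
  qed (use F in auto)
qed

lemma decomposition_rmult:
  assumes d: "decomposition r c" and s: "s \<in> gr R m"
  shows "decomposition (r \<otimes> s) (\<lambda>n. c (n - m) \<otimes> s)"
proof -
  obtain F where F: "finite F" "\<And>n. c n \<in> gr R n" "\<And>n. n \<notin> F \<Longrightarrow> c n = \<zero>" "r = finsum R c F"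
    using decompositionD[OF d] by metis
  note cc = gr_closed[OF F(2)] gr_closed[OF s]
  let ?G = "(\<lambda>n. n + m) ` F"
  show ?thesis
  proof (rule decompositionI[of ?G])
    show "c (n - m) \<otimes> s \<in> gr R n" for n using gr_mult[OF F(2)[of "n - m"] s] by simp
    show "c (n - m) \<otimes> s = \<zero>" if "n \<notin> ?G" for n
    proof -
      have "n - m \<notin> F" using that image_eqI[of n "\<lambda>n. n + m" "n - m" F] by auto
      then show ?thesis using F(3) cc by simp
    qed
    have "r \<otimes> s = finsum R (\<lambda>n. c n \<otimes> s) F" using F(1,4) cc finsum_ldistr[of F s c] by auto
    also have "\<dots> = finsum R (\<lambda>n. c (n - m) \<otimes> s) ?G"
      using finsum_reindex[of "\<lambda>n. c (n - m) \<otimes> s" "\<lambda>n. n + m" F] cc by (auto simp: inj_on_def)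
    finally show "r \<otimes> s = finsum R (\<lambda>n. c (n - m) \<otimes> s) ?G" .
  qed (use F in auto)
qed

text \<open>A family of homogeneous parts is easier to define than an ideal, and it determines the homogeneous ideal
  of all elements with components in the family.\<close>

definition span :: "(int \<Rightarrow> 'r set) \<Rightarrow> 'r set" where
  "span A = {r. \<exists>c. decomposition r c \<and> (\<forall>n. c n \<in> A n)}"

lemma homogeneous_ideal_span:
  assumes A: "\<And>n. A n \<subseteq> gr R n" "\<And>n. \<zero> \<in> A n" "\<And>n a b. a \<in> A n \<Longrightarrow> b \<in> A n \<Longrightarrow> a \<oplus> b \<in> A n"
    "\<And>m n s a. s \<in> gr R m \<Longrightarrow> a \<in> A n \<Longrightarrow> s \<otimes> a \<in> A (m + n)"
  shows "homogeneous_ideal R (span A)" "r \<in> gr R n \<Longrightarrow> r \<in> span A \<longleftrightarrow> r \<in> A n"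
proof -
  show mem: "r \<in> span A \<longleftrightarrow> r \<in> A n" if r: "r \<in> gr R n" for r n
  proof
    assume "r \<in> span A"
    then obtain c where c: "decomposition r c" "\<And>n. c n \<in> A n" by (auto simp: span_def)
    have "c = (\<lambda>k. if k = n then r else \<zero>)"
      using decomposition_unique[OF gr_closed[OF r] c(1) decomposition_homogeneous[OF r]] .
    then show "r \<in> A n" using c(2)[of n] by simp
  next
    assume "r \<in> A n"
    then show "r \<in> span A" using decomposition_homogeneous[OF r] A(2) unfolding span_def by auto
  qed
  have carr: "span A \<subseteq> carrier R" unfolding span_def by (auto elim: decompositionD)
  have add: "a \<oplus> b \<in> span A" if "a \<in> span A" "b \<in> span A" for a b
    using that decomposition_add A(3) unfolding span_def by blast
  have zero: "\<zero> \<in> span A" using decomposition_zero A(2) unfolding span_def by blast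
  have lm: "s \<otimes> a \<in> span A" if a: "a \<in> span A" and s: "s \<in> gr R m" for s a m
  proof -
    obtain c where c: "decomposition a c" "\<And>n. c n \<in> A n" using a by (auto simp: span_def)
    have "s \<otimes> c (n - m) \<in> A n" for n using A(4)[OF s c(2), of "n - m"] by simp
    then show ?thesis using decomposition_lmult[OF c(1) s] unfolding span_def by blast
  qed
  have rm: "a \<otimes> s \<in> span A" if a: "a \<in> span A" and s: "s \<in> gr R m" for s a m
  proof -
    obtain c where c: "decomposition a c" "\<And>n. c n \<in> A n" using a by (auto simp: span_def)
    have "c (n - m) \<otimes> s \<in> A n" for n
    proof -
      obtain e where e: "e \<in> gr R 0" "c (n - m) \<otimes> s = e \<otimes> (s \<otimes> c (n - m))"
        using gr_commute_unit[OF decomposition_mem[OF c(1)] s] by metis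
      show ?thesis using A(4)[OF e(1) A(4)[OF s c(2)], of "n - m"] e(2) by simp
    qed
    then show ?thesis using decomposition_rmult[OF c(1) s] unfolding span_def by blast
  qed
  have fs: "finsum R f F \<in> span A" if "finite F" "\<And>i. i \<in> F \<Longrightarrow> f i \<in> span A" for f and F :: "int set"
    using that
  proof (induction F rule: finite_induct)
    case empty
    then show ?case using zero by simp
  next
    case (insert j F)
    have "finsum R f (insert j F) = f j \<oplus> finsum R f F"
      using insert carr by (intro finsum_insert) auto
    then show ?case using add insert by simp
  qed
  have "ideal (span A) R"
  proof (rule idealI[OF ring_axioms])
    show "subgroup (span A) (add_monoid R)"
    proof (rule group.subgroupI[OF add.is_group])
      show "span A \<subseteq> carrier (add_monoid R)" using carr by simp
      show "span A \<noteq> {}" using zero by blast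
      show "inv\<^bsub>add_monoid R\<^esub> a \<in> span A" if "a \<in> span A" for a
      proof -
        have "\<ominus> a = \<ominus> \<one> \<otimes> a" using that carr by (auto simp: l_minus)
        then show ?thesis using lm[OF that gr_neg[OF gr_one]] by (simp add: a_inv_def)
      qed
      show "a \<otimes>\<^bsub>add_monoid R\<^esub> b \<in> span A" if "a \<in> span A" "b \<in> span A" for a b
        using add that by simp
    qed
  next
    fix a x assume a: "a \<in> span A" and x: "x \<in> carrier R"
    obtain c where "decomposition x c" using decomposition_ex[OF x] by blast
    then obtain F where F: "finite F" "\<And>n. c n \<in> gr R n" "x = finsum R c F" using decompositionD by metis
    have cc: "c \<in> F \<rightarrow> carrier R" using gr_closed[OF F(2)] by auto
    have ac: "a \<in> carrier R" using a carr by auto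
    show "x \<otimes> a \<in> span A"
      unfolding F(3) finsum_ldistr[OF F(1) ac cc] using lm[OF a F(2)] by (intro fs F)
    show "a \<otimes> x \<in> span A"
      unfolding F(3) finsum_rdistr[OF F(1) ac cc] using rm[OF a F(2)] by (intro fs F)
  qed
  moreover have "\<exists>c. (\<forall>n. c n \<in> span A \<inter> gr R n) \<and> finite {n. c n \<noteq> \<zero>} \<and> r = finsum R c {n. c n \<noteq> \<zero>}"
    if r: "r \<in> span A" for r
  proof -
    obtain c where c: "decomposition r c" "\<And>n. c n \<in> A n" using r by (auto simp: span_def)
    then have "c n \<in> span A \<inter> gr R n" for n using mem[OF decomposition_mem[OF c(1)], of n] decomposition_mem[OF c(1)] by auto
    then show ?thesis using c(1) unfolding decomposition_def by blast
  qed
  ultimately show "homogeneous_ideal R (span A)" unfolding homogeneous_ideal_def by blast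
qed

text \<open>A homogeneous ideal \<open>p\<close> that contains \<open>I\<close> and is maximal among those avoiding the powers of \<open>z\<close> is prime:
  the colon ideals $(p : b)$ and $(p : z^N)$ contain \<open>p\<close>, so each of them equals \<open>p\<close> or contains a
  power of \<open>z\<close>.\<close>

lemma ex_prime_avoiding_powers:
  assumes I: "homogeneous_ideal R I" and z: "z \<in> gr R e" "\<And>N::nat. z [^] N \<notin> I"
  obtains p where "p \<in> Spec R" "I \<subseteq> p" "z \<notin> p"
proof -
  let ?A = "{J. homogeneous_ideal R J \<and> I \<subseteq> J \<and> (\<forall>N::nat. z [^] N \<notin> J)}"
  \<comment> \<open>Zorn's lemma; unions of chains inherit the defining properties of the class\<close>
  have "\<exists>p\<in>?A. \<forall>J\<in>?A. p \<subseteq> J \<longrightarrow> J = p"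
  proof (rule subset_Zorn_nonempty)
    show "?A \<noteq> {}" using I z by blast
    fix C assume C: "C \<noteq> {}" "subset.chain ?A C"
    have CA: "J \<in> ?A" if "J \<in> C" for J using C(2) that unfolding subset.chain_def by blast
    have CI: "ideal J R" if "J \<in> C" for J using CA[OF that] unfolding homogeneous_ideal_def by blast
    have "ideal (\<Union>C) R"
    proof (rule idealI[OF ring_axioms])
      show "subgroup (\<Union>C) (add_monoid R)"
      proof (rule group.subgroupI[OF add.is_group])
        show "\<Union>C \<subseteq> carrier (add_monoid R)"
          using additive_subgroup.a_Hcarr[OF ideal.axioms(1)[OF CI]] by auto
        show "\<Union>C \<noteq> {}"
          using C(1) additive_subgroup.zero_closed[OF ideal.axioms(1)[OF CI]] by blast
        show "inv\<^bsub>add_monoid R\<^esub> a \<in> \<Union>C" if "a \<in> \<Union>C" for a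
          using that additive_subgroup.a_inv_closed[OF ideal.axioms(1)[OF CI]] by (auto simp: a_inv_def)
        fix a b assume "a \<in> \<Union>C" "b \<in> \<Union>C"
        then obtain J J' where J: "J \<in> C" "J' \<in> C" "a \<in> J" "b \<in> J'" by blast
        then have "J \<subseteq> J' \<or> J' \<subseteq> J" using C(2) unfolding subset.chain_def by blast
        then obtain K where "K \<in> C" "a \<in> K" "b \<in> K" using J by blast
        then show "a \<otimes>\<^bsub>add_monoid R\<^esub> b \<in> \<Union>C"
          using additive_subgroup.a_closed[OF ideal.axioms(1)[OF CI]] by auto
      qed
      show "x \<otimes> a \<in> \<Union>C" "a \<otimes> x \<in> \<Union>C" if "a \<in> \<Union>C" "x \<in> carrier R" for a x
        using that ideal.I_l_closed[OF CI] ideal.I_r_closed[OF CI] by blast+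
    qed
    moreover have "\<exists>c. (\<forall>n. c n \<in> \<Union>C \<inter> gr R n) \<and> finite {n. c n \<noteq> \<zero>} \<and> r = finsum R c {n. c n \<noteq> \<zero>}"
      if r: "r \<in> \<Union>C" for r
    proof -
      obtain J where J: "J \<in> C" "r \<in> J" using r by blast
      then have "\<exists>c. (\<forall>n. c n \<in> J \<inter> gr R n) \<and> finite {n. c n \<noteq> \<zero>} \<and> r = finsum R c {n. c n \<noteq> \<zero>}"
        using CA[OF J(1)] unfolding homogeneous_ideal_def by blast
      then show ?thesis using J(1) by blast
    qed
    ultimately have "homogeneous_ideal R (\<Union>C)" unfolding homogeneous_ideal_def by blast
    then show "\<Union>C \<in> ?A" using CA C(1) by blast
  qed
  then obtain p where p: "homogeneous_ideal R p" "I \<subseteq> p" "\<And>N::nat. z [^] N \<notin> p"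
    and max: "\<And>J. homogeneous_ideal R J \<Longrightarrow> p \<subseteq> J \<Longrightarrow> (\<And>N::nat. z [^] N \<notin> J) \<Longrightarrow> J = p"
    by auto
  interpret p: ideal p R using p(1) by (simp add: homogeneous_ideal_def)
  have colon: "(\<exists>N::nat. z [^] N \<otimes> b \<in> p) \<or> a \<in> p"
    if ab: "a \<in> gr R m" "b \<in> gr R n" "a \<otimes> b \<in> p" for a b m n
  proof -
    let ?B = "\<lambda>k. {r \<in> gr R k. r \<otimes> b \<in> p}"
    have bc: "b \<in> carrier R" using ab by simp
    have B: "homogeneous_ideal R (span ?B)" "\<And>r k. r \<in> gr R k \<Longrightarrow> r \<in> span ?B \<longleftrightarrow> r \<in> ?B k"
      by (rule homogeneous_ideal_span;
          use ab bc gr_add gr_mult p.I_l_closed p.a_closed p.zero_closed in \<open>auto simp: l_distr m_assoc\<close>)+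
    have "p \<subseteq> span ?B"
    proof
      fix r assume "r \<in> p"
      then obtain c where c: "\<And>n. c n \<in> p \<inter> gr R n" "finite {n. c n \<noteq> \<zero>}" "r = finsum R c {n. c n \<noteq> \<zero>}"
        using p(1) unfolding homogeneous_ideal_def by meson
      have "c n \<in> ?B n" for n using c(1)[of n] p.I_r_closed[OF _ bc] by auto
      moreover have "decomposition r c" using c by (auto simp: decomposition_def)
      ultimately show "r \<in> span ?B" unfolding span_def by blast
    qed
    then show ?thesis using max[OF B(1)] B(2)[OF gr_pow[OF z(1)]] B(2)[OF ab(1)] ab by blast
  qed
  have "a \<in> p \<or> b \<in> p" if ab: "a \<in> gr R m" "b \<in> gr R n" "a \<otimes> b \<in> p" for a b m n
  proof (rule ccontr)
    assume np: "\<not> (a \<in> p \<or> b \<in> p)"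
    then obtain N :: nat where N: "z [^] N \<otimes> b \<in> p" using colon[OF ab] by blast
    obtain s where s: "s \<in> gr R 0" "b \<otimes> z [^] N = s \<otimes> (z [^] N \<otimes> b)"
      using gr_commute_unit[OF ab(2) gr_pow[OF z(1)]] by metis
    have "b \<otimes> z [^] N \<in> p" using s N p.I_l_closed by simp
    then obtain K :: nat where "z [^] K \<otimes> z [^] N \<in> p" using colon[OF ab(2) gr_pow[OF z(1)]] np by blast
    then show False using p(3)[of "K + N"] z(1) by (simp add: nat_pow_mult)
  qed
  moreover have "p \<noteq> carrier R" using p(3)[of 0] by auto
  ultimately have "p \<in> Spec R" using p(1) unfolding Spec_def by blast
  then show ?thesis using that[of p] p(2) p(3)[of 1] z(1) by simp
qed

lemma prime_pow:
  assumes p: "p \<in> Spec R" and z: "z \<in> gr R e" "z \<notin> p" shows "z [^] (N::nat) \<notin> p"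
proof (induction N)
  case 0
  interpret p: ideal p R using p by (simp add: Spec_def homogeneous_ideal_def)
  have "\<one> \<notin> p" using p p.one_imp_carrier unfolding Spec_def by blast
  then show ?case by simp
next
  case (Suc N)
  then show ?case using p z gr_pow[OF z(1), of N] unfolding Spec_def by auto
qed

end

section \<open>Central actions and nilpotence\<close>

locale linear_triangulated_category = triangulated_category T + graded_commutative_ring R
  for T :: "('o, 'm, 'z) tri_cat_scheme" (structure) and R :: "('r, 'y) graded_ring_scheme" (structure) +
  fixes act :: "int \<Rightarrow> 'r \<Rightarrow> 'o \<Rightarrow> 'm"
  assumes lin: "linear_action T R act"
begin

lemma act_hom: assumes "a \<in> gr R n" "X \<in> Obj T" shows "act n a X \<in> Hom T X (suspO T n X)"
  using lin assms by (auto simp: linear_action_def center_def nat_trans_def id_functor_def susp_def)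

lemma act_natural:
  assumes "a \<in> gr R n" "f \<in> Hom T X Y" shows "act n a Y \<cdot> f = suspA T n f \<cdot> act n a X"
  using lin assms by (auto simp: linear_action_def center_def nat_trans_def id_functor_def susp_def Hom_def)

lemma act_sig:
  assumes "a \<in> gr R n" "X \<in> Obj T" shows "act n a (SigO T X) = signed T n (SigA T (act n a X))"
  using lin assms by (auto simp: linear_action_def center_def)

lemma act_mult:
  assumes "a \<in> gr R m" "b \<in> gr R n" "X \<in> Obj T"
  shows "act (m + n) (a \<otimes>\<^bsub>R\<^esub> b) X = suspA T n (act m a X) \<cdot> act n b X"
  using lin assms by (simp add: linear_action_def)

lemma act_add:
  assumes "a \<in> gr R n" "b \<in> gr R n" "X \<in> Obj T"
  shows "act n (a \<oplus>\<^bsub>R\<^esub> b) X = Add T (act n a X) (act n b X)"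
  using lin assms by (simp add: linear_action_def)

lemma act_one: "X \<in> Obj T \<Longrightarrow> act 0 \<one>\<^bsub>R\<^esub> X = Idn T X"
  using lin by (simp add: linear_action_def)

lemma signed_arr [simp]:
  assumes "f \<in> Arr T"
  shows "signed T k f \<in> Arr T" "Dom T (signed T k f) = Dom T f" "Cod T (signed T k f) = Cod T f"
  using assms by (auto simp: signed_def)

lemma signed_zer: "f \<in> Arr T \<Longrightarrow> A = Dom T f \<Longrightarrow> B = Cod T f \<Longrightarrow> signed T k f = Zer T A B \<longleftrightarrow> f = Zer T A B"
  by (simp add: signed_def)

lemma sig_signed: "f \<in> Arr T \<Longrightarrow> SigA T (signed T k f) = signed T k (SigA T f)"
  using Sig_neg[OF tri, of f] by (auto simp: signed_def Hom_def)

lemma sig_susp: "X \<in> Obj T \<Longrightarrow> suspO T n (SigO T X) = SigO T (suspO T n X)"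
    "f \<in> Arr T \<Longrightarrow> suspA T n (SigA T f) = SigA T (suspA T n f)"
  by (simp_all add: susp_susp add.commute flip: susp_1)

text \<open>Only vanishing of the action matters later, so the sign is not computed.\<close>

lemma act_susp:
  assumes a: "a \<in> gr R n" and X: "X \<in> Obj T"
  shows "\<exists>k. act n a (suspO T j X) = signed T k (suspA T j (act n a X))"
proof (rule int_orbit[of "\<lambda>j. \<exists>k. act n a (suspO T j X) = signed T k (suspA T j (act n a X))"])
  have aX: "act n a X \<in> Arr T" using act_hom[OF a X] by (simp add: Hom_def)
  show "\<exists>k. act n a (suspO T 0 X) = signed T k (suspA T 0 (act n a X))"
    by (rule exI[of _ 0]) (simp add: signed_def)
  fix j
  let ?Y = "suspO T j X"
  have aY: "act n a ?Y \<in> Arr T" using act_hom[OF a, of ?Y] X by (simp add: Hom_def)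
  have e: "act n a (suspO T (j + 1) X) = signed T n (SigA T (act n a ?Y))"
    using act_sig[OF a, of ?Y] X by (simp add: susp_step_up)
  show "(\<exists>k. act n a (suspO T j X) = signed T k (suspA T j (act n a X))) \<longleftrightarrow>
    (\<exists>k. act n a (suspO T (j + 1) X) = signed T k (suspA T (j + 1) (act n a X)))"
  proof
    assume "\<exists>k. act n a (suspO T j X) = signed T k (suspA T j (act n a X))"
    then obtain k where "act n a ?Y = signed T k (suspA T j (act n a X))" by blast
    then have "act n a (suspO T (j + 1) X) = signed T (n + k) (suspA T (j + 1) (act n a X))"
      using e aX by (simp add: sig_signed susp_step_up signed_signed[OF tri, of _ "Dom T (SigA T (suspA T j (act n a X)))" "Cod T (SigA T (suspA T j (act n a X)))"] Hom_def)
    then show "\<exists>k. act n a (suspO T (j + 1) X) = signed T k (suspA T (j + 1) (act n a X))" by blast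
  next
    assume "\<exists>k. act n a (suspO T (j + 1) X) = signed T k (suspA T (j + 1) (act n a X))"
    then obtain k where k: "signed T n (SigA T (act n a ?Y)) = signed T k (SigA T (suspA T j (act n a X)))"
      using e aX by (auto simp: susp_step_up)
    have "signed T n (signed T n (SigA T (act n a ?Y))) = SigA T (act n a ?Y)"
      using aY by (simp add: signed_def)
    then have "SigA T (act n a ?Y) = signed T n (signed T k (SigA T (suspA T j (act n a X))))" using k by simp
    also have "\<dots> = SigA T (signed T n (signed T k (suspA T j (act n a X))))" using aX by (simp add: sig_signed)
    finally have "act n a ?Y = signed T n (signed T k (suspA T j (act n a X)))"
      using aY aX by (simp add: sig_inj)
    also have "\<dots> = signed T (n + k) (suspA T j (act n a X))"
      using signed_signed[OF tri susp_hom[OF act_hom[OF a X]]] .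
    finally show "\<exists>k. act n a (suspO T j X) = signed T k (suspA T j (act n a X))" by blast
  qed
qed

definition kills where
  "kills n a X \<longleftrightarrow> act n a X = Zer T X (suspO T n X)"

lemma kills_susp:
  assumes a: "a \<in> gr R n" and X: "X \<in> Obj T"
  shows "kills n a (suspO T k X) \<longleftrightarrow> kills n a X"
proof -
  obtain j where j: "act n a (suspO T k X) = signed T j (suspA T k (act n a X))" using act_susp[OF a X] by blast
  have aX: "act n a X \<in> Arr T" "Dom T (act n a X) = X" "Cod T (act n a X) = suspO T n X"
    using act_hom[OF a X] by (auto simp: Hom_def)
  have "kills n a (suspO T k X) \<longleftrightarrow> suspA T k (act n a X) = Zer T (suspO T k X) (suspO T k (suspO T n X))"
    unfolding kills_def j using aX X by (subst signed_zer) (simp_all add: susp_susp add.commute)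
  also have "\<dots> \<longleftrightarrow> kills n a X" using aX X by (simp add: susp_eq_zer kills_def)
  finally show ?thesis .
qed

lemma kills_mult:
  assumes a: "a \<in> gr R m" "b \<in> gr R n" and X: "X \<in> Obj T" and k: "kills m a X \<or> kills n b X"
  shows "kills (m + n) (a \<otimes>\<^bsub>R\<^esub> b) X"
proof -
  have b: "act n b X \<in> Hom T X (suspO T n X)" using act_hom a X by simp
  have a': "suspA T n (act m a X) \<in> Hom T (suspO T n X) (suspO T (m + n) X)"
    using susp_hom[OF act_hom[OF a(1) X], of n] X by (simp add: susp_susp add.commute)
  have "suspA T n (act m a X) \<cdot> act n b X = Zer T X (suspO T (m + n) X)"
    using k
  proof
    assume "kills m a X"
    then have "suspA T n (act m a X) = Zer T (suspO T n X) (suspO T (m + n) X)"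
      using X by (simp add: kills_def susp_zer susp_susp add.commute)
    then show ?thesis using hom_zer[OF b] X by simp
  next
    assume "kills n b X"
    then show ?thesis using zer_hom[OF a' X] by (simp add: kills_def)
  qed
  then show ?thesis using act_mult[OF a X] by (simp add: kills_def)
qed

definition nilpotent_on where
  "nilpotent_on e z X \<longleftrightarrow> (\<exists>N::nat. kills (int N * e) (z [^]\<^bsub>R\<^esub> N) X)"

lemma kills_pow_mono:
  assumes z: "z \<in> gr R e" and X: "X \<in> Obj T" and k: "kills (int N * e) (z [^]\<^bsub>R\<^esub> (N::nat)) X" and le: "N \<le> K"
  shows "kills (int K * e) (z [^]\<^bsub>R\<^esub> K) X"
proof -
  obtain j where j: "K = j + N" using le by (metis le_Suc_ex add.commute)
  have "kills (int j * e + int N * e) (z [^]\<^bsub>R\<^esub> j \<otimes>\<^bsub>R\<^esub> z [^]\<^bsub>R\<^esub> N) X"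
    using kills_mult[OF gr_pow[OF z] gr_pow[OF z] X, of j N] k by blast
  then show ?thesis using j z by (simp add: nat_pow_mult algebra_simps)
qed

lemma nilpotent_susp:
  assumes "z \<in> gr R e" "X \<in> Obj T" shows "nilpotent_on e z (suspO T k X) \<longleftrightarrow> nilpotent_on e z X"
  unfolding nilpotent_on_def using kills_susp[OF gr_pow[OF assms(1)] assms(2)] by blast

text \<open>The first hypothesis says that the action of \<open>z\<close> on the cone vanishes after restriction along \<open>g\<close>, so
  it factors as $k h$; by naturality a second application of \<open>z\<close> can be moved past \<open>h\<close>, where
  the second hypothesis kills it.\<close>

lemma kills_square_cone:
  assumes t: "(f, g, h) \<in> Tri T" and z: "z \<in> gr R e"
    and g: "suspA T e g \<cdot> act e z (Dom T g) = Zer T (Dom T g) (suspO T e (Cod T g))"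
    and h: "act e z (SigO T (Dom T f)) \<cdot> h = Zer T (Cod T g) (suspO T e (SigO T (Dom T f)))"
  shows "kills (e + e) (z \<otimes>\<^bsub>R\<^esub> z) (Cod T g)"
proof -
  note d = TriD[OF t]
  let ?Y = "Cod T g"
  have Y: "?Y \<in> Obj T" using d by simp
  have zY: "act e z ?Y \<in> Hom T ?Y (suspO T e ?Y)" using act_hom[OF z Y] .
  have gh: "g \<in> Hom T (Dom T g) ?Y" "h \<in> Hom T ?Y (SigO T (Dom T f))" using d by (auto simp: Hom_def)
  have "act e z ?Y \<cdot> g = Zer T (Dom T g) (suspO T e ?Y)" using act_natural[OF z gh(1)] g by simp
  then obtain k where k: "k \<in> Hom T (SigO T (Dom T f)) (suspO T e ?Y)" "k \<cdot> h = act e z ?Y"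
    using weak_cokernel2[OF t, of "act e z ?Y" "suspO T e ?Y"] zY d by metis
  have "suspA T e (act e z ?Y) \<cdot> act e z ?Y = (suspA T e k \<cdot> suspA T e h) \<cdot> act e z ?Y"
    using susp_cmp[of h k e] k gh by (simp add: Hom_def)
  also have "\<dots> = suspA T e k \<cdot> (suspA T e h \<cdot> act e z ?Y)"
    using susp_hom[OF k(1), of e] susp_hom[OF gh(2), of e] zY by (simp add: Hom_def)
  also have "suspA T e h \<cdot> act e z ?Y = act e z (SigO T (Dom T f)) \<cdot> h" using act_natural[OF z gh(2)] by simp
  also have "suspA T e k \<cdot> \<dots> = Zer T ?Y (suspO T e (suspO T e ?Y))"
    using h zer_hom[OF susp_hom[OF k(1), of e] Y] by simp
  finally show ?thesis using act_mult[OF z z Y] Y by (simp add: kills_def susp_susp)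
qed

lemma nilpotent_cone:
  assumes t: "(f, g, h) \<in> Tri T" and z: "z \<in> gr R e"
    and n: "nilpotent_on e z (Dom T f)" "nilpotent_on e z (Dom T g)"
  shows "nilpotent_on e z (Cod T g)"
proof -
  note d = TriD[OF t]
  have o: "Dom T f \<in> Obj T" "Dom T g \<in> Obj T" "Cod T g \<in> Obj T" using d by auto
  obtain N K :: nat where NK: "kills (int N * e) (z [^]\<^bsub>R\<^esub> N) (Dom T f)" "kills (int K * e) (z [^]\<^bsub>R\<^esub> K) (Dom T g)"
    using n unfolding nilpotent_on_def by blast
  define M where "M = max N K"
  let ?n = "int M * e" and ?a = "z [^]\<^bsub>R\<^esub> M"
  have a: "?a \<in> gr R ?n" using gr_pow[OF z] .
  have k: "kills ?n ?a (suspO T 1 (Dom T f))" "kills ?n ?a (Dom T g)"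
    using kills_pow_mono[OF z o(1) NK(1)] kills_pow_mono[OF z o(2) NK(2)] kills_susp[OF a o(1)] by (auto simp: M_def)
  have gh: "suspA T ?n g \<in> Hom T (suspO T ?n (Dom T g)) (suspO T ?n (Cod T g))" "h \<in> Hom T (Cod T g) (SigO T (Dom T f))"
    using d by (auto simp: Hom_def)
  have "kills (?n + ?n) (?a \<otimes>\<^bsub>R\<^esub> ?a) (Cod T g)"
    using k zer_hom[OF gh(1) o(2)] hom_zer[OF gh(2), of "suspO T ?n (SigO T (Dom T f))"] o
    by (intro kills_square_cone[OF t a]) (simp_all add: kills_def susp_1)
  then show ?thesis unfolding nilpotent_on_def using z
    by (intro exI[of _ "M + M"]) (simp add: nat_pow_mult algebra_simps)
qed

text \<open>Both composites of $x^N$ with the other two maps of its own triangle vanish up to sign, so $x^{2N}$ kills the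
  cone.\<close>

lemma nilpotent_self_cone:
  assumes z: "z \<in> gr R e" and X: "X \<in> Obj T" and t: "(act (int N * e) (z [^]\<^bsub>R\<^esub> (N::nat)) X, g, h) \<in> Tri T"
  shows "nilpotent_on e z (Cod T g)"
proof -
  let ?n = "int N * e" and ?a = "z [^]\<^bsub>R\<^esub> N"
  have a: "?a \<in> gr R ?n" using gr_pow[OF z] .
  note d = TriD[OF t]
  have aX: "act ?n ?a X \<in> Arr T" "Dom T (act ?n ?a X) = X" "Cod T (act ?n ?a X) = suspO T ?n X"
    using act_hom[OF a X] by (auto simp: Hom_def)
  have Dg: "Dom T g = suspO T ?n X" using d aX by simp
  have o: "Cod T g \<in> Obj T" using d by simp
  obtain k where k: "act ?n ?a (suspO T ?n X) = signed T k (suspA T ?n (act ?n ?a X))" using act_susp[OF a X] by blast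
  have "suspA T ?n g \<cdot> act ?n ?a (Dom T g) = signed T k (suspA T ?n g \<cdot> suspA T ?n (act ?n ?a X))"
    using k Dg cmp_signed[OF tri, of "suspA T ?n (act ?n ?a X)" "suspO T ?n X" "suspO T ?n (Dom T g)" "suspA T ?n g" "suspO T ?n (Cod T g)"]
      aX d by (simp add: Hom_def)
  also have "suspA T ?n g \<cdot> suspA T ?n (act ?n ?a X) = suspA T ?n (g \<cdot> act ?n ?a X)"
    using aX d by (simp add: susp_cmp)
  also have "\<dots> = Zer T (Dom T g) (suspO T ?n (Cod T g))"
    using Tri_cmp[OF t] aX Dg o X by (simp add: susp_zer)
  finally have 1: "suspA T ?n g \<cdot> act ?n ?a (Dom T g) = Zer T (Dom T g) (suspO T ?n (Cod T g))"
    using Dg X o by (simp add: signed_zer)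
  have "act ?n ?a (SigO T X) \<cdot> h = signed T ?n (SigA T (act ?n ?a X) \<cdot> h)"
    unfolding act_sig[OF a X]
    using signed_cmp[OF tri, of h "Dom T h" "SigO T X" "SigA T (act ?n ?a X)" "SigO T (suspO T ?n X)"] aX d
    by (simp add: Hom_def)
  also have "\<dots> = Zer T (Cod T g) (suspO T ?n (SigO T X))"
    using Tri_cmp3[OF t] aX d X o by (simp add: signed_zer sig_susp)
  finally have "kills (?n + ?n) (?a \<otimes>\<^bsub>R\<^esub> ?a) (Cod T g)"
    using aX 1 by (intro kills_square_cone[OF t a]) simp_all
  then show ?thesis unfolding nilpotent_on_def using z
    by (intro exI[of _ "N + N"]) (simp add: nat_pow_mult algebra_simps)
qed

section \<open>Support of compact objects\<close>

text \<open>The localization of $\mathrm{End}^*(D)$ vanishes iff the fractions of the identity and of zero agree, that is, iff a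
  homogeneous element outside \<open>p\<close> kills the identity of \<open>D\<close>.\<close>

lemma End_localization_zero_iff:
  assumes D: "D \<in> Obj T" and p: "p \<in> Spec R"
  shows "End_localization_zero T R act D p \<longleftrightarrow> (\<exists>n a. a \<in> gr R n \<and> a \<notin> p \<and> kills n a D)"
proof
  let ?N = "\<lambda>n. Hom T D (suspO T n D)" and ?sm = "\<lambda>j n a f. suspA T n (act j a D) \<cdot> f"
  let ?z = "\<lambda>n. Zer T D (suspO T n D)"
  interpret p: ideal p R using p by (simp add: Spec_def homogeneous_ideal_def)
  have one: "\<one>\<^bsub>R\<^esub> \<notin> p" using p p.one_imp_carrier unfolding Spec_def by blast
  {
    assume "End_localization_zero T R act D p"
    then have l: "localization R p ?N ?sm 0 = {frac_rel R p ?N ?sm 0 `` {(0, \<one>\<^bsub>R\<^esub>, ?z 0)}}"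
      unfolding End_localization_zero_def localization_zero_def by blast
    have fr: "(0, \<one>\<^bsub>R\<^esub>, Idn T D) \<in> fractions R p ?N 0" using one D Id_Hom[OF tri D] by (simp add: fractions_def)
    then have "frac_rel R p ?N ?sm 0 `` {(0, \<one>\<^bsub>R\<^esub>, Idn T D)} \<in> localization R p ?N ?sm 0"
      unfolding localization_def by (rule quotientI)
    then have e: "frac_rel R p ?N ?sm 0 `` {(0, \<one>\<^bsub>R\<^esub>, Idn T D)} = frac_rel R p ?N ?sm 0 `` {(0, \<one>\<^bsub>R\<^esub>, ?z 0)}"
      unfolding l by (rule singletonD)
    have "((0, \<one>\<^bsub>R\<^esub>, Idn T D), (0, \<one>\<^bsub>R\<^esub>, Idn T D)) \<in> frac_rel R p ?N ?sm 0"
      unfolding frac_rel_def mem_Collect_eq prod.case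
      by (intro conjI fr exI[of _ "0::int"] exI[of _ "\<one>\<^bsub>R\<^esub>"]) (use one in simp_all)
    then have "((0, \<one>\<^bsub>R\<^esub>, ?z 0), (0, \<one>\<^bsub>R\<^esub>, Idn T D)) \<in> frac_rel R p ?N ?sm 0"
      unfolding Image_singleton_iff[symmetric] e .
    then obtain j a j' b where ab: "a \<in> gr R j" "b \<in> gr R j'" "j + 0 = j' + 0"
      "a \<otimes>\<^bsub>R\<^esub> \<one>\<^bsub>R\<^esub> = b \<otimes>\<^bsub>R\<^esub> \<one>\<^bsub>R\<^esub>" "a \<otimes>\<^bsub>R\<^esub> \<one>\<^bsub>R\<^esub> \<notin> p" "suspA T (0 + 0) (act j a D) \<cdot> ?z 0 = suspA T (0 + 0) (act j' b D) \<cdot> Idn T D"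
      unfolding frac_rel_def by blast
    have e: "a = b" "j' = j" "a \<notin> p" using ab by auto
    have aD: "act j a D \<in> Hom T D (suspO T j D)" using act_hom[OF ab(1) D] .
    have "act j a D = act j a D \<cdot> Zer T D D" using ab(6) e aD D by (simp add: Hom_def)
    then have "kills j a D" using zer_hom[OF aD D] by (simp add: kills_def)
    then show "\<exists>n a. a \<in> gr R n \<and> a \<notin> p \<and> kills n a D" using ab(1) e by blast
  }
  assume "\<exists>n a. a \<in> gr R n \<and> a \<notin> p \<and> kills n a D"
  then obtain n a where a: "a \<in> gr R n" "a \<notin> p" "kills n a D" by blast
  have prime: "r \<otimes>\<^bsub>R\<^esub> s \<notin> p" if "r \<in> gr R i" "s \<in> gr R j" "r \<notin> p" "s \<notin> p" for r s i j
    using p that unfolding Spec_def by blast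
  \<comment> \<open>all fractions agree: both numerators are killed after expanding by a multiple of \<open>a\<close>\<close>
  have all: "(\<xi>, \<zeta>) \<in> frac_rel R p ?N ?sm d"
    if fr: "\<xi> \<in> fractions R p ?N d" "\<zeta> \<in> fractions R p ?N d" for \<xi> \<zeta> d
  proof -
    obtain k s m k' s' m' where xz: "\<xi> = (k, s, m)" "\<zeta> = (k', s', m')" by (metis prod_cases3)
    have f: "s \<in> gr R k" "s \<notin> p" "m \<in> ?N (k + d)" "s' \<in> gr R k'" "s' \<notin> p" "m' \<in> ?N (k' + d)"
      using fr unfolding xz fractions_def by auto
    obtain c where c: "c \<in> gr R 0" "s' \<otimes>\<^bsub>R\<^esub> s = c \<otimes>\<^bsub>R\<^esub> (s \<otimes>\<^bsub>R\<^esub> s')" using gr_commute_unit[OF f(4) f(1)] by metis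
    have cs: "c \<otimes>\<^bsub>R\<^esub> s \<in> gr R k" using gr_mult[OF c(1) f(1)] by simp
    have g: "a \<otimes>\<^bsub>R\<^esub> s' \<in> gr R (n + k')" "a \<otimes>\<^bsub>R\<^esub> (c \<otimes>\<^bsub>R\<^esub> s) \<in> gr R (n + k)"
      using gr_mult[OF a(1) f(4)] gr_mult[OF a(1) cs] by auto
    have e: "(a \<otimes>\<^bsub>R\<^esub> s') \<otimes>\<^bsub>R\<^esub> s = (a \<otimes>\<^bsub>R\<^esub> (c \<otimes>\<^bsub>R\<^esub> s)) \<otimes>\<^bsub>R\<^esub> s'"
      using c(2) gr_closed[OF a(1)] gr_closed[OF f(1)] gr_closed[OF f(4)] gr_closed[OF c(1)] by (simp add: m_assoc)
    have np: "(a \<otimes>\<^bsub>R\<^esub> s') \<otimes>\<^bsub>R\<^esub> s \<notin> p" using prime[OF g(1) f(1) prime[OF a(1) f(4) a(2) f(5)] f(2)] .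
    have k1: "kills (n + k') (a \<otimes>\<^bsub>R\<^esub> s') D" "kills (n + k) (a \<otimes>\<^bsub>R\<^esub> (c \<otimes>\<^bsub>R\<^esub> s)) D"
      using kills_mult[OF a(1) f(4) D] kills_mult[OF a(1) cs D] a(3) by blast+
    have z1: "suspA T (k + d) (act (n + k') (a \<otimes>\<^bsub>R\<^esub> s') D) \<cdot> m = Zer T D (suspO T (k + d + (n + k')) D)"
      using k1(1) hom_zer[OF f(3)] D by (simp add: kills_def susp_zer susp_susp)
    have z2: "suspA T (k' + d) (act (n + k) (a \<otimes>\<^bsub>R\<^esub> (c \<otimes>\<^bsub>R\<^esub> s)) D) \<cdot> m' = Zer T D (suspO T (k' + d + (n + k)) D)"
      using k1(2) hom_zer[OF f(6)] D by (simp add: kills_def susp_zer susp_susp)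
    have deg: "k + d + (n + k') = k' + d + (n + k)" by simp
    have "suspA T (k + d) (act (n + k') (a \<otimes>\<^bsub>R\<^esub> s') D) \<cdot> m = suspA T (k' + d) (act (n + k) (a \<otimes>\<^bsub>R\<^esub> (c \<otimes>\<^bsub>R\<^esub> s)) D) \<cdot> m'"
      by (simp only: z1 z2 deg)
    moreover have "n + k' + k = n + k + k'" by simp
    ultimately show ?thesis
      using fr g e np unfolding xz frac_rel_def by blast
  qed
  show "End_localization_zero T R act D p"
    unfolding End_localization_zero_def localization_zero_def
  proof
    fix d
    have zf: "(0, \<one>\<^bsub>R\<^esub>, ?z d) \<in> fractions R p ?N d" using one D Zer_Hom[OF tri D] by (simp add: fractions_def)
    have "frac_rel R p ?N ?sm d `` {\<xi>} = fractions R p ?N d" if "\<xi> \<in> fractions R p ?N d" for \<xi>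
      using all[OF that] unfolding frac_rel_def by blast
    then show "localization R p ?N ?sm d = {frac_rel R p ?N ?sm d `` {(0, \<one>\<^bsub>R\<^esub>, ?z d)}}"
      unfolding localization_def quotient_def using zf by blast
  qed
qed

lemma kills_zero: assumes "X \<in> Obj T" shows "kills n \<zero>\<^bsub>R\<^esub> X"
proof -
  have "Add T (act n \<zero>\<^bsub>R\<^esub> X) (act n \<zero>\<^bsub>R\<^esub> X) = act n \<zero>\<^bsub>R\<^esub> X"
    using act_add[OF gr_zero gr_zero assms, of n] by simp
  then show ?thesis
    using add_idem_zero[OF tri act_hom[OF gr_zero assms]] by (simp add: kills_def)
qed

text \<open>The annihilator of \<open>D\<close> is a homogeneous ideal.  If it contained no power of \<open>x i\<close>, a prime that
  contains it and avoids \<open>x i\<close> would contradict the vanishing of the localization at that prime.\<close>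

lemma supported_iff_nilpotent:
  fixes x :: "nat \<Rightarrow> 'r"
  assumes x: "\<And>i. i \<in> {1..t} \<Longrightarrow> x i \<in> gr R (d i)" and D: "D \<in> Obj T"
  shows "(\<forall>p \<in> Spec R - closed_set R (Idl\<^bsub>R\<^esub> (x ` {1..t})). End_localization_zero T R act D p) \<longleftrightarrow>
    (\<forall>i \<in> {1..t}. nilpotent_on (d i) (x i) D)"
proof (intro iffI ballI)
  have xc: "x ` {1..t} \<subseteq> carrier R" using gr_closed[OF x] by auto
  fix i assume z: "\<forall>p \<in> Spec R - closed_set R (Idl\<^bsub>R\<^esub> (x ` {1..t})). End_localization_zero T R act D p"
    and i: "i \<in> {1..t}"
  let ?A = "\<lambda>n. {a \<in> gr R n. kills n a D}"
  have A1: "a \<oplus>\<^bsub>R\<^esub> b \<in> ?A n" if ab: "a \<in> ?A n" "b \<in> ?A n" for n a b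
  proof -
    have "act n (a \<oplus>\<^bsub>R\<^esub> b) D = Add T (Zer T D (suspO T n D)) (Zer T D (suspO T n D))"
      using act_add[of a n b D] ab D by (simp add: kills_def)
    then show ?thesis using ab gr_add Zer_add[OF tri D] D by (simp add: kills_def)
  qed
  have A2: "s \<otimes>\<^bsub>R\<^esub> a \<in> ?A (m + n)" if "s \<in> gr R m" "a \<in> ?A n" for m n s a
    using that gr_mult kills_mult[OF that(1) _ D] by simp
  have A0: "?A n \<subseteq> gr R n" "\<zero>\<^bsub>R\<^esub> \<in> ?A n" for n using kills_zero[OF D] by auto
  have A: "homogeneous_ideal R (span ?A)" "\<And>r n. r \<in> gr R n \<Longrightarrow> r \<in> span ?A \<longleftrightarrow> r \<in> ?A n"
    by (rule homogeneous_ideal_span, (rule A0 A1 A2 | assumption)+)+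
  show "nilpotent_on (d i) (x i) D"
  proof (rule ccontr)
    assume "\<not> nilpotent_on (d i) (x i) D"
    then have np: "x i [^]\<^bsub>R\<^esub> N \<notin> span ?A" for N :: nat
      using A(2)[OF gr_pow[OF x[OF i]]] unfolding nilpotent_on_def by blast
    obtain p where p: "p \<in> Spec R" "span ?A \<subseteq> p" "x i \<notin> p"
      by (rule ex_prime_avoiding_powers[OF A(1) x[OF i] np])
    have "x i \<in> Idl\<^bsub>R\<^esub> (x ` {1..t})" using genideal_self[OF xc] i by blast
    then have "p \<in> Spec R - closed_set R (Idl\<^bsub>R\<^esub> (x ` {1..t}))" using p unfolding closed_set_def by blast
    then obtain n a where "a \<in> gr R n" "a \<notin> p" "kills n a D"
      using z End_localization_zero_iff[OF D p(1)] by blast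
    then show False using A(2)[of a n] p(2) by blast
  qed
next
  fix p assume n: "\<forall>i \<in> {1..t}. nilpotent_on (d i) (x i) D" and p: "p \<in> Spec R - closed_set R (Idl\<^bsub>R\<^esub> (x ` {1..t}))"
  have "ideal p R" using p by (simp add: Spec_def homogeneous_ideal_def)
  then have "\<not> x ` {1..t} \<subseteq> p" using genideal_minimal[of p "x ` {1..t}"] p unfolding closed_set_def by blast
  then obtain i where i: "i \<in> {1..t}" "x i \<notin> p" by blast
  obtain N :: nat where N: "kills (int N * d i) (x i [^]\<^bsub>R\<^esub> N) D" using n i unfolding nilpotent_on_def by blast
  have "x i [^]\<^bsub>R\<^esub> N \<notin> p" using prime_pow[of p "x i" "d i" N] p x[OF i(1)] i by blast
  then show "End_localization_zero T R act D p"
    using End_localization_zero_iff[OF D] p N gr_pow[OF x[OF i(1)]] by blast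
qed

text \<open>Choose \<open>N\<close> with $x_i^N = 0$ on \<open>Y\<close>.  If the Koszul object of $x_i^N$ on a compact object \<open>C\<close> has no maps to
  suspensions of \<open>Y\<close>, then every map $C \to Y$ factors through $x_i^N \colon C \to \Sigma^n C$ and vanishes,
  because $x_i^N$ can be moved to \<open>Y\<close>.  The induction on \<open>s\<close> treats compact objects on which
  only the \<open>x i\<close> with $i > s$ are assumed nilpotent.\<close>

lemma orthogonal_compact_if_nilpotent:
  fixes x :: "nat \<Rightarrow> 'r" and U :: "'u itself"
  assumes x: "\<And>i. i \<in> {1..t} \<Longrightarrow> x i \<in> gr R (d i)" and Y: "Y \<in> Obj T"
    and nY: "\<And>i. i \<in> {1..t} \<Longrightarrow> nilpotent_on (d i) (x i) Y"
    and orth: "\<And>D. compact U T D \<Longrightarrow> (\<And>i. i \<in> {1..t} \<Longrightarrow> nilpotent_on (d i) (x i) D) \<Longrightarrow> orthogonal D Y"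
    and C: "compact U T C"
  shows "orthogonal C Y"
proof -
  have "\<forall>C. compact U T C \<longrightarrow> (\<forall>i\<in>{Suc s..t}. nilpotent_on (d i) (x i) C) \<longrightarrow> orthogonal C Y" if "s \<le> t" for s
    using that
  proof (induction s)
    case 0
    then show ?case using orth by simp
  next
    case (Suc s)
    show ?case
    proof (intro allI impI)
      fix C assume C: "compact U T C" and nC: "\<forall>i\<in>{Suc (Suc s)..t}. nilpotent_on (d i) (x i) C"
      have st: "Suc s \<in> {1..t}" using Suc.prems by simp
      let ?z = "x (Suc s)" and ?e = "d (Suc s)"
      have z: "?z \<in> gr R ?e" using x[OF st] .
      obtain N :: nat where N: "kills (int N * ?e) (?z [^]\<^bsub>R\<^esub> N) Y" using nY[OF st] unfolding nilpotent_on_def by blast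
      let ?n = "int N * ?e" and ?a = "?z [^]\<^bsub>R\<^esub> N"
      have a: "?a \<in> gr R ?n" using gr_pow[OF z] .
      have Co: "C \<in> Obj T" using compact_obj[OF C] .
      have aC: "act ?n ?a C \<in> Arr T" "Dom T (act ?n ?a C) = C" "Cod T (act ?n ?a C) = suspO T ?n C"
        using act_hom[OF a Co] by (auto simp: Hom_def)
      obtain g h where t: "(act ?n ?a C, g, h) \<in> Tri T" using Tri_cone[OF aC(1)] by blast
      note d = TriD[OF t]
      have Dg: "Dom T g = suspO T ?n C" using d aC by simp
      let ?K = "Cod T g"
      have K: "compact U T ?K" using compact_cone[OF t, of U] C compact_susp[OF C] aC Dg d by simp
      have Ko: "?K \<in> Obj T" using compact_obj[OF K] .
      have nK: "nilpotent_on (d i) (x i) ?K" if i: "i \<in> {Suc s..t}" for i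
      proof (cases "i = Suc s")
        case True
        then show ?thesis using nilpotent_self_cone[OF z Co t] by simp
      next
        case False
        then have "i \<in> {Suc (Suc s)..t}" "i \<in> {1..t}" using i by auto
        then show ?thesis
          using nilpotent_cone[OF t x[of i]] nilpotent_susp[OF x[of i] Co] nC aC Dg by simp
      qed
      \<comment> \<open>needed for a desuspension of \<open>?K\<close>, which satisfies the same hypotheses as \<open>?K\<close>\<close>
      have IH: "orthogonal D Y" if "compact U T D" "\<And>i. i \<in> {Suc s..t} \<Longrightarrow> nilpotent_on (d i) (x i) D" for D
        using Suc that by simp
      have "orthogonal (suspO T (- 1) ?K) Y"
        using IH[OF compact_susp[OF K]] nilpotent_susp[OF x Ko] nK by simp
      then have oK: "orthogonal ?K (SigO T Y)"
        using orthogonal_shift[OF Ko Y, of "-1" 0] by (simp add: susp_1)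
      show "orthogonal C Y"
        unfolding orthogonal_def
      proof
        fix f assume f: "f \<in> Hom T C Y"
        have sf: "SigA T f \<in> Hom T (SigO T C) (SigO T Y)" using f by (simp add: Hom_def)
        have "SigA T f \<cdot> h \<in> Hom T ?K (SigO T Y)" using sf d aC by (simp add: Hom_def)
        then have "SigA T f \<cdot> h = Zer T (Dom T h) (SigO T Y)" using oK d unfolding orthogonal_def by simp
        then obtain b where b: "b \<in> Hom T (SigO T (suspO T ?n C)) (SigO T Y)" "b \<cdot> SigA T (act ?n ?a C) = SigA T f"
          using weak_cokernel3[OF t, of "SigA T f" "SigO T Y"] sf aC by metis
        \<comment> \<open>suspended back so that naturality of \<open>?a\<close> applies with \<open>C\<close> as the source\<close>
        let ?b = "suspA T (- 1 - ?n) b"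
        have b': "?b \<in> Hom T C (suspO T (- ?n) Y)"
          using susp_hom[OF b(1), of "- 1 - ?n"] Co Y by (simp add: susp_susp flip: susp_1)
        have bn: "suspA T ?n ?b = suspA T (- 1) b" using b(1) by (simp add: susp_susp Hom_def)
        have "suspA T (- 1) b \<cdot> act ?n ?a C = suspA T (- 1) (b \<cdot> SigA T (act ?n ?a C))"
          using b(1) aC Co by (simp add: susp_cmp Hom_def) (simp add: susp_susp flip: susp_1)
        also have "\<dots> = f" using b(2) f by (simp add: susp_susp Hom_def flip: susp_1)
        finally have "f = act ?n ?a (suspO T (- ?n) Y) \<cdot> ?b" using act_natural[OF a b'] bn by simp
        also have "\<dots> = Zer T C Y"
          using N kills_susp[OF a Y] hom_zer[OF b' Y] Y by (simp add: kills_def susp_susp)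
        finally show "f = Zer T C Y" .
      qed
    qed
  qed
  from this[of t] show ?thesis using C by simp
qed

end

section \<open>Koszul systems\<close>

locale koszul_system = linear_triangulated_category T R act
  for T :: "('o, 'm, 'z) tri_cat_scheme" (structure) and R :: "('r, 'y) graded_ring_scheme" (structure)
    and act :: "int \<Rightarrow> 'r \<Rightarrow> 'o \<Rightarrow> 'm" +
  fixes M :: 'o and t :: nat and d :: "nat \<Rightarrow> int" and x :: "nat \<Rightarrow> 'r"
    and Kz :: "nat \<Rightarrow> nat \<Rightarrow> 'o" and kv kw u :: "nat \<Rightarrow> nat \<Rightarrow> 'm"
  assumes M: "M \<in> Obj T"
    and x: "\<And>i. i \<in> {1..t} \<Longrightarrow> x i \<in> gr R (d i)"
    and ko: "koszul_objects T R act d x t M Kz kv kw"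
    and km: "koszul_maps T R act d x t M Kz kv kw u"
begin

abbreviation K where "K \<equiv> desusp_koszul T Kz"
abbreviation st where "st \<equiv> koszul_step T kw"
abbreviation can where "can \<equiv> koszul_canonical T M kw"
abbreviation deg where "deg s n \<equiv> int n * d s"
abbreviation xp where "xp s n \<equiv> x s [^]\<^bsub>R\<^esub> (n::nat)"
abbreviation w where "w s n \<equiv> signed T (int s + int (s - 1) * int n * d s) (suspA T (- int (s - 1)) (kv s n))"

lemma xp_gr: "s \<in> {1..t} \<Longrightarrow> xp s n \<in> gr R (deg s n)"
  using gr_pow[OF x] .

lemma koszul_triangle:
  assumes "n \<ge> 1" "s \<in> {1..t}"
  shows "(st s n, act (deg s n) (xp s n) (K (s - 1) n), w s n) \<in> Tri T"
  using koszul_triangle_exact[OF tri lin M ko assms xp_gr[OF assms(2)]] by (simp add: koszul_triangle_def)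

lemma K_obj: assumes n: "n \<ge> 1" and s: "s \<le> t" shows "K s n \<in> Obj T" "s \<ge> 1 \<Longrightarrow> Dom T (st s n) = K s n"
proof -
  have "K s n \<in> Obj T \<and> (s \<ge> 1 \<longrightarrow> Dom T (st s n) = K s n)"
  proof (cases s)
    case 0
    then show ?thesis using M ko n by (simp add: koszul_objects_def desusp_koszul_def)
  next
    case (Suc j)
    then have s1: "s \<in> {1..t}" using s by simp
    have c: "Cod T (kv s n) = Kz s n" "(act (deg s n) (xp s n) (Kz (s - 1) n), kv s n, kw s n) \<in> Tri T"
      using ko n s1 by (auto simp: koszul_objects_def)
    then have "kw s n \<in> Arr T" "Dom T (kw s n) = Kz s n" using TriD[OF c(2)] by auto
    then show ?thesis using arr_obj(1)[of "kw s n"] by (simp add: koszul_step_def desusp_koszul_def)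
  qed
  then show "K s n \<in> Obj T" "s \<ge> 1 \<Longrightarrow> Dom T (st s n) = K s n" by auto
qed

lemma K_zero: "n \<ge> 1 \<Longrightarrow> K 0 n = M"
  using ko by (simp add: koszul_objects_def desusp_koszul_def)

lemma koszul_hom:
  assumes n: "n \<ge> 1" and s: "s \<in> {1..t}"
  shows "st s n \<in> Hom T (K s n) (K (s - 1) n)"
    "act (deg s n) (xp s n) (K (s - 1) n) \<in> Hom T (K (s - 1) n) (suspO T (deg s n) (K (s - 1) n))"
    "w s n \<in> Hom T (suspO T (deg s n) (K (s - 1) n)) (SigO T (K s n))"
proof -
  note tr = TriD[OF koszul_triangle[OF n s]]
  have "s - 1 \<le> t" using s by auto
  then have "K (s - 1) n \<in> Obj T" using K_obj(1)[OF n] by blast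
  then show a: "act (deg s n) (xp s n) (K (s - 1) n) \<in> Hom T (K (s - 1) n) (suspO T (deg s n) (K (s - 1) n))"
    using act_hom[OF xp_gr[OF s]] by simp
  have D: "Dom T (st s n) = K s n" using K_obj(2)[OF n, of s] s by simp
  show "st s n \<in> Hom T (K s n) (K (s - 1) n)" using tr(1,4) a D by (simp add: Hom_def)
  show "w s n \<in> Hom T (suspO T (deg s n) (K (s - 1) n)) (SigO T (K s n))" using tr(3,5,6) a D by (simp add: Hom_def)
qed

lemma u_hom: assumes n: "n \<ge> 1" and s: "s \<le> t" shows "u s n \<in> Hom T (K s n) (K s (n + 1))"
proof (cases s)
  case 0
  then show ?thesis using km n M Id_Hom[OF tri M] K_zero by (simp add: koszul_maps_def)
next
  case (Suc j)
  then have s1: "s \<in> {1..t}" using s by simp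
  then show ?thesis
    using km n koszul_hom(1)[OF n s1] koszul_hom(1)[of "n + 1" s]
    by (auto simp: koszul_maps_def triangle_map_def koszul_triangle_def Hom_def)
qed

lemma u_step: assumes n: "n \<ge> 1" and s: "s \<in> {1..t}" shows "st s (n + 1) \<cdot> u s n = u (s - 1) n \<cdot> st s n"
  using km n s by (simp add: koszul_maps_def triangle_map_def koszul_triangle_def)

lemma u_third:
  assumes n: "n \<ge> 1" and s: "s \<in> {1..t}"
  shows "SigA T (u s n) \<cdot> w s n = w s (n + 1) \<cdot>
    (act (d s) (x s) (suspO T (deg s n) (K (s - 1) (n + 1))) \<cdot> suspA T (deg s n) (u (s - 1) n))"
  using km n s unfolding koszul_maps_def triangle_map_def koszul_triangle_def by simp

lemma can_hom: "n \<ge> 1 \<Longrightarrow> s \<le> t \<Longrightarrow> can s n \<in> Hom T (K s n) M"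
proof (induction s)
  case 0
  then show ?case using Id_Hom[OF tri M] K_zero by simp
next
  case (Suc s)
  then show ?case using koszul_hom(1)[of n "Suc s"] by (simp add: Hom_def)
qed

lemma can_u: "n \<ge> 1 \<Longrightarrow> s \<le> t \<Longrightarrow> can s (n + 1) \<cdot> u s n = can s n"
proof (induction s)
  case 0
  then show ?case using km M by (simp add: koszul_maps_def)
next
  case (Suc s)
  have s: "Suc s \<in> {1..t}" using Suc by simp
  have s': "s \<le> t" using Suc by simp
  have st: "st (Suc s) n \<in> Hom T (K (Suc s) n) (K s n)" "st (Suc s) (n + 1) \<in> Hom T (K (Suc s) (n + 1)) (K s (n + 1))"
    using koszul_hom(1)[OF Suc.prems(1) s] koszul_hom(1)[of "n + 1", OF _ s] by auto
  have "(can s (n + 1) \<cdot> st (Suc s) (n + 1)) \<cdot> u (Suc s) n = can s (n + 1) \<cdot> (u s n \<cdot> st (Suc s) n)"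
    using u_step[OF Suc.prems(1) s] can_hom[of "n + 1" s, OF _ s'] st u_hom[OF Suc.prems]
    by (simp add: Hom_def)
  also have "\<dots> = can s n \<cdot> st (Suc s) n"
    by (rule cmp_reduce[OF _ st(1) u_hom[OF Suc.prems(1) s'] can_hom[of "n + 1" s, OF _ s']]) (use Suc s' in auto)
  finally show ?case by simp
qed

abbreviation ktrans where "ktrans s \<equiv> transition (K s) (u s)"

lemma ktrans_hom: assumes "i \<ge> 1" "s \<le> t" shows "ktrans s i k \<in> Hom T (K s i) (K s (i + k))"
  by (rule transition_hom) (use u_hom assms in blast)+

lemma can_ktrans: assumes "i \<ge> 1" "s \<le> t" shows "can s (i + k) \<cdot> ktrans s i k = can s i"
  by (rule transition_cocone[where Y = M]) (use u_hom can_hom can_u assms in blast)+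

lemma step_ktrans:
  assumes "i \<ge> 1" "s \<in> {1..t}" shows "st s (i + k) \<cdot> ktrans s i k = ktrans (s - 1) i k \<cdot> st s i"
  by (rule transition_natural) (use u_hom koszul_hom(1) u_step assms in auto)

lemma ktrans_ktrans: assumes "i \<ge> 1" "s \<le> t" shows "ktrans s (i + k) l \<cdot> ktrans s i k = ktrans s i (k + l)"
  by (rule transition_add) (use u_hom assms in blast)+

definition torsion where
  "torsion X \<longleftrightarrow> X \<in> Obj T \<and> (\<forall>i \<in> {1..t}. nilpotent_on (d i) (x i) X)"

lemma torsion_susp: "torsion X \<Longrightarrow> torsion (suspO T n X)"
  using nilpotent_susp x by (simp add: torsion_def)

text \<open>To lift \<open>f\<close> from $K_{s,j}$ to $K_{s+1,j}$ one needs $x_{s+1}^j f = 0$.  By naturality this is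
  $\Sigma^{n}(f)\, x_{s+1}^j$ with the power acting on \<open>D\<close>, which vanishes for large \<open>j\<close>.\<close>

lemma torsion_lift:
  assumes D: "torsion D" and s: "s \<le> t" and m: "m \<in> Hom T D M"
  obtains j f where "j \<ge> 1" "f \<in> Hom T D (K s j)" "can s j \<cdot> f = m"
proof -
  have "\<exists>j f. j \<ge> 1 \<and> f \<in> Hom T D (K s j) \<and> can s j \<cdot> f = m"
    using s
  proof (induction s)
    case 0
    then show ?case using m K_zero[of 1] by (intro exI[of _ 1] exI[of _ m]) (simp add: Hom_def)
  next
    case (Suc s)
    have s1: "Suc s \<in> {1..t}" and s': "s \<le> t" using Suc.prems by auto
    obtain j f where jf: "j \<ge> 1" "f \<in> Hom T D (K s j)" "can s j \<cdot> f = m" using Suc by auto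
    have Do: "D \<in> Obj T" using D by (simp add: torsion_def)
    obtain N where N: "kills (deg (Suc s) N) (xp (Suc s) N) D"
      using D s1 unfolding torsion_def nilpotent_on_def by blast
    let ?j = "j + N" and ?f = "ktrans s j N \<cdot> f"
    have j1: "?j \<ge> 1" using jf(1) by simp
    have f: "?f \<in> Hom T D (K s ?j)" using ktrans_hom[OF jf(1) s', of N] jf(2) by (simp add: Hom_def)
    have cf: "can s ?j \<cdot> ?f = m"
      using cmp_reduce[OF can_ktrans[OF jf(1) s'] jf(2) ktrans_hom[OF jf(1) s'] can_hom[OF j1 s']] jf(3) by simp
    have "kills (deg (Suc s) ?j) (xp (Suc s) ?j) D"
      by (rule kills_pow_mono[OF x[OF s1] Do N]) simp
    then have "suspA T (deg (Suc s) ?j) ?f \<cdot> act (deg (Suc s) ?j) (xp (Suc s) ?j) D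
        = Zer T D (suspO T (deg (Suc s) ?j) (K s ?j))"
      unfolding kills_def by (simp only: zer_hom[OF susp_hom[OF f] Do])
    then have "act (deg (Suc s) ?j) (xp (Suc s) ?j) (K s ?j) \<cdot> ?f = Zer T D (suspO T (deg (Suc s) ?j) (K s ?j))"
      unfolding act_natural[OF xp_gr[OF s1] f] .
    moreover note tr = koszul_triangle[OF j1 s1] and h = koszul_hom[OF j1 s1]
    ultimately obtain b where b: "b \<in> Hom T D (K (Suc s) ?j)" "st (Suc s) ?j \<cdot> b = ?f"
      using f h(1,2) by (auto intro: weak_kernel[OF tr, of ?f D] simp: Hom_def)
    have "can (Suc s) ?j \<cdot> b = m"
      using b h(1) can_hom[OF j1 s'] cf by (simp add: Hom_def)
    then show ?case using b(1) j1 by blast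
  qed
  then show ?thesis using that by blast
qed

text \<open>A morphism killed by $K_{s,i} \to K_{s-1,i}$ comes from $g\colon \Sigma D \to \Sigma^{i|x_s|}K_{s-1,i}$.  On that term the
  transition maps of the system multiply by $x_s$ once per step, and by naturality all
  these factors collect to a power of $x_s$ on $\Sigma D$, which is eventually zero.\<close>

lemma torsion_step_dies:
  assumes D: "torsion D" and s: "s \<in> {1..t}" and i: "i \<ge> 1" and f: "f \<in> Hom T D (K s i)"
    and z: "st s i \<cdot> f = Zer T D (K (s - 1) i)"
  obtains k where "ktrans s i k \<cdot> f = Zer T D (K s (i + k))"
proof -
  have s': "s \<le> t" "s - 1 \<le> t" using s by auto
  have Do: "D \<in> Obj T" and Do': "SigO T D \<in> Obj T" using D by (auto simp: torsion_def)
  have xs: "x s \<in> gr R (d s)" using x[OF s] .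
  note h = koszul_hom[OF i s] and tr = koszul_triangle[OF i s]
  have sf: "SigA T f \<in> Hom T (SigO T D) (SigO T (K s i))" using f by (simp add: Hom_def)
  have "SigA T (st s i) \<cdot> SigA T f = Zer T (SigO T D) (SigO T (K (s - 1) i))"
    using z f h(1) hom_obj[OF h(1)] Do by (simp add: Hom_def sig_zer flip: sig_cmp)
  then obtain g where g: "g \<in> Hom T (SigO T D) (suspO T (deg s i) (K (s - 1) i))" "w s i \<cdot> g = SigA T f"
    using sf h by (auto intro: weak_kernel3[OF tr, of "SigA T f" "SigO T D"] simp: Hom_def)
  \<comment> \<open>after \<open>k\<close> steps the preimage under \<open>w\<close> has picked up the \<open>k\<close>-th power acting on the source\<close>
  have factor: "\<exists>b. b \<in> Hom T (suspO T (deg s k) (SigO T D)) (suspO T (deg s (i + k)) (K (s - 1) (i + k))) \<and>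
      SigA T (ktrans s i k \<cdot> f) = w s (i + k) \<cdot> (b \<cdot> act (deg s k) (xp s k) (SigO T D))" for k
  proof (induction k)
    case 0
    have "act 0 \<one>\<^bsub>R\<^esub> (SigO T D) = Idn T (SigO T D)" using act_one[OF Do'] .
    moreover have "ktrans s i 0 \<cdot> f = f" using f by (simp add: Hom_def)
    moreover have "g \<cdot> Idn T (SigO T D) = g" using g(1) by (simp add: Hom_def)
    ultimately show ?case using g by (intro exI[of _ g]) simp
  next
    case (Suc k)
    let ?n = "i + k" and ?a = "act (deg s k) (xp s k) (SigO T D)"
    have n: "?n \<ge> 1" and n1: "?n + 1 \<ge> 1" using i by auto
    obtain b where b: "b \<in> Hom T (suspO T (deg s k) (SigO T D)) (suspO T (deg s ?n) (K (s - 1) ?n))"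
      "SigA T (ktrans s i k \<cdot> f) = w s ?n \<cdot> (b \<cdot> ?a)" using Suc by blast
    have a: "?a \<in> Hom T (SigO T D) (suspO T (deg s k) (SigO T D))" using act_hom[OF xp_gr[OF s] Do'] .
    let ?su = "suspA T (deg s ?n) (u (s - 1) ?n)" and ?Z = "suspO T (deg s ?n) (K (s - 1) (?n + 1))"
    have su: "?su \<in> Hom T (suspO T (deg s ?n) (K (s - 1) ?n)) ?Z" using susp_hom[OF u_hom[OF n s'(2)]] .
    have wn: "w s ?n \<in> Hom T (suspO T (deg s ?n) (K (s - 1) ?n)) (SigO T (K s ?n))"
      and wn1: "w s (?n + 1) \<in> Hom T (suspO T (deg s (?n + 1)) (K (s - 1) (?n + 1))) (SigO T (K s (?n + 1)))"
      using koszul_hom(3)[OF n s] koszul_hom(3)[OF n1 s] .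
    have un: "u s ?n \<in> Hom T (K s ?n) (K s (?n + 1))" using u_hom[OF n s'(1)] .
    have Z: "?Z \<in> Obj T" "suspO T (d s) ?Z = suspO T (deg s (?n + 1)) (K (s - 1) (?n + 1))"
      using K_obj(1)[OF n1 s'(2)] by (simp_all add: susp_susp algebra_simps)
    have xZ: "act (d s) (x s) ?Z \<in> Hom T ?Z (suspO T (deg s (?n + 1)) (K (s - 1) (?n + 1)))"
      using act_hom[OF xs Z(1)] Z(2) by simp
    let ?y = "?su \<cdot> b"
    have y: "?y \<in> Hom T (suspO T (deg s k) (SigO T D)) ?Z" using su b(1) by (simp add: Hom_def)
    have tf: "ktrans s i k \<cdot> f \<in> Hom T D (K s ?n)" using ktrans_hom[OF i s'(1), of k] f by (simp add: Hom_def)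
    have ya: "?y \<cdot> ?a \<in> Hom T (SigO T D) ?Z" using y a by (simp add: Hom_def)
    have "SigA T (ktrans s i (Suc k) \<cdot> f) = SigA T (u s ?n) \<cdot> SigA T (ktrans s i k \<cdot> f)"
      using tf un f ktrans_hom[OF i s'(1), of k] sig_cmp[of "ktrans s i k \<cdot> f" "u s ?n"] by (simp add: Hom_def)
    also have "\<dots> = (SigA T (u s ?n) \<cdot> w s ?n) \<cdot> (b \<cdot> ?a)"
      unfolding b(2) using un wn a b(1) by (simp add: Hom_def)
    also have "\<dots> = (w s (?n + 1) \<cdot> (act (d s) (x s) ?Z \<cdot> ?su)) \<cdot> (b \<cdot> ?a)" using u_third[OF n s] by simp
    also have "\<dots> = w s (?n + 1) \<cdot> (act (d s) (x s) ?Z \<cdot> (?y \<cdot> ?a))"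
      using wn1 xZ su a b(1) by (simp add: Hom_def)
    also have "act (d s) (x s) ?Z \<cdot> (?y \<cdot> ?a) = suspA T (d s) (?y \<cdot> ?a) \<cdot> act (d s) (x s) (SigO T D)"
      using act_natural[OF xs ya] .
    also have "\<dots> = suspA T (d s) ?y \<cdot> (suspA T (d s) ?a \<cdot> act (d s) (x s) (SigO T D))"
      using y a act_hom[OF xs Do'] susp_cmp[of ?a ?y "d s"] by (simp add: Hom_def)
    also have "suspA T (d s) ?a \<cdot> act (d s) (x s) (SigO T D) = act (deg s (Suc k)) (xp s (Suc k)) (SigO T D)"
      using act_mult[OF xp_gr[OF s] xs Do', of k] by (simp add: algebra_simps)
    finally have e: "SigA T (ktrans s i (Suc k) \<cdot> f) = w s (?n + 1) \<cdot> (suspA T (d s) ?y \<cdot> act (deg s (Suc k)) (xp s (Suc k)) (SigO T D))" .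
    have "suspA T (d s) ?y \<in> Hom T (suspO T (deg s (Suc k)) (SigO T D)) (suspO T (deg s (?n + 1)) (K (s - 1) (?n + 1)))"
      using susp_hom[OF y, of "d s"] Z(2) Do' by (simp add: susp_susp algebra_simps)
    then show ?case using e by (intro exI[of _ "suspA T (d s) ?y"]) simp
  qed
  obtain N where N: "kills (deg s N) (xp s N) D"
    using D s unfolding torsion_def nilpotent_on_def by blast
  then have N': "kills (deg s N) (xp s N) (SigO T D)" using kills_susp[OF xp_gr[OF s] Do, of N 1] by (simp add: susp_1)
  have iN: "i + N \<ge> 1" using i by simp
  obtain b where b: "b \<in> Hom T (suspO T (deg s N) (SigO T D)) (suspO T (deg s (i + N)) (K (s - 1) (i + N)))"
      "SigA T (ktrans s i N \<cdot> f) = w s (i + N) \<cdot> (b \<cdot> act (deg s N) (xp s N) (SigO T D))" using factor by blast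
  have tf: "ktrans s i N \<cdot> f \<in> Hom T D (K s (i + N))" using ktrans_hom[OF i s'(1), of N] f by (simp add: Hom_def)
  have "b \<cdot> act (deg s N) (xp s N) (SigO T D) = Zer T (SigO T D) (suspO T (deg s (i + N)) (K (s - 1) (i + N)))"
    using N' zer_hom[OF b(1) Do'] by (simp add: kills_def)
  then have "SigA T (ktrans s i N \<cdot> f) = Zer T (SigO T D) (SigO T (K s (i + N)))"
    using b(2) zer_hom[OF koszul_hom(3)[OF iN s] Do'] by simp
  then have "SigA T (ktrans s i N \<cdot> f) = SigA T (Zer T D (K s (i + N)))"
    using Do hom_obj(2)[OF tf] by (simp add: sig_zer)
  then have "ktrans s i N \<cdot> f = Zer T D (K s (i + N))"
    using sig_inj(2)[of "ktrans s i N \<cdot> f" "Zer T D (K s (i + N))"] tf Do hom_obj(2)[OF tf] by (simp add: Hom_def)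
  then show ?thesis using that by blast
qed

text \<open>Together with lifting, this says that $\mathrm{colim}_n \mathrm{Hom}(D, K_{s,n}) \to \mathrm{Hom}(D, M)$ is bijective for torsion
  objects \<open>D\<close>.\<close>

lemma torsion_dies:
  assumes D: "torsion D" and s: "s \<le> t" and i: "i \<ge> 1" and f: "f \<in> Hom T D (K s i)"
    and z: "can s i \<cdot> f = Zer T D M"
  obtains k where "ktrans s i k \<cdot> f = Zer T D (K s (i + k))"
proof -
  have "\<exists>k. ktrans s i k \<cdot> f = Zer T D (K s (i + k))"
    using s i f z
  proof (induction s arbitrary: i f)
    case 0
    then show ?case using K_zero by (intro exI[of _ 0]) (simp add: Hom_def)
  next
    case (Suc s)
    have s1: "Suc s \<in> {1..t}" and s': "s \<le> t" using Suc.prems by auto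
    have Do: "D \<in> Obj T" using D by (simp add: torsion_def)
    note i = Suc.prems(2) and f = Suc.prems(3)
    have stp: "st (Suc s) i \<in> Hom T (K (Suc s) i) (K s i)" using koszul_hom(1)[OF i s1] by simp
    let ?g = "st (Suc s) i \<cdot> f"
    have g: "?g \<in> Hom T D (K s i)" using stp f by (simp add: Hom_def)
    have "can s i \<cdot> ?g = Zer T D M" using Suc.prems(4) stp f can_hom[OF i s'] by (simp add: Hom_def)
    then obtain k where k: "ktrans s i k \<cdot> ?g = Zer T D (K s (i + k))" using Suc.IH[OF s' i g] by blast
    let ?f = "ktrans (Suc s) i k \<cdot> f"
    have ik: "i + k \<ge> 1" using i by simp
    have tw: "ktrans (Suc s) i k \<in> Hom T (K (Suc s) i) (K (Suc s) (i + k))" using ktrans_hom[OF i Suc.prems(1)] .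
    have f': "?f \<in> Hom T D (K (Suc s) (i + k))" using tw f by (simp add: Hom_def)
    have stp': "st (Suc s) (i + k) \<in> Hom T (K (Suc s) (i + k)) (K s (i + k))" using koszul_hom(1)[OF ik s1] by simp
    have "st (Suc s) (i + k) \<cdot> ?f = (ktrans s i k \<cdot> st (Suc s) i) \<cdot> f"
      by (rule cmp_reduce[OF _ f tw stp']) (use step_ktrans[OF i s1] in simp)
    also have "\<dots> = ktrans s i k \<cdot> ?g" using ktrans_hom[OF i s'] stp f by (simp add: Hom_def)
    finally have "st (Suc s) (i + k) \<cdot> ?f = Zer T D (K (Suc s - 1) (i + k))" using k by simp
    then obtain l where l: "ktrans (Suc s) (i + k) l \<cdot> ?f = Zer T D (K (Suc s) (i + k + l))"
      using torsion_step_dies[OF D s1 ik f'] by blast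
    have "ktrans (Suc s) (i + k) l \<cdot> ?f = ktrans (Suc s) i (k + l) \<cdot> f"
      by (rule cmp_reduce[OF ktrans_ktrans[OF i Suc.prems(1)] f tw ktrans_hom[OF ik Suc.prems(1)]])
    then show ?case using l by (intro exI[of _ "k + l"]) (simp add: add.assoc)
  qed
  then show ?thesis using that by blast
qed

text \<open>The suspension of $K_{s,n}$ is a cone of the action of $x_s^n$ on $K_{s-1,n}$.\<close>

lemma nilpotent_K:
  assumes n: "n \<ge> 1" shows "s \<le> t \<Longrightarrow> i \<in> {1..s} \<Longrightarrow> nilpotent_on (d i) (x i) (K s n)"
proof (induction s)
  case (Suc s)
  have s1: "Suc s \<in> {1..t}" and i1: "i \<in> {1..t}" and s': "s \<le> t" using Suc.prems by auto
  note tr = Tri_rotate[OF koszul_triangle[OF n s1]]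
  note h = koszul_hom[OF n s1]
  have o: "K s n \<in> Obj T" "K (Suc s) n \<in> Obj T" using K_obj(1)[OF n] Suc.prems(1) s' by auto
  have "nilpotent_on (d i) (x i) (Cod T (w (Suc s) n))"
  proof (cases "i = Suc s")
    case True
    show ?thesis unfolding True
      by (rule nilpotent_self_cone[OF x[OF s1], of "K (Suc s - 1) n"]) (use o tr in simp_all)
  next
    case False
    then have "nilpotent_on (d i) (x i) (K s n)" using Suc by simp
    then show ?thesis
      using nilpotent_cone[OF tr x[OF i1]] nilpotent_susp[OF x[OF i1] o(1)] h(2,3) by (simp add: Hom_def)
  qed
  then have "nilpotent_on (d i) (x i) (suspO T 1 (K (Suc s) n))" using h(3) by (simp add: Hom_def susp_1)
  then show ?case using nilpotent_susp[OF x[OF i1] o(2)] by simp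
qed simp


section \<open>Comparison with local cohomology\<close>

definition torsion_compact :: "'u itself \<Rightarrow> 'o set" where
  "torsion_compact U = {D. compact U T D \<and> torsion D}"

abbreviation supp :: "'u itself \<Rightarrow> 'o set" where
  "supp U \<equiv> supported_subcategory U T R act (closed_set R (Idl\<^bsub>R\<^esub> (x ` {1..t})))"

text \<open>The primes are eliminated from the description of the local cohomology subcategory here.\<close>

lemma supp_eq:
  fixes U :: "'u itself"
  shows "supp U = localizing_generated_by U T (torsion_compact U)"
proof -
  have "{D. compact U T D \<and> (\<forall>p \<in> Spec R - closed_set R (Idl\<^bsub>R\<^esub> (x ` {1..t})). End_localization_zero T R act D p)} = torsion_compact U"
    using supported_iff_nilpotent[of t x d, OF x] compact_obj unfolding torsion_compact_def torsion_def by blast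
  then show ?thesis unfolding supported_subcategory_def by simp
qed

lemma torsion_compact_obj: "torsion_compact U \<subseteq> Obj T"
  by (auto simp: torsion_compact_def torsion_def)

lemma torsion_compact_susp:
  fixes U :: "'u itself"
  shows "D \<in> torsion_compact U \<Longrightarrow> suspO T n D \<in> torsion_compact U"
  using compact_susp torsion_susp by (auto simp: torsion_compact_def)

lemma supp_localizing:
  fixes U :: "'u itself"
  shows "localizing U T (supp U)" "torsion_compact U \<subseteq> supp U"
  unfolding supp_eq using localizing_generated[OF torsion_compact_obj] by blast+

lemma supp_orthogonal:
  fixes U :: "'u itself"
  assumes "Y \<in> Obj T" "\<And>D. D \<in> torsion_compact U \<Longrightarrow> orthogonal D Y" "X \<in> supp U"
  shows "orthogonal X Y"
  using generated_left_orthogonal[OF torsion_compact_obj torsion_compact_susp, of U Y X] assms unfolding supp_eq by blast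

text \<open>The localization \<open>Y\<close> of the Koszul object inherits nilpotence of the \<open>x i\<close>: $x_i^N$ vanishes after
  composition with the unit, so on \<open>Y\<close> it factors through an object of the subcategory, and
  there are no nonzero maps from there to a suspension of \<open>Y\<close>.  Then \<open>Y\<close> is orthogonal to all
  compact objects, hence zero.\<close>

lemma koszul_supported:
  fixes U :: "'u itself"
  assumes cg: "compactly_generated U T" and c: "coreflection T (supp U) \<Gamma> \<epsilon>"
    and \<eta>: "\<And>N. N \<in> Obj T \<Longrightarrow> (\<epsilon> N, \<eta> N, \<delta> N) \<in> Tri T" and n: "n \<ge> 1"
  shows "K t n \<in> supp U"
proof -
  let ?X = "K t n"
  have X: "?X \<in> Obj T" using K_obj(1)[OF n] by simp
  note tr = \<eta>[OF X]
  note dd = TriD[OF tr]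
  let ?G = "onO \<Gamma> ?X" and ?Y = "Cod T (\<eta> ?X)"
  note G = coreflectionD(1)[OF c X] and e = coreflectionD(2)[OF c X]
  have Y: "?Y \<in> Obj T" using dd by simp
  have eta: "\<eta> ?X \<in> Hom T ?X ?Y" using dd e by (simp add: Hom_def)
  have oG: "orthogonal Z ?Y" if "Z \<in> supp U" for Z
    using coreflection_orthogonal[OF supp_localizing(1) c that X tr] .
  have nY: "nilpotent_on (d i) (x i) ?Y" if i: "i \<in> {1..t}" for i
  proof -
    obtain N :: nat where N: "kills (deg i N) (xp i N) ?X"
      using nilpotent_K[OF n order_refl] i unfolding nilpotent_on_def by blast
    have a: "act (deg i N) (xp i N) ?Y \<in> Hom T ?Y (suspO T (deg i N) ?Y)" using act_hom[OF xp_gr[OF i] Y] .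
    have "act (deg i N) (xp i N) ?Y \<cdot> \<eta> ?X = Zer T ?X (suspO T (deg i N) ?Y)"
      unfolding act_natural[OF xp_gr[OF i] eta]
      using N zer_hom[OF susp_hom[OF eta] X] by (simp add: kills_def)
    then obtain b where b: "b \<in> Hom T (SigO T ?G) (suspO T (deg i N) ?Y)" "b \<cdot> \<delta> ?X = act (deg i N) (xp i N) ?Y"
      using weak_cokernel2[OF tr, of "act (deg i N) (xp i N) ?Y" "suspO T (deg i N) ?Y"] a dd e eta by (auto simp: Hom_def)
    have Go: "?G \<in> Obj T" using hom_obj(1)[OF e] .
    have "orthogonal (suspO T (1 - deg i N) ?G) ?Y" using oG localizing_susp[OF supp_localizing(1) G] by blast
    then have "orthogonal (SigO T ?G) (suspO T (deg i N) ?Y)"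
      using orthogonal_susp[of "suspO T (1 - deg i N) ?G" ?Y "deg i N"] Go Y by (simp add: susp_susp susp_1)
    then have "b = Zer T (SigO T ?G) (suspO T (deg i N) ?Y)" using b(1) by (simp add: orthogonal_def)
    then have "kills (deg i N) (xp i N) ?Y" using b(2) dd e Y by (simp add: kills_def Hom_def)
    then show ?thesis unfolding nilpotent_on_def by blast
  qed
  have "zero_object T ?Y"
  proof (rule zero_object_if_compact_orthogonal[OF cg Y])
    fix C assume C: "compact U T C"
    show "orthogonal C ?Y"
    proof (rule orthogonal_compact_if_nilpotent[OF x Y nY _ C])
      fix D assume D: "compact U T D" "\<And>i. i \<in> {1..t} \<Longrightarrow> nilpotent_on (d i) (x i) D"
      then have "D \<in> torsion_compact U" using compact_obj by (auto simp: torsion_compact_def torsion_def)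
      then show "orthogonal D ?Y" using oG supp_localizing(2) by blast
    qed
  qed
  then have "?Y \<in> supp U" using supp_localizing(1)[of U] by (auto simp: localizing_def)
  then show ?thesis using localizing_cone(2)[OF supp_localizing(1) tr] G e eta by (simp add: Hom_def)
qed

text \<open>Morphisms from \<open>D\<close> to the homotopy colimit are represented at a finite stage, so the comparison with \<open>M\<close> is
  bijective on them by the colimit statements for the Koszul system.\<close>

lemma koszul_hocolim_cone_orthogonal:
  assumes un: "uncountable (UNIV :: 'u set)" and h: "hocolim T (K t) (u t) H \<iota>"
    and \<alpha>: "\<alpha> \<in> Hom T H M" "\<And>l. l \<ge> 1 \<Longrightarrow> \<alpha> \<cdot> \<iota> l = can t l" and tr: "(\<alpha>, g, k) \<in> Tri T"
    and D: "D \<in> torsion_compact TYPE('u)"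
  shows "orthogonal D (Cod T g)"
  unfolding orthogonal_def
proof
  note dd = TriD[OF tr]
  have gh: "g \<in> Hom T M (Cod T g)" using dd \<alpha>(1) by (simp add: Hom_def)
  have uh: "u t n \<in> Hom T (K t n) (K t (n + 1))" if "n \<ge> 1" for n using u_hom[OF that] by simp
  have inc: "\<iota> n \<in> Hom T (K t n) H" "\<iota> (n + 1) \<cdot> u t n = \<iota> n" if "n \<ge> 1" for n
    using hocolim_inc[OF h uh that] by auto
  have Do: "D \<in> Obj T" and Dt: "torsion D" using D by (auto simp: torsion_compact_def torsion_def)
  have Ho: "H \<in> Obj T" using hom_obj(1)[OF \<alpha>(1)] .
  have mono: "b = Zer T D' H" if D': "D' \<in> torsion_compact TYPE('u)" and b: "b \<in> Hom T D' H" "\<alpha> \<cdot> b = Zer T D' M" for D' b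
  proof -
    have cD: "compact TYPE('u) T D'" and tD: "torsion D'" using D' by (auto simp: torsion_compact_def)
    obtain N \<phi> where N: "N \<ge> 1" "\<phi> \<in> Hom T D' (K t N)" "b = \<iota> N \<cdot> \<phi>"
      using hocolim_compact_factor[OF un h uh cD b(1)] by metis
    have "can t N \<cdot> \<phi> = Zer T D' M"
      using cmp_reduce[OF \<alpha>(2)[OF N(1)] N(2) inc(1)[OF N(1)] \<alpha>(1)] b(2) N(3) by simp
    then obtain j where j: "ktrans t N j \<cdot> \<phi> = Zer T D' (K t (N + j))"
      using torsion_dies[OF tD order_refl N(1,2)] by blast
    have Nj: "N + j \<ge> 1" using N(1) by simp
    have "\<iota> (N + j) \<cdot> ktrans t N j = \<iota> N"
      by (rule transition_cocone) (use uh inc N(1) in blast)+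
    then have "\<iota> (N + j) \<cdot> (ktrans t N j \<cdot> \<phi>) = b"
      using cmp_reduce[OF _ N(2) ktrans_hom[OF N(1) order_refl] inc(1)[OF Nj]] N(3) by simp
    then show ?thesis using j zer_hom[OF inc(1)[OF Nj]] hom_obj(1)[OF b(1)] by simp
  qed
  fix f assume f: "f \<in> Hom T D (Cod T g)"
  obtain m where m: "m \<in> Hom T D M" "g \<cdot> m = f"
    by (rule lift_to_middle[OF tr \<alpha>(1) gh f]) (use mono[OF torsion_compact_susp[OF D]] in blast)+
  obtain j \<phi> where j: "j \<ge> 1" "\<phi> \<in> Hom T D (K t j)" "can t j \<cdot> \<phi> = m"
    using torsion_lift[OF Dt order_refl m(1)] by metis
  have ij: "\<iota> j \<cdot> \<phi> \<in> Hom T D H" using inc(1)[OF j(1)] j(2) by (simp add: Hom_def)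
  have "\<alpha> \<cdot> (\<iota> j \<cdot> \<phi>) = m" using cmp_reduce[OF \<alpha>(2)[OF j(1)] j(2) inc(1)[OF j(1)] \<alpha>(1)] j(3) by simp
  moreover have "g \<cdot> (\<alpha> \<cdot> (\<iota> j \<cdot> \<phi>)) = Zer T H (Cod T g) \<cdot> (\<iota> j \<cdot> \<phi>)"
    by (rule cmp_reduce[OF _ ij \<alpha>(1)]) (use Tri_cmp[OF tr] dd \<alpha>(1) in \<open>simp_all add: Hom_def\<close>)
  ultimately show "f = Zer T D (Cod T g)" using m(2) hom_zer[OF ij] dd by simp
qed

context
  fixes V :: "nat \<Rightarrow> 'o" and p q v :: "nat \<Rightarrow> 'm" and HV :: 'o and \<iota> :: "nat \<Rightarrow> 'm"
  assumes cs: "cone_system T M (can t) (u t) V p q v" and hV: "hocolim T V v HV \<iota>"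
begin

lemma cone_hom:
  assumes n: "n \<ge> 1"
  shows "(can t n, p n, q n) \<in> Tri T" "p n \<in> Hom T M (V n)" "q n \<in> Hom T (V n) (SigO T (K t n))"
    "v n \<in> Hom T (V n) (V (n + 1))" "v n \<cdot> p n = p (n + 1)" "q (n + 1) \<cdot> v n = SigA T (u t n) \<cdot> q n"
proof -
  have t: "(can t n, p n, q n) \<in> Tri T" "(can t (n + 1), p (n + 1), q (n + 1)) \<in> Tri T"
    "Cod T (p n) = V n" "Cod T (p (n + 1)) = V (n + 1)"
    "triangle_map T (can t n, p n, q n) (can t (n + 1), p (n + 1), q (n + 1)) (u t n) (Idn T M) (v n)"
    using cs n unfolding cone_system_def by auto
  show "(can t n, p n, q n) \<in> Tri T" by (rule t)
  note c = can_hom[OF n order_refl] can_hom[of "n + 1" t, OF _ order_refl]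
  note d1 = TriD[OF t(1)] and d2 = TriD[OF t(2)]
  show "p n \<in> Hom T M (V n)" "q n \<in> Hom T (V n) (SigO T (K t n))" "v n \<in> Hom T (V n) (V (n + 1))"
    using d1 d2 t(3-5) c(1) by (auto simp: Hom_def triangle_map_def)
  show "v n \<cdot> p n = p (n + 1)" "q (n + 1) \<cdot> v n = SigA T (u t n) \<cdot> q n"
    using t(5) d2 c(2) by (auto simp: Hom_def triangle_map_def)
qed

text \<open>The maps $M \to V_n$ are compatible with the maps \<open>v n\<close>, because these extend the identity of \<open>M\<close>.\<close>

lemma cone_hocolim_unit:
  assumes "n \<ge> 1" shows "\<iota> n \<in> Hom T (V n) HV" "\<iota> (n + 1) \<cdot> v n = \<iota> n" "\<iota> n \<cdot> p n = \<iota> 1 \<cdot> p 1"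
proof -
  have inc: "\<iota> n \<in> Hom T (V n) HV" "\<iota> (n + 1) \<cdot> v n = \<iota> n" if "n \<ge> 1" for n
    using hocolim_inc[OF hV cone_hom(4) that] by auto
  show "\<iota> n \<in> Hom T (V n) HV" "\<iota> (n + 1) \<cdot> v n = \<iota> n" using inc[OF assms] by auto
  show "\<iota> n \<cdot> p n = \<iota> 1 \<cdot> p 1"
    using assms
  proof (induction n rule: dec_induct)
    case (step n)
    have n: "n \<ge> 1" "n + 1 \<ge> 1" using step by auto
    have "\<iota> (n + 1) \<cdot> (v n \<cdot> p n) = \<iota> n \<cdot> p n"
      by (rule cmp_reduce[OF inc(2)[OF n(1)] cone_hom(2)[OF n(1)] cone_hom(4)[OF n(1)] inc(1)[OF n(2)]])
    then show ?case using cone_hom(5)[OF n(1)] step by simp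
  qed simp
qed

text \<open>A morphism $D \to V_N$ has a connecting part in $\Sigma K_{t,N}$ whose image in $\Sigma M$ vanishes.  So this part dies at a
  later stage, and there the morphism comes from some $m\colon D \to M$.  But \<open>m\<close> lifts to some
  $K_{t,l}$, and $K_{t,l} \to M \to V_l$ is zero.\<close>

lemma cone_hocolim_orthogonal:
  assumes un: "uncountable (UNIV :: 'u set)" and D: "D \<in> torsion_compact TYPE('u)"
  shows "orthogonal D HV"
  unfolding orthogonal_def
proof
  fix f assume f: "f \<in> Hom T D HV"
  have cD: "compact TYPE('u) T D" and Do: "D \<in> Obj T" and Dt: "torsion D"
    using D by (auto simp: torsion_compact_def torsion_def)
  obtain N \<phi> where N: "N \<ge> 1" "\<phi> \<in> Hom T D (V N)" "f = \<iota> N \<cdot> \<phi>"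
    using hocolim_compact_factor[OF un hV cone_hom(4) cD f] by metis
  note c = can_hom[OF N(1) order_refl]
  let ?D = "suspO T (- 1) D"
  have Ko: "K t N \<in> Obj T" using hom_obj(1)[OF c] .
  have sD: "SigO T ?D = D" using Do by (simp add: susp_susp flip: susp_1)
  obtain b where b: "b \<in> Hom T ?D (K t N)" and sb: "SigA T b = q N \<cdot> \<phi>" and cb: "can t N \<cdot> b = Zer T ?D M"
    by (rule desuspended_connecting[OF cone_hom(1)[OF N(1)] c cone_hom(2)[OF N(1)] N(2)])
  obtain j where j: "ktrans t N j \<cdot> b = Zer T ?D (K t (N + j))"
    using torsion_dies[OF torsion_susp[OF Dt] order_refl N(1) b cb] by blast
  have Nj: "N + j \<ge> 1" using N(1) by simp
  let ?tV = "transition V v N j"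
  have tV: "?tV \<in> Hom T (V N) (V (N + j))" by (rule transition_hom) (use cone_hom(4) N(1) in blast)+
  have tK: "ktrans t N j \<in> Hom T (K t N) (K t (N + j))" using ktrans_hom[OF N(1) order_refl] .
  \<comment> \<open>the maps \<open>q n\<close> are compatible with the suspended transition maps of the Koszul system\<close>
  have tsK: "q (N + j) \<cdot> ?tV = transition (\<lambda>n. SigO T (K t n)) (\<lambda>n. SigA T (u t n)) N j \<cdot> q N"
    by (rule transition_natural) (use cone_hom u_hom N(1) in \<open>auto simp: Hom_def\<close>)
  have "transition (\<lambda>n. SigO T (K t n)) (\<lambda>n. SigA T (u t n)) N j = SigA T (ktrans t N j)"
  proof (induction j)
    case 0
    then show ?case using Ko by (simp add: Sig_Id[OF tri])
  next
    case (Suc j)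
    then show ?case
      using ktrans_hom[OF N(1) order_refl, of j] u_hom[of "N + j" t] N(1) by (simp add: sig_cmp Hom_def)
  qed
  then have "(q (N + j) \<cdot> ?tV) \<cdot> \<phi> = SigA T (ktrans t N j) \<cdot> (q N \<cdot> \<phi>)"
    unfolding tsK using tK cone_hom(3)[OF N(1)] N(2) by (simp add: Hom_def)
  also have "\<dots> = SigA T (ktrans t N j \<cdot> b)" using sb tK b by (simp add: sig_cmp Hom_def)
  also have "\<dots> = Zer T D (SigO T (K t (N + j)))" using j sD Do hom_obj(2)[OF tK] by (simp add: sig_zer)
  finally have "q (N + j) \<cdot> (?tV \<cdot> \<phi>) = Zer T D (SigO T (K t (N + j)))"
    using cone_hom(3)[OF Nj] tV N(2) by (simp add: Hom_def)
  moreover have vf: "?tV \<cdot> \<phi> \<in> Hom T D (V (N + j))" using tV N(2) by (simp add: Hom_def)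
  moreover note ch = cone_hom[OF Nj]
  ultimately obtain m where m: "m \<in> Hom T D M" "p (N + j) \<cdot> m = ?tV \<cdot> \<phi>"
    by (auto intro: weak_kernel2[OF ch(1), of "?tV \<cdot> \<phi>" D] simp: Hom_def)
  obtain l \<chi> where l: "l \<ge> 1" "\<chi> \<in> Hom T D (K t l)" "can t l \<cdot> \<chi> = m"
    using torsion_lift[OF Dt order_refl m(1)] by metis
  note io = cone_hocolim_unit
  have "\<iota> (N + j) \<cdot> ?tV = \<iota> N"
    by (rule transition_cocone) (use cone_hom(4) io(1,2) N(1) in blast)+
  then have "f = \<iota> (N + j) \<cdot> (?tV \<cdot> \<phi>)"
    using cmp_reduce[OF _ N(2) tV io(1)[OF Nj]] N(3) by simp
  also have "\<dots> = (\<iota> (N + j) \<cdot> p (N + j)) \<cdot> m"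
    unfolding m(2)[symmetric] using io(1)[OF Nj] ch(2) m(1) by (simp add: Hom_def)
  also have "\<iota> (N + j) \<cdot> p (N + j) = \<iota> l \<cdot> p l" using io(3)[OF Nj] io(3)[OF l(1)] by simp
  also have "(\<iota> l \<cdot> p l) \<cdot> m = \<iota> l \<cdot> (p l \<cdot> (can t l \<cdot> \<chi>))"
    unfolding l(3) using io(1)[OF l(1)] cone_hom(2)[OF l(1)] m(1) by (simp add: Hom_def)
  also have "p l \<cdot> (can t l \<cdot> \<chi>) = Zer T (K t l) (V l) \<cdot> \<chi>"
    by (rule cmp_reduce[OF _ l(2) can_hom[OF l(1) order_refl] cone_hom(2)[OF l(1)]])
      (use Tri_cmp[OF cone_hom(1)[OF l(1)]] cone_hom(2)[OF l(1)] can_hom[OF l(1) order_refl] in \<open>simp add: Hom_def\<close>)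
  also have "\<iota> l \<cdot> (Zer T (K t l) (V l) \<cdot> \<chi>) = Zer T D HV"
    using hom_zer[OF l(2) hom_obj(2)[OF cone_hom(2)[OF l(1)]]] zer_hom[OF io(1)[OF l(1)] Do] by simp
  finally show "f = Zer T D HV" .
qed

text \<open>The comparison $\gamma\colon LM \to \mathrm{hocolim}\,V_n$ has a left inverse \<open>\<beta>\<close>, and \<open>\<gamma> \<cdot> \<beta>\<close> fixes the
  canonical morphism from each $V_l$, because the two agree on \<open>M\<close> and there are no nonzero
  morphisms from $\Sigma K_{t,l}$ to the homotopy colimit.  This does not yet make \<open>\<gamma> \<cdot> \<beta>\<close> the
  identity, since morphisms out of a homotopy colimit are not determined by their restrictions
  to the stages.  But every morphism from a compact object to the homotopy colimit comes from
  some $V_l$, so it lies in the image of \<open>\<gamma>\<close>, and the cone of \<open>\<gamma>\<close> is orthogonal to all compact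
  objects.\<close>

lemma cone_hocolim_iso:
  assumes un: "uncountable (UNIV :: 'u set)" and cg: "compactly_generated TYPE('u) T"
    and c: "coreflection T (supp TYPE('u)) \<Gamma> \<epsilon>"
    and \<eta>: "\<And>N. N \<in> Obj T \<Longrightarrow> (\<epsilon> N, \<eta> N, \<delta> N) \<in> Tri T"
  obtains \<phi> where "isomorphism T HV (Cod T (\<eta> M)) \<phi>" "\<And>l. l \<ge> 1 \<Longrightarrow> \<phi> \<cdot> (\<iota> l \<cdot> p l) = \<eta> M"
proof -
  note S = supp_localizing(1)[of "TYPE('u)"]
  note tr = \<eta>[OF M] and io = cone_hocolim_unit
  note dd = TriD[OF tr]
  let ?L = "Cod T (\<eta> M)" and ?G = "onO \<Gamma> M"
  note G = coreflectionD(1)[OF c M] and e = coreflectionD(2)[OF c M]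
  have eta: "\<eta> M \<in> Hom T M ?L" using dd e by (simp add: Hom_def)
  have Lo: "?L \<in> Obj T" and Ho: "HV \<in> Obj T" using hom_obj(2)[OF eta] hom_obj(2)[OF io(1)[of 1]] by auto
  have oL: "orthogonal X ?L" if "X \<in> supp TYPE('u)" for X
    using coreflection_orthogonal[OF S c that M tr] .
  have oH: "orthogonal X HV" if "X \<in> supp TYPE('u)" for X
    by (rule supp_orthogonal[OF Ho cone_hocolim_orthogonal[OF un] that])
  have KS: "K t n \<in> supp TYPE('u)" if "n \<ge> 1" for n by (rule koszul_supported[OF cg c \<eta> that])
  have sig: "SigO T X \<in> supp TYPE('u)" if "X \<in> supp TYPE('u)" for X
    using localizing_susp[OF S that, of 1] by (simp add: susp_1)
  let ?r = "\<iota> 1 \<cdot> p 1"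
  have r: "?r \<in> Hom T M HV" using io(1)[of 1] cone_hom(2)[of 1] by (simp add: Hom_def)
  have "?r \<cdot> \<epsilon> M = Zer T ?G HV" using oH[OF G] r e by (simp add: orthogonal_def Hom_def)
  then obtain \<gamma> where \<gamma>: "\<gamma> \<in> Hom T ?L HV" "\<gamma> \<cdot> \<eta> M = ?r"
    using r e dd by (auto intro: weak_cokernel[OF tr, of ?r HV] simp: Hom_def)
  have "\<exists>b. b \<in> Hom T (V n) ?L \<and> b \<cdot> p n = \<eta> M" if n: "n \<ge> 1" for n
  proof -
    have "\<eta> M \<cdot> can t n = Zer T (K t n) ?L"
      using oL[OF KS[OF n]] eta can_hom[OF n order_refl] by (simp add: orthogonal_def Hom_def)
    moreover have "Dom T (can t n) = K t n" "Dom T (p n) = M" "Cod T (p n) = V n"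
      using can_hom[OF n order_refl] cone_hom(2)[OF n] by (auto simp: Hom_def)
    ultimately show ?thesis using weak_cokernel[OF cone_hom(1)[OF n], of "\<eta> M" ?L] eta by metis
  qed
  then obtain b where b: "\<And>n. n \<ge> 1 \<Longrightarrow> b n \<in> Hom T (V n) ?L" "\<And>n. n \<ge> 1 \<Longrightarrow> b n \<cdot> p n = \<eta> M" by metis
  have unique: "a = a'"
    if "n \<ge> 1" "a \<in> Hom T (V n) W" "a' \<in> Hom T (V n) W" "a \<cdot> p n = a' \<cdot> p n" "orthogonal (SigO T (K t n)) W" for a a' n W
    by (rule unique_extension[OF cone_hom(1)[OF that(1)]])
      (use that cone_hom(2)[OF that(1)] can_hom[OF that(1) order_refl] in \<open>simp_all add: Hom_def\<close>)
  have bv: "b (n + 1) \<cdot> v n = b n" if n: "n \<ge> 1" for n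
  proof (rule unique[OF n _ b(1)[OF n]])
    have n1: "n + 1 \<ge> 1" by simp
    show "b (n + 1) \<cdot> v n \<in> Hom T (V n) ?L" using b(1)[OF n1] cone_hom(4)[OF n] by (simp add: Hom_def)
    have "(b (n + 1) \<cdot> v n) \<cdot> p n = b (n + 1) \<cdot> (v n \<cdot> p n)"
      using b(1)[OF n1] cone_hom(4)[OF n] cone_hom(2)[OF n] by (simp add: Hom_def)
    then show "(b (n + 1) \<cdot> v n) \<cdot> p n = b n \<cdot> p n" using b(2)[OF n] b(2)[OF n1] cone_hom(5)[OF n] by simp
    show "orthogonal (SigO T (K t n)) ?L" using oL[OF sig[OF KS[OF n]]] .
  qed
  obtain \<beta> where \<beta>: "\<beta> \<in> Hom T HV ?L" "\<And>l. l \<ge> 1 \<Longrightarrow> \<beta> \<cdot> \<iota> l = b l"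
    by (rule hocolim_out[OF hV cone_hom(4) Lo, of b]) (use b(1) bv in auto)
  have \<beta>p: "\<beta> \<cdot> (\<iota> l \<cdot> p l) = \<eta> M" if "l \<ge> 1" for l
    using cmp_reduce[OF \<beta>(2)[OF that] cone_hom(2)[OF that] io(1)[OF that] \<beta>(1)] b(2)[OF that] by simp
  have bg: "\<beta> \<cdot> \<gamma> = Idn T ?L"
  proof (rule unique_extension[OF tr])
    show "\<beta> \<cdot> \<gamma> \<in> Hom T ?L ?L" "Idn T ?L \<in> Hom T ?L ?L" using \<beta> \<gamma> Lo by (simp_all add: Hom_def)
    have "(\<beta> \<cdot> \<gamma>) \<cdot> \<eta> M = \<beta> \<cdot> ?r" using \<beta>(1) \<gamma> eta by (simp add: Hom_def)
    then show "(\<beta> \<cdot> \<gamma>) \<cdot> \<eta> M = Idn T ?L \<cdot> \<eta> M" using \<beta>p[of 1] eta by (simp add: Hom_def)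
    show "orthogonal (SigO T (Dom T (\<epsilon> M))) ?L" using oL[OF sig[OF G]] e by (simp add: Hom_def)
  qed
  have gb: "\<gamma> \<cdot> (\<beta> \<cdot> \<iota> l) = \<iota> l" if l: "l \<ge> 1" for l
  proof (rule unique[OF l])
    show "\<gamma> \<cdot> (\<beta> \<cdot> \<iota> l) \<in> Hom T (V l) HV" using \<gamma>(1) \<beta>(1) io(1)[OF l] by (simp add: Hom_def)
    show "\<iota> l \<in> Hom T (V l) HV" using io(1)[OF l] .
    have "(\<gamma> \<cdot> (\<beta> \<cdot> \<iota> l)) \<cdot> p l = \<gamma> \<cdot> (\<beta> \<cdot> (\<iota> l \<cdot> p l))"
      using \<gamma>(1) \<beta>(1) io(1)[OF l] cone_hom(2)[OF l] by (simp add: Hom_def)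
    then show "(\<gamma> \<cdot> (\<beta> \<cdot> \<iota> l)) \<cdot> p l = \<iota> l \<cdot> p l" using \<beta>p[OF l] \<gamma>(2) io(3)[OF l] by simp
    show "orthogonal (SigO T (K t l)) HV" using oH[OF sig[OF KS[OF l]]] .
  qed
  have ga: "\<gamma> \<in> Arr T" "Dom T \<gamma> = ?L" "Cod T \<gamma> = HV" using \<gamma>(1) by (auto simp: Hom_def)
  obtain g h where tg: "(\<gamma>, g, h) \<in> Tri T" using Tri_cone[OF ga(1)] by blast
  note dg = TriD[OF tg]
  have gH: "g \<in> Hom T HV (Cod T g)" using dg ga by (simp add: Hom_def)
  have "zero_object T (Cod T g)"
  proof (rule zero_object_if_compact_orthogonal[OF cg])
    show "Cod T g \<in> Obj T" using dg by simp
    fix C assume C: "compact TYPE('u) T C"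
    have Co: "C \<in> Obj T" using compact_obj[OF C] .
    show "orthogonal C (Cod T g)"
      unfolding orthogonal_def
    proof
      fix f assume f: "f \<in> Hom T C (Cod T g)"
      have mono: "b = Zer T D ?L" if b: "b \<in> Hom T D ?L" "\<gamma> \<cdot> b = Zer T D HV" for b D
        using cmp_reduce[OF bg b(1) \<gamma>(1) \<beta>(1)] b zer_hom[OF \<beta>(1) hom_obj(1)[OF b(1)]] by (simp add: Hom_def)
      obtain f' where f': "f' \<in> Hom T C HV" "g \<cdot> f' = f"
        by (rule lift_to_middle[OF tg \<gamma>(1) gH f]) (use mono in blast)+
      obtain N \<phi> where N: "N \<ge> 1" "\<phi> \<in> Hom T C (V N)" "f' = \<iota> N \<cdot> \<phi>"
        using hocolim_compact_factor[OF un hV cone_hom(4) C f'(1)] by metis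
      let ?k = "(\<beta> \<cdot> \<iota> N) \<cdot> \<phi>"
      have bi: "\<beta> \<cdot> \<iota> N \<in> Hom T (V N) ?L" using \<beta>(1) io(1)[OF N(1)] by (simp add: Hom_def)
      have k: "?k \<in> Hom T C ?L" using bi N(2) cmp_Hom[OF tri] by blast
      have "\<gamma> \<cdot> ?k = f'" using cmp_reduce[OF gb[OF N(1)] N(2) bi \<gamma>(1)] N(3) by simp
      moreover have "g \<cdot> (\<gamma> \<cdot> ?k) = Zer T ?L (Cod T g) \<cdot> ?k"
        by (rule cmp_reduce[OF _ k \<gamma>(1)]) (use Tri_cmp[OF tg] dg ga in \<open>simp_all add: Hom_def\<close>)
      ultimately show "f = Zer T C (Cod T g)" using f'(2) hom_zer[OF k] dg by simp
    qed
  qed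
  then have "isomorphism T ?L HV \<gamma>" using iso_if_zero_cone[OF tg] ga by simp
  then obtain k where k: "k \<in> Hom T HV ?L" "k \<cdot> \<gamma> = Idn T ?L" "\<gamma> \<cdot> k = Idn T HV"
    unfolding isomorphism_def by blast
  have "k = (\<beta> \<cdot> \<gamma>) \<cdot> k" using bg k(1) by (simp add: Hom_def)
  also have "\<dots> = \<beta>" using k(1,3) \<beta>(1) ga by (simp add: Hom_def)
  finally have "isomorphism T HV ?L \<beta>" using k \<beta>(1) \<gamma>(1) bg unfolding isomorphism_def by blast
  then show ?thesis using that \<beta>p by blast
qed

end

end

theorem theorem3p3:
  fixes R :: "'r graded_ring"
    and T :: "('o, 'm) tri_cat"
    and act :: "int \<Rightarrow> 'r \<Rightarrow> 'o \<Rightarrow> 'm"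
    and M :: 'o
    and t :: nat
    and d :: "nat \<Rightarrow> int"
    and x :: "nat \<Rightarrow> 'r"
    and Kz :: "nat \<Rightarrow> nat \<Rightarrow> 'o"
    and kv kw u :: "nat \<Rightarrow> nat \<Rightarrow> 'm"
    and V :: "nat \<Rightarrow> 'o"
    and p q v :: "nat \<Rightarrow> 'm"
    and HK HV :: 'o
    and \<iota>K \<iota>V :: "nat \<Rightarrow> 'm"
    and \<Gamma> L :: "('o, 'm) func"
    and \<epsilon> \<eta> :: "'o \<Rightarrow> 'm"
  assumes "uncountable (UNIV :: 'u set)"
    and "graded_commutative R" and "graded_noetherian R"
    and "triangulated T" and "compactly_generated TYPE('u) T" and "linear_action T R act"
    and "M \<in> Obj T"
    and "t \<ge> 1" and "\<And>i. i \<in> {1..t} \<Longrightarrow> x i \<in> gr R (d i)"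
    and "koszul_objects T R act d x t M Kz kv kw"
    and "koszul_maps T R act d x t M Kz kv kw u"
    and "cone_system T M (koszul_canonical T M kw t) (u t) V p q v"
    and "hocolim T (desusp_koszul T Kz t) (u t) HK \<iota>K"
    and "hocolim T V v HV \<iota>V"
    and "local_cohomology TYPE('u) T R act (closed_set R (Idl\<^bsub>R\<^esub> (x ` {1..t}))) \<Gamma> \<epsilon> L \<eta>"
  shows "\<exists>\<phi> \<psi>. isomorphism T HV (onO L M) \<phi> \<and> isomorphism T HK (onO \<Gamma> M) \<psi> \<and>
           (\<forall>l \<ge> 1.
              \<epsilon> M \<cdot>\<^bsub>T\<^esub> (\<psi> \<cdot>\<^bsub>T\<^esub> \<iota>K l) = koszul_canonical T M kw t l \<and>
              \<phi> \<cdot>\<^bsub>T\<^esub> (\<iota>V l \<cdot>\<^bsub>T\<^esub> p l) = \<eta> M)"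
proof -
  interpret koszul_system T R act M t d x Kz kv kw u
    by unfold_locales (use assms in auto)
  note un = assms(1) and cg = assms(5) and hK = assms(13)
  obtain \<delta> where lc: "coreflection T (supp TYPE('u)) \<Gamma> \<epsilon>" "localization_functor T L \<eta>"
    and tr: "\<And>N. N \<in> Obj T \<Longrightarrow> (\<epsilon> N, \<eta> N, \<delta> N) \<in> Tri T"
    using assms(15) unfolding local_cohomology_def by blast
  have eta: "Cod T (\<eta> M) = onO L M"
    using lc(2) M unfolding localization_functor_def nat_trans_def Hom_def by blast
  note e = coreflectionD(2)[OF lc(1) M]
  obtain \<phi> where \<phi>: "isomorphism T HV (onO L M) \<phi>" "\<And>l. l \<ge> 1 \<Longrightarrow> \<phi> \<cdot>\<^bsub>T\<^esub> (\<iota>V l \<cdot>\<^bsub>T\<^esub> p l) = \<eta> M"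
    using cone_hocolim_iso[OF assms(12,14) un cg lc(1) tr] eta by metis
  have uh: "u t n \<in> Hom T (K t n) (K t (n + 1))" if "n \<ge> 1" for n using u_hom[OF that] by simp
  obtain \<alpha> where \<alpha>: "\<alpha> \<in> Hom T HK M" "\<And>l. l \<ge> 1 \<Longrightarrow> \<alpha> \<cdot>\<^bsub>T\<^esub> \<iota>K l = can t l"
    by (rule hocolim_out[OF hK uh M, of "can t"]) (use can_hom can_u in auto)
  have "\<alpha> \<in> Arr T" using \<alpha>(1) by (simp add: Hom_def)
  then obtain g h where tg: "(\<alpha>, g, h) \<in> Tri T" using Tri_cone by blast
  have W: "Cod T g \<in> Obj T" using TriD[OF tg] by simp
  have HS: "HK \<in> supp TYPE('u)"
    by (rule hocolim_localizing[OF un hK uh supp_localizing(1)]) (use koszul_supported[OF cg lc(1) tr] in auto)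
  have orth: "orthogonal X (Cod T g)" if "X \<in> supp TYPE('u)" for X
    by (rule supp_orthogonal[OF W koszul_hocolim_cone_orthogonal[OF un hK \<alpha> tg] that])
  obtain \<psi> where \<psi>: "isomorphism T HK (onO \<Gamma> M) \<psi>" "\<epsilon> M \<cdot>\<^bsub>T\<^esub> \<psi> = \<alpha>"
    using coreflection_iso[OF supp_localizing(1) lc(1) M HS \<alpha>(1) tg orth] by metis
  have "\<epsilon> M \<cdot>\<^bsub>T\<^esub> (\<psi> \<cdot>\<^bsub>T\<^esub> \<iota>K l) = can t l" if l: "l \<ge> 1" for l
    using cmp_reduce[OF \<psi>(2) hocolim_inc(1)[OF hK uh l] _ e] \<psi>(1) \<alpha>(2)[OF l] by (simp add: isomorphism_def)
  then show ?thesis using \<phi> \<psi>(1) by blast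
qed

end
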